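(* Let $k\ge 2$, and let $\psi^{DV}(u)$ be the $k$-th order De Vylder type approximation of the ruin probability $\psi(u)$: it is the ruin probability of a compound Poisson reserve model $(U^{DV}_t)$ such that $\mathbb{E}[(U_t(u))^j]=\mathbb{E}[(U^{DV}_t(u))^j]$ for all $j=1,\dots,k$, $t\ge 0$ and $u\ge 0$. Suppose that both reserve models $(U_t)$ and $(U^{DV}_t)$ satisfy the following assumptions, written here for $(U_t)$ and analogously for $(U^{DV}_t)$: (A1) there exists $R>0$ with $\int_0^\infty e^{Rx}\frac{f_I(x)}{1+\theta}\,dx=1$; (A2) $m_k^{\exp}:=\int_0^\infty x^k e^{Rx}\frac{f_I(x)}{1+\theta}\,dx<\infty$; (A3) $h_I:=\sup_{x\ge 0} f_I(x)/\overline F_I(x)<\infty$. Denote the adjustment coefficients of the two models by $R$ and $R^{DV}$. Then, for $u\ge0$ and $\theta>0$ in a bounded interval, $$\psi(u)-\psi^{DV}(u)=\mathcal O(\theta+\theta^k u)\,\exp\big(-(R\wedge R^{DV})u\big)=\mathcal O(\theta+\theta^k u)\,\exp\Big(-\Big|\frac{2m_1}{m_2}\theta+\mathcal O(\theta^2)\Big|u\Big),$$ and, for the relative error, $$\frac{\psi(u)-\psi^{DV}(u)}{\psi(u)}=\mathcal O(\theta+\theta^k u)\,\exp\big(\mathcal O(\theta^k u)\,\mathbf 1_{R>R^{DV}}\big).$$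
   Context: Reserve model: $U_t=U_t(u)=u+ct-\sum_{i=1}^{N_t}Z_i$, where $u\ge0$ is the initial reserve, $c>0$ is the premium per unit time, $(N_t)_{t\ge0}$ is a Poisson process of intensity $\lambda>0$, and $(Z_i)_{i\ge1}$ are positive i.i.d. random variables, independent of $(N_t)$, with cumulative distribution function $F$ of unbounded support. Write $m_j:=\mathbb E(Z_1^j)$ and $\overline\Phi:=1-\Phi$ for any distribution function $\Phi$. Set $f_I(x):=\overline F(x)/m_1$, $F_I(x):=\int_0^x f_I(y)\,dy$, and $\theta:=\frac{c}{\lambda m_1}-1$ (safety loading coefficient). The time of ruin is $T(u):=\inf\{t\ge0:U_t<0\}$ and the ruin probability is $\psi(u):=\mathbb P(T(u)<\infty)$. The model $(U^{DV}_t)$ is of the same form, with the same initial reserve $u$, and with all parameters and derived quantities defined in the same way and carrying the superscript $DV$ ($c^{DV},\lambda^{DV},F^{DV},m_j^{DV},\theta^{DV},f_I^{DV},F_I^{DV},R^{DV},\psi^{DV},\dots$). No particular form of the claim distribution $F^{DV}$ is assumed. Dependence on $\theta$: $\lambda$ and $F$ are fixed and $\theta$ varies through $c=(1+\theta)\lambda m_1$; the quantities $\psi,R,m_k^{\exp}$ depend implicitly on $\theta$. The moments $m_j^{DV}$ do not depend on $\theta$, and $\theta^{DV}$ depends linearly on $\theta$. Notation $\mathcal O$: $a(u,\theta)=\mathcal O(b(u,\theta))$ means that there is a constant $C\ge0$, independent of $(u,\theta)$, with $|a(u,\theta)|\le C|b(u,\theta)|$ for all $u\ge0$ and all $\theta>0$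 in a bounded interval. The constant $C$ may depend on the $m_j$'s, $m_k^{\exp}$ and $h_I$ and on the corresponding quantities of the approximating model (these are treated as constants, i.e. bounded over the range of $\theta$). An expression $\mathcal O(b)$ inside a formula stands for some function of $(u,\theta)$ (possibly signed) that is $\mathcal O(b)$. Also $x\wedge y=\min(x,y)$, and $\mathbf 1_{x>y}$ equals $1$ if $x>y$ and $0$ otherwise. *)

theory Defs
  imports "HOL-Probability.Probability"
begin

definition poisson_process :: "'a measure \<Rightarrow> real \<Rightarrow> (real \<Rightarrow> 'a \<Rightarrow> nat) \<Rightarrow> bool" where
  "poisson_process M lam N \<longleftrightarrow>
     (\<forall>t\<ge>0. N t \<in> measurable M (count_space UNIV)) \<and>
     (\<forall>\<omega>\<in>space M. N 0 \<omega> = 0 \<and> mono_on {0..} (\<lambda>t. N t \<omega>) \<and>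
        (\<forall>t\<ge>0. ((\<lambda>s. N s \<omega>) \<longlongrightarrow> N t \<omega>) (at_right t))) \<and>
     (\<forall>(t :: nat \<Rightarrow> real) n. 0 \<le> t 0 \<and> mono t \<longrightarrow>
        prob_space.indep_vars M (\<lambda>_. count_space UNIV)
          (\<lambda>i \<omega>. N (t (Suc i)) \<omega> - N (t i) \<omega>) {..<n}) \<and>
     (\<forall>s t. 0 \<le> s \<and> s < t \<longrightarrow>
        distr M (count_space UNIV) (\<lambda>\<omega>. N t \<omega> - N s \<omega>) =
        measure_pmf (poisson_pmf (lam * (t - s))))"

record 'a reserve_model =
  sample :: "'a measure"
  premium :: real
  intensity :: real
  arrivals :: "real \<Rightarrow> 'a \<Rightarrow> nat"
  claim :: "nat \<Rightarrow> 'a \<Rightarrow> real"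

text \<open>Claims are numbered from zero, so \<open>claim X i\<close> is the claim $Z_{i+1}$. The initial reserve
  \<open>u\<close> is an argument of the quantities below rather than a field of the record.\<close>

definition claim_cdf :: "'a reserve_model \<Rightarrow> real \<Rightarrow> real" where
  "claim_cdf X = cdf (distr (sample X) borel (claim X 0))"

definition compound_poisson_model :: "'a reserve_model \<Rightarrow> bool" where
  "compound_poisson_model X \<longleftrightarrow>
     prob_space (sample X) \<and> premium X > 0 \<and> intensity X > 0 \<and>
     poisson_process (sample X) (intensity X) (arrivals X) \<and>
     prob_space.indep_vars (sample X) (\<lambda>_. borel) (claim X) UNIV \<and>
     (\<forall>i. distr (sample X) borel (claim X i) = distr (sample X) borel (claim X 0)) \<and>
     (\<forall>i. AE \<omega> in sample X. claim X i \<omega> > 0) \<and>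
     prob_space.indep_var (sample X)
       (PiM {0..} (\<lambda>_. count_space UNIV)) (\<lambda>\<omega>. \<lambda>t\<in>{0..}. arrivals X t \<omega>)
       (PiM UNIV (\<lambda>_. borel)) (\<lambda>\<omega> i. claim X i \<omega>) \<and>
     (\<forall>x. claim_cdf X x < 1)"

definition reserve :: "'a reserve_model \<Rightarrow> real \<Rightarrow> real \<Rightarrow> 'a \<Rightarrow> real" where
  "reserve X u t \<omega> = u + premium X * t - (\<Sum>i<arrivals X t \<omega>. claim X i \<omega>)"

definition ruin_time :: "'a reserve_model \<Rightarrow> real \<Rightarrow> 'a \<Rightarrow> ereal" where
  "ruin_time X u \<omega> = Inf {ereal t | t. t \<ge> 0 \<and> reserve X u t \<omega> < 0}"

definition ruin_prob :: "'a reserve_model \<Rightarrow> real \<Rightarrow> real" where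
  "ruin_prob X u = measure (sample X) {\<omega> \<in> space (sample X). ruin_time X u \<omega> < \<infinity>}"

definition claim_moment :: "'a reserve_model \<Rightarrow> nat \<Rightarrow> real" where
  "claim_moment X j = (\<integral>\<omega>. claim X 0 \<omega> ^ j \<partial>sample X)"

definition reserve_moment :: "'a reserve_model \<Rightarrow> real \<Rightarrow> real \<Rightarrow> nat \<Rightarrow> real" where
  "reserve_moment X u t j = (\<integral>\<omega>. reserve X u t \<omega> ^ j \<partial>sample X)"

definition safety_loading :: "'a reserve_model \<Rightarrow> real" where
  "safety_loading X = premium X / (intensity X * claim_moment X 1) - 1"

definition f_I :: "'a reserve_model \<Rightarrow> real \<Rightarrow> real" where
  "f_I X x = (1 - claim_cdf X x) / claim_moment X 1"

definition F_I :: "'a reserve_model \<Rightarrow> real \<Rightarrow> real" where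
  "F_I X x = (LBINT y:{0..x}. f_I X y)"

text \<open>Integrals of nonnegative functions that may diverge, and suprema that may be infinite, are
  taken in \<^typ>\<open>ennreal\<close>.\<close>

definition is_adjustment_coeff :: "'a reserve_model \<Rightarrow> real \<Rightarrow> bool" where
  "is_adjustment_coeff X r \<longleftrightarrow>
     r > 0 \<and> (\<integral>\<^sup>+x\<in>{0..}. ennreal (exp (r * x) * (f_I X x / (1 + safety_loading X))) \<partial>lborel) = 1"

text \<open>The integral is strictly increasing in \<open>r\<close> where it is finite, so there is at most one
  adjustment coefficient.\<close>

definition adjustment_coeff :: "'a reserve_model \<Rightarrow> real" where
  "adjustment_coeff X = (THE r. is_adjustment_coeff X r)"

definition exp_moment :: "'a reserve_model \<Rightarrow> nat \<Rightarrow> ennreal" where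
  "exp_moment X k =
     (\<integral>\<^sup>+x\<in>{0..}. ennreal (x ^ k * exp (adjustment_coeff X * x) *
        (f_I X x / (1 + safety_loading X))) \<partial>lborel)"

definition h_I :: "'a reserve_model \<Rightarrow> ennreal" where
  "h_I X = (SUP x\<in>{0..}. ennreal (f_I X x / (1 - F_I X x)))"

definition model_assumptions :: "nat \<Rightarrow> 'a reserve_model \<Rightarrow> bool" where
  "model_assumptions k X \<longleftrightarrow>
     (\<exists>r. is_adjustment_coeff X r) \<and> exp_moment X k < \<infinity> \<and> h_I X < \<infinity>"

text \<open>\<open>Y\<close> is a model whose ruin probability is a De Vylder type approximation of order \<open>k\<close>.\<close>

definition de_vylder_model :: "nat \<Rightarrow> 'a reserve_model \<Rightarrow> 'b reserve_model \<Rightarrow> bool" where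
  "de_vylder_model k X Y \<longleftrightarrow> compound_poisson_model Y \<and>
     (\<forall>j\<in>{1..k}. \<forall>t\<ge>0. \<forall>u\<ge>0. reserve_moment X u t j = reserve_moment Y u t j)"

definition unif_bigo :: "real set \<Rightarrow> (real \<Rightarrow> real \<Rightarrow> real) \<Rightarrow> (real \<Rightarrow> real \<Rightarrow> real) \<Rightarrow> bool" where
  "unif_bigo I a b \<longleftrightarrow> (\<exists>C\<ge>0. \<forall>u\<ge>0. \<forall>\<theta>\<in>I. \<bar>a u \<theta>\<bar> \<le> C * \<bar>b u \<theta>\<bar>)"

end

theory Submission
  imports Defs
begin

text \<open>Put \<open>K u = exp (R * u) * \<psi> u\<close>. The theorem rests on one estimate: \<open>K u = 1 + O(R)\<close> uniformly in \<open>u\<close>,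
together with a positive lower bound for \<open>K\<close>. The adjustment coefficients of the two models are
\<open>O(\<theta>)\<close> and differ by \<open>O(\<theta>^k)\<close>, so the difference of two functions \<open>(1 + O(\<theta>)) * exp (- R * u)\<close>
has the asserted form (\<open>exp_decay_difference\<close>), and dividing by \<open>K\<close> gives the relative error.

\<^bold>\<open>The estimate for K.\<close> Suppose first that claims and arrivals are independent. The defective renewal
equation of the ruin probability becomes \<open>K = z + K * g\<close> (\<open>K_renewal\<close>), where
\<open>g x = exp (R * x) * f_I x / (1 + \<theta>)\<close> is a probability density by (A1) and \<open>z\<close> is the tail of \<open>F_I\<close>,
multiplied by \<open>exp (R * u) / (1 + \<theta>)\<close>. The constant \<open>1\<close> solves the same equation with the tail of \<open>g\<close> in
place of \<open>z\<close>, and these two inhomogeneous terms differ by at most \<open>R\<close> times the tail moment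
\<open>\<integral>x\<ge>u. x * g x\<close>. Assumption (A3) bounds the hazard rate of \<open>g\<close>, hence its renewal density, so that a
perturbation \<open>d\<close> of the inhomogeneous term moves the solution by at most \<open>d u + h_I * (\<integral>v\<le>u. d v)\<close>;
by (A2) with \<open>k \<ge> 2\<close> the tail moment has a finite integral (\<open>renewal_majorant\<close>). This gives
\<open>K \<ge> 1 - O(R)\<close> (\<open>K_near_1\<close>). A perturbation that lives only beyond a large level keeps \<open>K\<close> away from \<open>0\<close>
for all \<open>\<theta>\<close> in the interval, not only for small ones (\<open>K_uniformly_positive\<close>). The bound \<open>K \<le> 1\<close> is
Lundberg's inequality.

\<^bold>\<open>The renewal equation.\<close> On a grid of mesh \<open>h\<close> the reserve is a random walk with compound Poisson steps.
Conditioning on its first step gives, up to \<open>O(h^2)\<close>, an equation in which at most one claim occurs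
(\<open>grid_psi_one_step\<close>). Integration over \<open>[0, u]\<close> turns the difference quotient of \<open>\<psi>\<close> into an increment, and
\<open>h \<rightarrow> 0\<close> through dyadic meshes gives an integral equation for \<open>\<psi>\<close>
(\<open>discretized_backward_equation_limit\<close>). Fubini's theorem turns it into the renewal equation, and
\<open>\<psi> \<rightarrow> 0\<close> at infinity, again by Lundberg's inequality, fixes the constant.

\<^bold>\<open>Independence.\<close> In \<^const>\<open>compound_poisson_model\<close> the arrival path that is assumed independent of the
claims is a sequence of type \<^typ>\<open>nat \<Rightarrow> real\<close>: it consists of the arrivals at integer times. Only the
reserve at integer times is therefore a random walk of known law. This suffices. Since the reserve
cannot grow by more than the premium \<open>c\<close> in a unit of time, \<open>\<psi> u\<close> lies between the ruin probabilities of
this walk from \<open>u\<close> and from \<open>u - c\<close>, and the walk has the same law in the model whose claims are replaced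
by an independent copy (\<open>indep_copy\<close>). The shift by \<open>c\<close> costs a factor \<open>exp (R * c) = 1 + O(\<theta>)\<close>.

\<^bold>\<open>The adjustment coefficients.\<close> The moments of the reserve at time \<open>1\<close> up to order \<open>k\<close> determine its first
\<open>k\<close> cumulants, which are the drift \<open>c - \<lambda> * m_1\<close> and \<open>\<plusminus> \<lambda> * m_j\<close> (\<open>cumulants_match\<close>). Expanding the equation
that defines \<open>R\<close> to order \<open>k\<close> involves just these numbers, with a remainder controlled by (A2), so both
coefficients solve the same polynomial equation up to \<open>O(\<theta>^k)\<close> (\<open>truncated_equation_roots\<close>).\<close>

section \<open>Renewal inequalities for densities of bounded hazard rate\<close>

text \<open>The two moment bounds share the constant \<open>B\<close> because both will come from a single moment of higher order.\<close>

locale bounded_hazard_density =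
  fixes g :: "real \<Rightarrow> real" and H B :: real
  assumes measurable_g [measurable]: "g \<in> borel_measurable borel"
    and g_nonneg: "\<And>x. 0 \<le> g x"
    and g_neg: "\<And>x. x < 0 \<Longrightarrow> g x = 0"
    and g_total: "(\<integral>\<^sup>+x. ennreal (g x) \<partial>lborel) = 1"
    and g_tail_pos: "\<And>u. 0 < (\<integral>x. g x * indicator {u<..} x \<partial>lborel)"
    and hazard: "\<And>x. 0 \<le> x \<Longrightarrow> g x \<le> H * (\<integral>y. g y * indicator {x<..} y \<partial>lborel)"
    and H_nonneg: "0 \<le> H"
    and B_nonneg: "0 \<le> B"
    and first_moment: "(\<integral>\<^sup>+x. ennreal (x * g x) \<partial>lborel) \<le> ennreal B"
    and second_moment: "(\<integral>\<^sup>+x. ennreal (x\<^sup>2 * g x) \<partial>lborel) \<le> ennreal B"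
begin

lemma integrable_g: "integrable lborel g"
  using g_total g_nonneg by (intro integrableI_nonneg) auto

lemma integral_g: "integral\<^sup>L lborel g = 1"
  using g_total g_nonneg by (subst integral_eq_nn_integral) auto

definition cdf_g :: "real \<Rightarrow> real" where
  "cdf_g u = (\<integral>x. g x * indicator {..u} x \<partial>lborel)"

lemma integrable_g_times:
  assumes [measurable]: "f \<in> borel_measurable borel" and "\<And>x. \<bar>f x\<bar> \<le> b"
  shows "integrable lborel (\<lambda>x. f x * g x)"
proof (rule Bochner_Integration.integrable_bound[of _ "\<lambda>x. b * g x"])
  show "integrable lborel (\<lambda>x. b * g x)" using integrable_g by simp
  show "AE x in lborel. norm (f x * g x) \<le> norm (b * g x)"
  proof (rule AE_I2)
    fix x
    have "\<bar>f x\<bar> * \<bar>g x\<bar> \<le> \<bar>b\<bar> * \<bar>g x\<bar>"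
      using assms(2)[of x] by (intro mult_right_mono) auto
    then show "norm (f x * g x) \<le> norm (b * g x)" by (simp add: abs_mult)
  qed
qed measurable

lemma tail_eq: "(\<integral>x. g x * indicator {u<..} x \<partial>lborel) = 1 - cdf_g u"
proof -
  have i1: "integrable lborel (\<lambda>x. g x * indicator {..u} x)"
    and i2: "integrable lborel (\<lambda>x. g x * indicator {u<..} x)"
    using integrable_g_times[of "indicator {..u}" 1] integrable_g_times[of "indicator {u<..}" 1]
    by (auto simp: mult.commute)
  have "1 = (\<integral>x. g x * indicator {..u} x + g x * indicator {u<..} x \<partial>lborel)"
    unfolding integral_g[symmetric] by (intro Bochner_Integration.integral_cong) (auto simp: indicator_def)
  also have "\<dots> = cdf_g u + (\<integral>x. g x * indicator {u<..} x \<partial>lborel)"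
    unfolding cdf_g_def using i1 i2 by simp
  finally show ?thesis by simp
qed

lemma cdf_g_lt_1: "cdf_g u < 1"
  using g_tail_pos[of u] tail_eq[of u] by simp

lemma cdf_g_nonneg: "0 \<le> cdf_g u"
  unfolding cdf_g_def using g_nonneg by (intro integral_nonneg_AE) (auto simp: indicator_def)

lemma nn_cdf_g: "(\<integral>\<^sup>+x. ennreal (g x * indicator {..u} x) \<partial>lborel) = ennreal (cdf_g u)"
  unfolding cdf_g_def using integrable_g_times[of "indicator {..u}" 1] g_nonneg
  by (intro nn_integral_eq_integral) (auto simp: mult.commute)

lemma measurable_cdf_g [measurable]: "cdf_g \<in> borel_measurable borel"
proof -
  have *: "cdf_g = (\<lambda>u. \<integral>x. g x * (if x \<le> u then 1 else 0) \<partial>lborel)"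
    by (rule ext) (auto simp: cdf_g_def indicator_def intro!: Bochner_Integration.integral_cong)
  show ?thesis unfolding * by measurable
qed

definition conv :: "(real \<Rightarrow> real) \<Rightarrow> real \<Rightarrow> real" where
  "conv w u = (\<integral>x. w (u - x) * g x \<partial>lborel)"

text \<open>On \<open>[0, u]\<close> a convolution with \<open>g\<close> multiplies an upper bound by at most \<open>cdf_g u < 1\<close>; iterating drives
the bound to \<open>0\<close>.\<close>

lemma subharmonic_nonpos:
  assumes [measurable]: "w \<in> borel_measurable borel"
    and bd: "\<And>v. \<bar>w v\<bar> \<le> b" and neg: "\<And>v. v < 0 \<Longrightarrow> w v = 0"
    and sub: "\<And>v. 0 \<le> v \<Longrightarrow> w v \<le> conv w v"
    and u: "0 \<le> u"
  shows "w u \<le> 0"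
proof -
  define \<gamma> where "\<gamma> = cdf_g u"
  have \<gamma>: "0 \<le> \<gamma>" "\<gamma> < 1" by (auto simp: \<gamma>_def cdf_g_lt_1 cdf_g_nonneg)
  have b: "0 \<le> b" using bd[of 0] by linarith
  have iter: "\<forall>v\<le>u. w v \<le> b * \<gamma> ^ n" for n
  proof (induction n)
    case 0
    then show ?case using bd by (simp add: abs_le_iff)
  next
    case (Suc n)
    show ?case
    proof (intro allI impI)
      fix v assume v: "v \<le> u"
      have nn: "0 \<le> b * \<gamma> ^ Suc n" using b \<gamma> by simp
      show "w v \<le> b * \<gamma> ^ Suc n"
      proof (cases "v < 0")
        case True then show ?thesis using neg nn by simp
      next
        case False
        then have "w v \<le> conv w v" using sub by simp
        also have "\<dots> \<le> (\<integral>x. (b * \<gamma> ^ n) * (g x * indicator {..u} x) \<partial>lborel)"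
          unfolding conv_def
        proof (rule integral_mono)
          show "integrable lborel (\<lambda>x. w (v - x) * g x)"
            by (rule integrable_g_times[of _ b]) (auto intro: bd)
          show "integrable lborel (\<lambda>x. (b * \<gamma> ^ n) * (g x * indicator {..u} x))"
            using integrable_g_times[of "indicator {..u}" 1] by (auto simp: mult.commute)
          fix x
          consider "x < 0" | "0 \<le> x" "x \<le> u" | "x > u" by linarith
          then show "w (v - x) * g x \<le> b * \<gamma> ^ n * (g x * indicator {..u} x)"
          proof cases
            case 1 then show ?thesis by (simp add: g_neg)
          next
            case 2
            then have "w (v - x) \<le> b * \<gamma> ^ n" using Suc.IH v by auto
            then show ?thesis using 2 g_nonneg[of x] by (simp add: mult_right_mono)
          next
            case 3 then show ?thesis using v neg[of "v - x"] by simp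
          qed
        qed
        also have "\<dots> = b * \<gamma> ^ Suc n" by (simp add: \<gamma>_def cdf_g_def)
        finally show ?thesis .
      qed
    qed
  qed
  have "(\<lambda>n. b * \<gamma> ^ n) \<longlonglongrightarrow> b * 0"
    using \<gamma> by (intro tendsto_mult tendsto_const LIMSEQ_power_zero) auto
  then show ?thesis using iter by (intro LIMSEQ_le_const[of _ 0]) auto
qed

text \<open>The inhomogeneous term used below. Its integral over \<open>v\<close> is the second moment of \<open>g\<close>.\<close>

definition moment_tail :: "real \<Rightarrow> real" where
  "moment_tail v = (\<integral>x. x * g x * indicator {v..} x \<partial>lborel) * indicator {0..} v"

lemma xg_nonneg: "0 \<le> x * g x"
  using g_nonneg[of x] g_neg[of x] by (cases "x < 0") auto

lemma integrable_xg: "integrable lborel (\<lambda>x. x * g x)"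
  using first_moment xg_nonneg by (intro integrableI_nonneg) (auto simp: less_top[symmetric] top_unique)

lemma integrable_xg_ind: "integrable lborel (\<lambda>x. x * g x * indicator {v..} x)"
  by (rule Bochner_Integration.integrable_bound[OF integrable_xg])
     (auto simp: indicator_def)

lemma measurable_moment_tail [measurable]: "moment_tail \<in> borel_measurable borel"
proof -
  have *: "moment_tail = (\<lambda>v. (\<integral>x. x * g x * (if v \<le> x then 1 else 0) \<partial>lborel) * indicator {0..} v)"
    unfolding moment_tail_def
    by (intro ext arg_cong2[where f=times] Bochner_Integration.integral_cong refl) (auto simp: indicator_def)
  show ?thesis unfolding * by measurable
qed

lemma moment_tail_nonneg: "0 \<le> moment_tail v"
  unfolding moment_tail_def using xg_nonneg
  by (intro mult_nonneg_nonneg integral_nonneg_AE) (auto simp: indicator_def)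

lemma moment_tail_le: "moment_tail v \<le> B"
proof -
  have "integral\<^sup>L lborel (\<lambda>x. x * g x) \<le> B"
    using first_moment B_nonneg xg_nonneg by (subst integral_eq_nn_integral) (auto intro: enn2real_leI)
  moreover have "(\<integral>x. x * g x * indicator {v..} x \<partial>lborel) \<le> integral\<^sup>L lborel (\<lambda>x. x * g x)"
    using integrable_xg integrable_xg_ind xg_nonneg
    by (intro integral_mono) (auto simp: indicator_def)
  ultimately show ?thesis using B_nonneg by (auto simp: moment_tail_def indicator_def)
qed

lemma nn_integral_moment_tail: "(\<integral>\<^sup>+v. ennreal (moment_tail v) \<partial>lborel) \<le> ennreal B"
proof -
  have "(\<integral>\<^sup>+v. ennreal (moment_tail v) \<partial>lborel) =
      (\<integral>\<^sup>+v. (\<integral>\<^sup>+x. ennreal (x * g x * (if 0 \<le> v \<and> v \<le> x then 1 else 0)) \<partial>lborel) \<partial>lborel)"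
  proof (rule nn_integral_cong)
    fix v :: real
    have "ennreal (moment_tail v) =
        (\<integral>\<^sup>+x. ennreal (x * g x * indicator {v..} x) \<partial>lborel) * indicator {0..} v"
      unfolding moment_tail_def using integrable_xg_ind xg_nonneg
      by (subst nn_integral_eq_integral) (auto simp: indicator_def)
    also have "\<dots> = (\<integral>\<^sup>+x. ennreal (x * g x * indicator {v..} x) * indicator {0..} v \<partial>lborel)"
      by (subst nn_integral_multc) auto
    also have "\<dots> = (\<integral>\<^sup>+x. ennreal (x * g x * (if 0 \<le> v \<and> v \<le> x then 1 else 0)) \<partial>lborel)"
      by (intro nn_integral_cong) (auto simp: indicator_def)
    finally show "ennreal (moment_tail v) = \<dots>" .
  qed
  also have "\<dots> = (\<integral>\<^sup>+x. (\<integral>\<^sup>+v. ennreal (x * g x * (if 0 \<le> v \<and> v \<le> x then 1 else 0)) \<partial>lborel) \<partial>lborel)"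
    by (rule lborel_pair.Fubini') measurable
  also have "\<dots> = (\<integral>\<^sup>+x. ennreal (x\<^sup>2 * g x) \<partial>lborel)"
  proof (rule nn_integral_cong)
    fix x :: real
    have "(\<integral>\<^sup>+v. ennreal (x * g x * (if 0 \<le> v \<and> v \<le> x then 1 else 0)) \<partial>lborel) =
        (\<integral>\<^sup>+v. ennreal (x * g x) * indicator {0..x} v \<partial>lborel)"
      by (intro nn_integral_cong) (auto simp: indicator_def)
    also have "\<dots> = ennreal (x * g x) * emeasure lborel {0..x}"
      by (simp add: nn_integral_cmult)
    also have "\<dots> = ennreal (x\<^sup>2 * g x)"
      using xg_nonneg[of x] g_neg[of x]
      by (cases "x < 0") (auto simp: ennreal_mult[symmetric] power2_eq_square mult_ac)
    finally show "(\<integral>\<^sup>+v. ennreal (x * g x * (if 0 \<le> v \<and> v \<le> x then 1 else 0)) \<partial>lborel) = ennreal (x\<^sup>2 * g x)" .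
  qed
  also have "\<dots> \<le> ennreal B" by (rule second_moment)
  finally show ?thesis .
qed

definition primitive :: "(real \<Rightarrow> real) \<Rightarrow> real \<Rightarrow> real" where
  "primitive d v = (\<integral>y. d y * indicator {..v} y \<partial>lborel)"

text \<open>The function \<open>S = d + H * primitive d\<close> satisfies \<open>d + S * g \<le> S\<close>. By Fubini the convolution of
\<open>primitive d\<close> with \<open>g\<close> is \<open>\<integral>d y * cdf_g (u - y)\<close>, while the hazard bound \<open>g \<le> H * (1 - cdf_g)\<close> gives
\<open>d * g \<le> H * \<integral>d y * (1 - cdf_g (u - y))\<close>; the two add up to \<open>H * primitive d u\<close>. In effect the renewal
density of \<open>g\<close> is at most \<open>H\<close>.\<close>

lemma conv_supersolution:
  assumes [measurable]: "d \<in> borel_measurable borel" and d: "integrable lborel d"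
    and nonneg: "\<And>v. 0 \<le> d v" and neg: "\<And>v. v < 0 \<Longrightarrow> d v = 0" and bd: "\<And>v. d v \<le> b"
  shows "conv (\<lambda>v. d v + H * primitive d v) u \<le> H * primitive d u"
proof -
  have int_d: "integrable lborel (\<lambda>y. d y * indicator {..v} y)" for v
    by (rule Bochner_Integration.integrable_bound[OF d]) (auto simp: indicator_def)
  have nn_prim: "ennreal (primitive d v) = (\<integral>\<^sup>+y. ennreal (d y * indicator {..v} y) \<partial>lborel)" for v
    unfolding primitive_def using int_d nonneg
    by (subst nn_integral_eq_integral) (auto simp: indicator_def)
  have prim_nonneg: "0 \<le> primitive d v" for v
    unfolding primitive_def using nonneg by (intro integral_nonneg_AE) (auto simp: indicator_def)
  have prim_meas [measurable]: "primitive d \<in> borel_measurable borel"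
  proof -
    have *: "primitive d = (\<lambda>v. \<integral>y. d y * (if y \<le> v then 1 else 0) \<partial>lborel)"
      by (rule ext) (auto simp: primitive_def indicator_def intro!: Bochner_Integration.integral_cong)
    show ?thesis unfolding * by measurable
  qed
  have "(\<integral>\<^sup>+x. ennreal (primitive d (u - x) * g x) \<partial>lborel) =
      (\<integral>\<^sup>+x. (\<integral>\<^sup>+y. ennreal (d y * g x * (if x + y \<le> u then 1 else 0)) \<partial>lborel) \<partial>lborel)"
  proof (rule nn_integral_cong)
    fix x
    have "ennreal (primitive d (u - x) * g x) =
        (\<integral>\<^sup>+y. ennreal (d y * indicator {..u-x} y) \<partial>lborel) * ennreal (g x)"
      using g_nonneg prim_nonneg by (simp add: ennreal_mult nn_prim)
    also have "\<dots> = (\<integral>\<^sup>+y. ennreal (d y * indicator {..u-x} y) * ennreal (g x) \<partial>lborel)"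
      by (subst nn_integral_multc) auto
    also have "\<dots> = (\<integral>\<^sup>+y. ennreal (d y * g x * (if x + y \<le> u then 1 else 0)) \<partial>lborel)"
      using nonneg g_nonneg by (intro nn_integral_cong) (auto simp: indicator_def ennreal_mult)
    finally show "ennreal (primitive d (u - x) * g x) = \<dots>" .
  qed
  also have "\<dots> = (\<integral>\<^sup>+y. (\<integral>\<^sup>+x. ennreal (d y * g x * (if x + y \<le> u then 1 else 0)) \<partial>lborel) \<partial>lborel)"
    by (rule lborel_pair.Fubini') measurable
  also have "\<dots> = (\<integral>\<^sup>+y. ennreal (d y * cdf_g (u - y)) \<partial>lborel)"
  proof (rule nn_integral_cong)
    fix y
    have "(\<integral>\<^sup>+x. ennreal (d y * g x * (if x + y \<le> u then 1 else 0)) \<partial>lborel) =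
       (\<integral>\<^sup>+x. ennreal (d y) * ennreal (g x * indicator {..u-y} x) \<partial>lborel)"
      using nonneg g_nonneg by (intro nn_integral_cong) (auto simp: indicator_def ennreal_mult)
    also have "\<dots> = ennreal (d y * cdf_g (u - y))"
      using nonneg cdf_g_nonneg by (subst nn_integral_cmult) (auto simp: nn_cdf_g ennreal_mult)
    finally show "(\<integral>\<^sup>+x. ennreal (d y * g x * (if x + y \<le> u then 1 else 0)) \<partial>lborel) =
      ennreal (d y * cdf_g (u - y))" .
  qed
  finally have A: "(\<integral>\<^sup>+x. ennreal (primitive d (u - x) * g x) \<partial>lborel) =
      (\<integral>\<^sup>+y. ennreal (d y * cdf_g (u - y)) \<partial>lborel)" .
  have cdf0: "cdf_g v = 0" if "v < 0" for v
  proof -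
    have "(\<lambda>x. g x * indicator {..v} x) = (\<lambda>x. 0)"
    proof
      fix x show "g x * indicator {..v} x = 0" using that g_neg[of x] by (cases "x \<le> v") auto
    qed
    then show ?thesis by (simp add: cdf_g_def)
  qed
  have "(\<integral>\<^sup>+x. ennreal (d (u - x) * g x) \<partial>lborel) = (\<integral>\<^sup>+y. ennreal (d y * g (u - y)) \<partial>lborel)"
    by (subst nn_integral_real_affine[where c="-1" and t=u]) auto
  also have "\<dots> \<le> (\<integral>\<^sup>+y. ennreal (H * (d y * (1 - cdf_g (u - y)) * indicator {..u} y)) \<partial>lborel)"
  proof (intro nn_integral_mono ennreal_leI)
    fix y
    show "d y * g (u - y) \<le> H * (d y * (1 - cdf_g (u - y)) * indicator {..u} y)"
    proof (cases "y \<le> u")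
      case True
      have "d y * g (u - y) \<le> d y * (H * (1 - cdf_g (u - y)))"
        using hazard[of "u - y"] True nonneg by (intro mult_left_mono) (auto simp: tail_eq)
      then show ?thesis using True by (simp add: mult_ac)
    qed (simp add: g_neg)
  qed
  also have "\<dots> = ennreal H * (\<integral>\<^sup>+y. ennreal (d y * (1 - cdf_g (u - y)) * indicator {..u} y) \<partial>lborel)"
    using H_nonneg by (subst nn_integral_cmult[symmetric]) (auto simp: ennreal_mult')
  finally have B: "(\<integral>\<^sup>+x. ennreal (d (u - x) * g x) \<partial>lborel) \<le>
      ennreal H * (\<integral>\<^sup>+y. ennreal (d y * (1 - cdf_g (u - y)) * indicator {..u} y) \<partial>lborel)" .
  have "(\<integral>\<^sup>+x. ennreal ((d (u - x) + H * primitive d (u - x)) * g x) \<partial>lborel) =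
      (\<integral>\<^sup>+x. ennreal (d (u - x) * g x) + ennreal H * ennreal (primitive d (u - x) * g x) \<partial>lborel)"
  proof (rule nn_integral_cong)
    fix x
    have "0 \<le> d (u - x) * g x" "0 \<le> primitive d (u - x) * g x"
      using nonneg g_nonneg prim_nonneg by auto
    then have "ennreal (d (u - x) * g x) + ennreal H * ennreal (primitive d (u - x) * g x) =
        ennreal (d (u - x) * g x + H * (primitive d (u - x) * g x))"
      using H_nonneg by (simp add: ennreal_mult)
    then show "ennreal ((d (u - x) + H * primitive d (u - x)) * g x) =
        ennreal (d (u - x) * g x) + ennreal H * ennreal (primitive d (u - x) * g x)"
      by (simp add: algebra_simps)
  qed
  also have "\<dots> = (\<integral>\<^sup>+x. ennreal (d (u - x) * g x) \<partial>lborel) +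
      ennreal H * (\<integral>\<^sup>+x. ennreal (primitive d (u - x) * g x) \<partial>lborel)"
    by (subst nn_integral_add) (auto simp: nn_integral_cmult)
  also have "\<dots> \<le> ennreal H * (\<integral>\<^sup>+y. ennreal (d y * (1 - cdf_g (u - y)) * indicator {..u} y) \<partial>lborel) +
      ennreal H * (\<integral>\<^sup>+y. ennreal (d y * cdf_g (u - y)) \<partial>lborel)"
    using B A by (intro add_mono) auto
  also have "\<dots> = ennreal H * (\<integral>\<^sup>+y. ennreal (d y * (1 - cdf_g (u - y)) * indicator {..u} y) +
      ennreal (d y * cdf_g (u - y)) \<partial>lborel)"
    by (subst nn_integral_add) (auto simp: distrib_left)
  also have "(\<integral>\<^sup>+y. ennreal (d y * (1 - cdf_g (u - y)) * indicator {..u} y) +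
      ennreal (d y * cdf_g (u - y)) \<partial>lborel) = ennreal (primitive d u)"
    unfolding nn_prim
  proof (rule nn_integral_cong)
    fix y
    show "ennreal (d y * (1 - cdf_g (u - y)) * indicator {..u} y) + ennreal (d y * cdf_g (u - y)) =
        ennreal (d y * indicator {..u} y)"
    proof (cases "y \<le> u")
      case True
      then show ?thesis using nonneg[of y] cdf_g_nonneg[of "u - y"] cdf_g_lt_1[of "u - y"]
        by (subst ennreal_plus[symmetric]) (auto simp: algebra_simps intro!: mult_left_le)
    qed (simp add: cdf0)
  qed
  also have "ennreal H * ennreal (primitive d u) = ennreal (H * primitive d u)"
    using H_nonneg prim_nonneg by (simp add: ennreal_mult)
  finally have le: "(\<integral>\<^sup>+x. ennreal ((d (u - x) + H * primitive d (u - x)) * g x) \<partial>lborel) \<le> ennreal (H * primitive d u)" .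
  have "conv (\<lambda>v. d v + H * primitive d v) u =
     enn2real (\<integral>\<^sup>+x. ennreal ((d (u - x) + H * primitive d (u - x)) * g x) \<partial>lborel)"
    unfolding conv_def using nonneg g_nonneg H_nonneg prim_nonneg
    by (intro integral_eq_nn_integral) auto
  also have "\<dots> \<le> H * primitive d u"
    using le H_nonneg prim_nonneg by (intro enn2real_leI) auto
  finally show ?thesis .
qed

text \<open>A bounded subsolution of the renewal equation stays below the supersolution
\<open>d + H * primitive d\<close> with \<open>d = a * moment_tail\<close>, since their difference is subharmonic.\<close>

lemma renewal_majorant:
  assumes [measurable]: "w \<in> borel_measurable borel"
    and bd: "\<And>v. \<bar>w v\<bar> \<le> b" and neg: "\<And>v. v < 0 \<Longrightarrow> w v = 0"
    and sub: "\<And>v. 0 \<le> v \<Longrightarrow> w v \<le> a * moment_tail v + conv w v"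
    and a: "0 \<le> a" and u: "0 \<le> u"
  shows "w u \<le> a * (B * (1 + H))"
proof -
  define d where "d v = a * moment_tail v" for v
  have d_meas [measurable]: "d \<in> borel_measurable borel" unfolding d_def by measurable
  have int_mt: "integrable lborel moment_tail"
    using nn_integral_moment_tail moment_tail_nonneg
    by (intro integrableI_nonneg) (auto simp: less_top[symmetric] top_unique)
  then have int_d: "integrable lborel d" unfolding d_def by simp
  have d_nonneg: "0 \<le> d v" and d_le: "d v \<le> a * B" for v
    using a moment_tail_nonneg moment_tail_le by (auto simp: d_def intro: mult_left_mono)
  have d_neg: "d v = 0" if "v < 0" for v using that by (simp add: d_def moment_tail_def)
  have prim_le: "primitive d v \<le> a * B" for v
  proof -
    have "primitive d v \<le> integral\<^sup>L lborel d"
      unfolding primitive_def using int_d d_nonneg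
      by (intro integral_mono Bochner_Integration.integrable_bound[OF int_d]) (auto simp: indicator_def)
    also have "\<dots> = a * enn2real (\<integral>\<^sup>+v. ennreal (moment_tail v) \<partial>lborel)"
      using moment_tail_nonneg unfolding d_def by (simp add: integral_eq_nn_integral)
    also have "\<dots> \<le> a * B"
      using nn_integral_moment_tail a B_nonneg by (intro mult_left_mono enn2real_leI) auto
    finally show ?thesis .
  qed
  have prim_nonneg: "0 \<le> primitive d v" for v
    unfolding primitive_def using d_nonneg by (intro integral_nonneg_AE) (auto simp: indicator_def)
  have prim_meas [measurable]: "primitive d \<in> borel_measurable borel"
  proof -
    have *: "primitive d = (\<lambda>v. \<integral>y. d y * (if y \<le> v then 1 else 0) \<partial>lborel)"
      by (rule ext) (auto simp: primitive_def indicator_def intro!: Bochner_Integration.integral_cong)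
    show ?thesis unfolding * by measurable
  qed
  have prim_neg: "primitive d v = 0" if "v < 0" for v
  proof -
    have "(\<lambda>x. d x * indicator {..v} x) = (\<lambda>x. 0)"
    proof
      fix x show "d x * indicator {..v} x = 0" using that d_neg[of x] by (cases "x \<le> v") auto
    qed
    then show ?thesis by (simp add: primitive_def)
  qed
  define S where "S v = d v + H * primitive d v" for v
  have S_meas [measurable]: "S \<in> borel_measurable borel" unfolding S_def by measurable
  have S_nonneg: "0 \<le> S v" for v using d_nonneg prim_nonneg H_nonneg by (simp add: S_def)
  have S_le: "S v \<le> a * (B * (1 + H))" for v
    using add_mono[OF d_le[of v] mult_left_mono[OF prim_le[of v] H_nonneg]]
    by (simp add: S_def algebra_simps)
  have "w u - S u \<le> 0"
  proof (rule subharmonic_nonpos[where w = "\<lambda>v. w v - S v" and b = "b + a * (B * (1 + H))"])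
    show "\<bar>w v - S v\<bar> \<le> b + a * (B * (1 + H))" for v
      using bd[of v] S_nonneg[of v] S_le[of v] by linarith
    show "w v - S v = 0" if "v < 0" for v using that neg d_neg prim_neg by (simp add: S_def)
    show "w v - S v \<le> conv (\<lambda>v. w v - S v) v" if "0 \<le> v" for v
    proof -
      have "conv (\<lambda>v. w v - S v) v = conv w v - conv S v"
        unfolding conv_def left_diff_distrib
      proof (rule Bochner_Integration.integral_diff)
        show "integrable lborel (\<lambda>x. w (v - x) * g x)"
          by (rule integrable_g_times[of _ b]) (auto intro: bd)
        show "integrable lborel (\<lambda>x. S (v - x) * g x)"
          using S_le S_nonneg by (intro integrable_g_times[of _ "a * (B * (1 + H))"]) auto
      qed
      moreover have "conv S v \<le> H * primitive d v"
        unfolding S_def by (rule conv_supersolution[OF d_meas int_d d_nonneg d_neg d_le])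
      ultimately show ?thesis using sub[OF that] by (simp add: S_def d_def)
    qed
  qed (use u in auto)
  then show ?thesis using S_le[of u] by simp
qed

end

section \<open>From the backward equation to the defective renewal equation\<close>

lemma integral_ind_bounds:
  fixes f :: "real \<Rightarrow> real"
  assumes [measurable]: "f \<in> borel_measurable borel" and "S \<in> sets lborel" "emeasure lborel S = ennreal m" "0 \<le> m"
    and bd: "\<And>v. \<bar>f v\<bar> \<le> b" and lo: "\<And>v. v \<in> S \<Longrightarrow> l \<le> f v" and up: "\<And>v. v \<in> S \<Longrightarrow> f v \<le> r"
  shows "integrable lborel (\<lambda>v. f v * indicator S v)"
    and "l * m \<le> (\<integral>v. f v * indicator S v \<partial>lborel)" "(\<integral>v. f v * indicator S v \<partial>lborel) \<le> r * m"
proof -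
  note [measurable] = assms(2)
  have int: "integrable lborel (\<lambda>v. k * indicator S v)" for k :: real
    using assms(2,3) by (intro integrable_mult_right integrable_real_indicator) auto
  show i: "integrable lborel (\<lambda>v. f v * indicator S v)"
    by (rule Bochner_Integration.integrable_bound[OF int[of b]])
       (use bd in \<open>auto simp: indicator_def intro: order_trans[OF bd abs_ge_self]\<close>)
  have e: "(\<integral>v. k * indicator S v \<partial>lborel) = k * m" for k :: real
    using assms(2-4) by (simp add: measure_def)
  show "l * m \<le> (\<integral>v. f v * indicator S v \<partial>lborel)"
    unfolding e[symmetric] using lo by (intro integral_mono i int) (auto simp: indicator_def)
  show "(\<integral>v. f v * indicator S v \<partial>lborel) \<le> r * m"
    unfolding e[symmetric] using up by (intro integral_mono i int) (auto simp: indicator_def)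
qed

lemma measurable_antimono:
  fixes f :: "real \<Rightarrow> real"
  assumes "antimono f" shows "f \<in> borel_measurable borel"
proof -
  have "mono (\<lambda>x. - f x)" using assms by (auto simp: monotone_def)
  then have "(\<lambda>x. - f x) \<in> borel_measurable borel" by (rule borel_measurable_mono)
  then have "(\<lambda>x. - (- f x)) \<in> borel_measurable borel" by (rule borel_measurable_uminus)
  then show ?thesis by (simp only: minus_minus)
qed

text \<open>Integrating the difference quotient \<open>(f n (v + c * h) - f n v) / h\<close> over \<open>[0, u]\<close> leaves averages of
\<open>f n\<close> over two intervals of length \<open>c * h\<close>, at \<open>u\<close> and at \<open>0\<close>. By monotonicity of \<open>f n\<close> these averages
lie between values of \<open>f n\<close> that converge to \<open>F u\<close> and \<open>F 0\<close>.\<close>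

lemma discretized_backward_equation_limit:
  fixes f :: "nat \<Rightarrow> real \<Rightarrow> real" and F :: "real \<Rightarrow> real" and \<nu> :: "real measure"
  assumes \<nu>: "prob_space \<nu>" and [measurable_cong]: "sets \<nu> = sets borel"
    and h: "\<And>n. 0 < h n" "h \<longlonglongrightarrow> 0"
    and c: "0 < c"
    and f01: "\<And>n v. 0 \<le> f n v" "\<And>n v. f n v \<le> 1"
    and anti: "\<And>n. antimono (f n)" "antimono F"
    and lim: "\<And>v. (\<lambda>n. f n v) \<longlonglongrightarrow> F v"
    and lim_shift: "\<And>v. (\<lambda>n. f n (v + c * h n)) \<longlonglongrightarrow> F v"
    and step: "\<And>n v. 0 \<le> v \<Longrightarrow>
       \<bar>f n v - (1 - lam * h n) * f n (v + c * h n) - lam * h n * (\<integral>z. f n (v + c * h n - z) \<partial>\<nu>)\<bar> \<le> C * (h n)\<^sup>2"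
    and u: "0 \<le> u"
  shows "c * (F u - F 0) = lam * (\<integral>v. (F v - (\<integral>z. F (v - z) \<partial>\<nu>)) * indicator {0..u} v \<partial>lborel)"
proof -
  interpret prob_space \<nu> by fact
  have f_abs: "\<bar>f n v\<bar> \<le> 1" for n v using f01[of n v] by simp
  have F01: "0 \<le> F v" "F v \<le> 1" for v
    using LIMSEQ_le_const[OF lim[of v], of 0] LIMSEQ_le_const2[OF lim[of v], of 1] f01 by auto
  have [measurable]: "f n \<in> borel_measurable borel" for n by (rule measurable_antimono[OF anti(1)])
  have [measurable]: "F \<in> borel_measurable borel" by (rule measurable_antimono[OF anti(2)])
  define A where "A n v = (\<integral>z. f n (v + c * h n - z) \<partial>\<nu>)" for n v
  define A0 where "A0 v = (\<integral>z. F (v - z) \<partial>\<nu>)" for v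
  have [measurable]: "A n \<in> borel_measurable borel" for n unfolding A_def by measurable
  have [measurable]: "A0 \<in> borel_measurable borel" unfolding A0_def by measurable
  have A_lim: "(\<lambda>n. A n v) \<longlonglongrightarrow> A0 v" for v
    unfolding A_def A0_def
  proof (rule integral_dominated_convergence[where w = "\<lambda>_. 1"])
    show "AE z in \<nu>. (\<lambda>n. f n (v + c * h n - z)) \<longlonglongrightarrow> F (v - z)"
    proof (rule AE_I2)
      fix z
      show "(\<lambda>n. f n (v + c * h n - z)) \<longlonglongrightarrow> F (v - z)"
        using lim_shift[of "v - z"] by (simp add: algebra_simps)
    qed
  qed (auto simp: f_abs)
  have A_abs: "\<bar>A n v\<bar> \<le> 1" for n v
  proof -
    have "\<bar>A n v\<bar> \<le> (\<integral>z. 1 \<partial>\<nu>)"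
      unfolding A_def by (rule integral_abs_bound_integral) (auto simp: f_abs intro!: integrable_const_bound[where B = 1])
    then show ?thesis by (simp add: prob_space)
  qed
  have ulen: "emeasure lborel {0..u} = ennreal u" using u by simp
  have int_c: "integrable lborel (\<lambda>v. k * indicator {0..u} v)" for k :: real
    by (intro integrable_mult_right integrable_real_indicator) (auto simp: ulen)
  have int_ind: "integrable lborel (\<lambda>v. G v * indicator {0..u} v)"
    if "G \<in> borel_measurable borel" "\<And>v. \<bar>G v\<bar> \<le> b" for G :: "real \<Rightarrow> real" and b
    using that by (intro integral_ind_bounds(1)[where b = b and m = u and l = "-b" and r = b] ulen u)
      (auto simp: abs_le_iff minus_le_iff)
  define L where "L n = (\<integral>v. (f n (v + c * h n) - f n v) * indicator {0..u} v \<partial>lborel) / h n" for n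
  define M where "M n = (\<integral>v. (f n (v + c * h n) - A n v) * indicator {0..u} v \<partial>lborel)" for n
  have M_lim: "M \<longlonglongrightarrow> (\<integral>v. (F v - A0 v) * indicator {0..u} v \<partial>lborel)"
    unfolding M_def
  proof (rule integral_dominated_convergence[where w = "\<lambda>v. 2 * indicator {0..u} v"])
    show "AE v in lborel. (\<lambda>n. (f n (v + c * h n) - A n v) * indicator {0..u} v) \<longlonglongrightarrow> (F v - A0 v) * indicator {0..u} v"
      by (intro AE_I2 tendsto_intros lim_shift A_lim)
    show "AE v in lborel. norm ((f n (v + c * h n) - A n v) * indicator {0..u} v) \<le> 2 * indicator {0..u} v" for n
    proof (rule AE_I2)
      fix v
      show "norm ((f n (v + c * h n) - A n v) * indicator {0..u} v) \<le> 2 * indicator {0..u} v"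
        using f_abs[of n "v + c * h n"] A_abs[of n v] by (auto simp: indicator_def)
    qed
  qed (use int_c[of 1] in auto)
  have LM: "\<bar>L n - lam * M n\<bar> \<le> C * u * h n" for n
  proof -
    have tri: "\<bar>x - y\<bar> \<le> 2" if "\<bar>x\<bar> \<le> 1" "\<bar>y\<bar> \<le> 1" for x y :: real using that by linarith
    have i1: "integrable lborel (\<lambda>v. (f n (v + c * h n) - f n v) * indicator {0..u} v)"
      by (rule int_ind[of _ 2]) (auto intro!: tri f_abs)
    have i2: "integrable lborel (\<lambda>v. (f n (v + c * h n) - A n v) * indicator {0..u} v)"
      by (rule int_ind[of _ 2]) (auto intro!: tri f_abs A_abs)
    \<comment> \<open>\<open>J\<close> is \<open>h n * (L n - lam * M n)\<close> as a single integral, to which the one-step bound applies pointwise.\<close>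
    define J where "J = (\<integral>v. (f n (v + c * h n) - f n v) * indicator {0..u} v -
        (lam * h n) * ((f n (v + c * h n) - A n v) * indicator {0..u} v) \<partial>lborel)"
    have J: "J = h n * (L n - lam * M n)" unfolding J_def
      using h(1)[of n] integrable_mult_right[OF i2, of "lam * h n"]
      by (subst Bochner_Integration.integral_diff[OF i1]) (simp_all add: L_def M_def right_diff_distrib)
    have "\<bar>J\<bar> \<le> (\<integral>v. (C * (h n)\<^sup>2) * indicator {0..u} v \<partial>lborel)"
      unfolding J_def
    proof (rule integral_abs_bound_integral)
      show "integrable lborel (\<lambda>v. (f n (v + c * h n) - f n v) * indicator {0..u} v -
        (lam * h n) * ((f n (v + c * h n) - A n v) * indicator {0..u} v))"
        using i1 i2 by auto
      show "integrable lborel (\<lambda>v. (C * (h n)\<^sup>2) * indicator {0..u} v)" by (rule int_c)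
      fix v
      show "\<bar>(f n (v + c * h n) - f n v) * indicator {0..u} v -
        (lam * h n) * ((f n (v + c * h n) - A n v) * indicator {0..u} v)\<bar> \<le> (C * (h n)\<^sup>2) * indicator {0..u} v"
      proof (cases "v \<in> {0..u}")
        case True
        then have "\<bar>f n v - (1 - lam * h n) * f n (v + c * h n) - lam * h n * A n v\<bar> \<le> C * (h n)\<^sup>2"
          unfolding A_def by (intro step) auto
        then show ?thesis using True by (simp add: algebra_simps abs_le_iff)
      qed simp
    qed
    also have "\<dots> = h n * (C * u * h n)" using u by (simp add: power2_eq_square)
    finally have "h n * \<bar>L n - lam * M n\<bar> \<le> h n * (C * u * h n)"
      using h(1)[of n] by (simp add: J abs_mult)
    then show ?thesis using h(1)[of n] by (simp only: mult_le_cancel_left_pos)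
  qed
  have L_bounds: "c * f n (u + c * h n) - c * f n 0 \<le> L n" "L n \<le> c * f n u - c * f n (0 + c * h n)" for n
  proof -
    define a where "a = c * h n"
    have a: "0 < a" using c h(1)[of n] by (simp add: a_def)
    have i1: "integrable lborel (\<lambda>v. f n (v + a) * indicator {0..u} v)"
      and i2: "integrable lborel (\<lambda>v. f n v * indicator {0..u} v)"
      by (rule int_ind[of _ 1]; simp add: f_abs)+
    have le: "f n y \<le> f n x" if "x \<le> y" for x y using anti(1)[of n] that by (simp add: monotone_def)
    note B1 = integral_ind_bounds[of "f n" "{u<..u+a}" a 1 "f n (u + a)" "f n u"]
    note B2 = integral_ind_bounds[of "f n" "{0..<a}" a 1 "f n a" "f n 0"]
    have I1: "integrable lborel (\<lambda>v. f n v * indicator {u<..u+a} v)"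
      "f n (u + a) * a \<le> (\<integral>v. f n v * indicator {u<..u+a} v \<partial>lborel)"
      "(\<integral>v. f n v * indicator {u<..u+a} v \<partial>lborel) \<le> f n u * a"
      by (rule B1; use a in \<open>simp add: f_abs le\<close>)+
    have I2: "integrable lborel (\<lambda>v. f n v * indicator {0..<a} v)"
      "f n a * a \<le> (\<integral>v. f n v * indicator {0..<a} v \<partial>lborel)"
      "(\<integral>v. f n v * indicator {0..<a} v \<partial>lborel) \<le> f n 0 * a"
      by (rule B2; use a in \<open>simp add: f_abs le\<close>)+
    have I3: "integrable lborel (\<lambda>v. f n v * indicator {a..u+a} v)"
      by (rule integral_ind_bounds(1)[where b = 1 and m = u and l = 0 and r = 1]) (use u f01[of n] in auto)
    have "(\<integral>v. f n (v + a) * indicator {0..u} v \<partial>lborel) = (\<integral>v. f n v * indicator {a..u+a} v \<partial>lborel)"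
      by (subst lborel_integral_real_affine[where c = 1 and t = "-a"])
         (auto simp: indicator_def intro!: Bochner_Integration.integral_cong)
    also have "\<dots> + (\<integral>v. f n v * indicator {0..<a} v \<partial>lborel) =
        (\<integral>v. f n v * indicator {0..u} v \<partial>lborel) + (\<integral>v. f n v * indicator {u<..u+a} v \<partial>lborel)"
      unfolding Bochner_Integration.integral_add[OF I3 I2(1), symmetric] Bochner_Integration.integral_add[OF i2 I1(1), symmetric]
      using a u by (intro Bochner_Integration.integral_cong) (auto simp: indicator_def)
    finally have "(\<integral>v. (f n (v + a) - f n v) * indicator {0..u} v \<partial>lborel) =
        (\<integral>v. f n v * indicator {u<..u+a} v \<partial>lborel) - (\<integral>v. f n v * indicator {0..<a} v \<partial>lborel)"
      using i1 i2 by (simp add: left_diff_distrib)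
    then have "a * (f n (u + a) - f n 0) \<le> h n * L n" "h n * L n \<le> a * (f n u - f n a)"
      using I1 I2 h(1)[of n] by (auto simp: L_def a_def algebra_simps)
    then show "c * f n (u + c * h n) - c * f n 0 \<le> L n" "L n \<le> c * f n u - c * f n (0 + c * h n)"
      using h(1)[of n] unfolding a_def by (auto simp: mult.assoc mult.left_commute[of c] right_diff_distrib[symmetric])
  qed
  have L_lim: "L \<longlonglongrightarrow> c * F u - c * F 0"
  proof (rule tendsto_sandwich)
    show "\<forall>\<^sub>F n in sequentially. c * f n (u + c * h n) - c * f n 0 \<le> L n"
      "\<forall>\<^sub>F n in sequentially. L n \<le> c * f n u - c * f n (0 + c * h n)"
      by (intro always_eventually allI L_bounds)+
    show "(\<lambda>n. c * f n (u + c * h n) - c * f n 0) \<longlonglongrightarrow> c * F u - c * F 0"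
      by (intro tendsto_intros lim lim_shift)
    show "(\<lambda>n. c * f n u - c * f n (0 + c * h n)) \<longlonglongrightarrow> c * F u - c * F 0"
      by (intro tendsto_diff tendsto_mult tendsto_const lim lim_shift)
  qed
  have "(\<lambda>n. L n - lam * M n) \<longlonglongrightarrow> 0"
  proof (rule Lim_null_comparison)
    show "(\<lambda>n. C * u * h n) \<longlonglongrightarrow> 0" using tendsto_mult_right_zero[OF h(2)] by simp
    show "\<forall>\<^sub>F n in sequentially. norm (L n - lam * M n) \<le> C * u * h n"
      using LM by (intro always_eventually) auto
  qed
  moreover have "(\<lambda>n. L n - lam * M n) \<longlonglongrightarrow> (c * F u - c * F 0) - lam * (\<integral>v. (F v - A0 v) * indicator {0..u} v \<partial>lborel)"
    by (intro tendsto_intros L_lim M_lim)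
  ultimately show ?thesis
    using LIMSEQ_unique unfolding A0_def by (fastforce simp: right_diff_distrib)
qed

text \<open>By Fubini, \<open>\<integral>v\<le>u. E (F (v - Z))\<close> is the integral of the tail of \<open>Z\<close> (the part \<open>Z > v\<close>, where \<open>F = 1\<close>) plus
the convolution of \<open>F\<close> with the distribution function of \<open>Z\<close>. This gives the renewal equation up to the
unknown constant \<open>F 0\<close>, and letting \<open>u \<rightarrow> \<infinity>\<close> yields \<open>c * F 0 = lam * m1\<close>.\<close>

lemma renewal_equation_of_backward_equation:
  fixes F :: "real \<Rightarrow> real" and \<nu> :: "real measure"
  assumes \<nu>: "prob_space \<nu>" and [measurable_cong]: "sets \<nu> = sets borel"
    and pos: "AE z in \<nu>. 0 < z"
    and mean: "(\<integral>\<^sup>+x. ennreal (measure \<nu> {x<..}) * indicator {0..} x \<partial>lborel) = ennreal m1" "0 \<le> m1"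
    and F01: "\<And>v. 0 \<le> F v" "\<And>v. F v \<le> 1" and anti: "antimono F" and F_neg: "\<And>v. v < 0 \<Longrightarrow> F v = 1"
    and F_lim: "(F \<longlongrightarrow> 0) at_top"
    and eq: "\<And>u. 0 \<le> u \<Longrightarrow> c * (F u - F 0) = lam * (\<integral>v. (F v - (\<integral>z. F (v - z) \<partial>\<nu>)) * indicator {0..u} v \<partial>lborel)"
    and u: "0 \<le> u"
  shows "c * F u = lam * (m1 - (\<integral>x. measure \<nu> {x<..} * indicator {0..u} x \<partial>lborel) +
     (\<integral>x. F (u - x) * measure \<nu> {x<..} * indicator {0..u} x \<partial>lborel))"
proof -
  interpret prob_space \<nu> by fact
  have space: "space \<nu> = UNIV" using sets_eq_imp_space_eq[OF assms(2)] by simp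
  define T where "T x = prob {x<..}" for x
  have antiT: "antimono T" unfolding T_def monotone_def by (auto intro!: finite_measure_mono)
  have [measurable]: "T \<in> borel_measurable borel" by (rule measurable_antimono[OF antiT])
  have [measurable]: "F \<in> borel_measurable borel" by (rule measurable_antimono[OF anti])
  have T01: "0 \<le> T x" "T x \<le> 1" for x by (auto simp: T_def)
  have F_abs: "\<bar>F v\<bar> \<le> 1" for v using F01[of v] by simp
  have T_compl: "prob {..x} = 1 - T x" for x
  proof -
    have "{..x} = space \<nu> - {x<..}" by (auto simp: space)
    then show ?thesis unfolding T_def by (simp add: prob_compl)
  qed
  have key: "c * (F u - F 0) = lam * ((\<integral>x. F (u - x) * T x * indicator {0..u} x \<partial>lborel) -
      (\<integral>x. T x * indicator {0..u} x \<partial>lborel))" if u: "0 \<le> u" for u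
  proof -
    have ulen: "emeasure lborel {0..u} = ennreal u" using u by simp
    have int_ind: "integrable lborel (\<lambda>v. G v * indicator {0..u} v)"
      if "G \<in> borel_measurable borel" "\<And>v. \<bar>G v\<bar> \<le> 1" for G :: "real \<Rightarrow> real"
      using that by (intro integral_ind_bounds(1)[where b = 1 and m = u and l = "-1" and r = 1] ulen u)
        (auto simp: abs_le_iff minus_le_iff)
    define A where "A v = (\<integral>z. F (v - z) \<partial>\<nu>)" for v
    have A01: "0 \<le> A v" "A v \<le> 1" for v
    proof -
      show "0 \<le> A v" unfolding A_def using F01 by (intro integral_nonneg_AE) auto
      have "A v \<le> (\<integral>z. 1 \<partial>\<nu>)"
        unfolding A_def using F01 by (intro integral_mono integrable_const_bound[where B = 1]) (auto simp: F_abs)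
      then show "A v \<le> 1" by (simp add: prob_space)
    qed
    have [measurable]: "A \<in> borel_measurable borel" unfolding A_def by measurable
    define Q where "Q v = (\<integral>z. F (v - z) * indicator {..v} z \<partial>\<nu>)" for v
    have Q_meas [measurable]: "Q \<in> borel_measurable borel"
    proof -
      have *: "Q = (\<lambda>v. \<integral>z. F (v - z) * (if z \<le> v then 1 else 0) \<partial>\<nu>)"
        unfolding Q_def by (intro ext Bochner_Integration.integral_cong) (auto simp: indicator_def)
      show ?thesis unfolding * by measurable
    qed
    have int_Q: "integrable \<nu> (\<lambda>z. F (v - z) * indicator {..v} z)" for v
      by (rule integrable_const_bound[where B = 1]) (auto simp: indicator_def F_abs)
    have A_eq: "A v = T v + Q v" for v
    proof -
      have "A v = (\<integral>z. indicator {v<..} z + F (v - z) * indicator {..v} z \<partial>\<nu>)"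
        unfolding A_def by (intro Bochner_Integration.integral_cong) (auto simp: indicator_def F_neg)
      also have "\<dots> = T v + Q v"
        unfolding Q_def T_def using int_Q[of v] by (subst Bochner_Integration.integral_add) (auto intro!: integrable_real_indicator simp: emeasure_eq_measure)
      finally show ?thesis .
    qed
    have Q0: "0 \<le> Q v" for v unfolding Q_def using F01 by (intro integral_nonneg_AE) (auto simp: indicator_def)
    have Q_abs: "\<bar>Q v\<bar> \<le> 1" for v using A_eq[of v] T01[of v] A01[of v] Q0[of v] by simp
    have "(\<integral>\<^sup>+v. ennreal (Q v * indicator {0..u} v) \<partial>lborel) =
      (\<integral>\<^sup>+v. (\<integral>\<^sup>+z. ennreal (F (v - z) * (if z \<le> v \<and> 0 \<le> v \<and> v \<le> u then 1 else 0)) \<partial>\<nu>) \<partial>lborel)"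
    proof (rule nn_integral_cong)
      fix v
      have "ennreal (Q v * indicator {0..u} v) = (\<integral>\<^sup>+z. ennreal (F (v - z) * indicator {..v} z) \<partial>\<nu>) * indicator {0..u} v"
        unfolding Q_def using int_Q[of v] F01 by (subst nn_integral_eq_integral) (auto simp: indicator_def)
      also have "\<dots> = (\<integral>\<^sup>+z. ennreal (F (v - z) * indicator {..v} z) * indicator {0..u} v \<partial>\<nu>)"
        by (subst nn_integral_multc) auto
      also have "\<dots> = (\<integral>\<^sup>+z. ennreal (F (v - z) * (if z \<le> v \<and> 0 \<le> v \<and> v \<le> u then 1 else 0)) \<partial>\<nu>)"
        by (intro nn_integral_cong) (auto simp: indicator_def)
      finally show "ennreal (Q v * indicator {0..u} v) = \<dots>" .
    qed
    also have "\<dots> = (\<integral>\<^sup>+z. (\<integral>\<^sup>+v. ennreal (F (v - z) * (if z \<le> v \<and> 0 \<le> v \<and> v \<le> u then 1 else 0)) \<partial>lborel) \<partial>\<nu>)"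
    proof -
      interpret P: pair_sigma_finite \<nu> lborel ..
      show ?thesis by (rule P.Fubini') measurable
    qed
    also have "\<dots> = (\<integral>\<^sup>+z. (\<integral>\<^sup>+w. ennreal (F w * (if 0 \<le> w \<and> w \<le> u \<and> z \<le> u - w then 1 else 0)) \<partial>lborel) \<partial>\<nu>)"
    proof (rule nn_integral_cong_AE, use pos in eventually_elim)
      fix z :: real assume z: "0 < z"
      have "(\<integral>\<^sup>+v. ennreal (F (v - z) * (if z \<le> v \<and> 0 \<le> v \<and> v \<le> u then 1 else 0)) \<partial>lborel) =
         (\<integral>\<^sup>+w. ennreal (F (z + w - z) * (if z \<le> z + w \<and> 0 \<le> z + w \<and> z + w \<le> u then 1 else 0)) \<partial>lborel)"
        by (subst nn_integral_real_affine[where c = 1 and t = z]) auto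
      also have "\<dots> = (\<integral>\<^sup>+w. ennreal (F w * (if 0 \<le> w \<and> w \<le> u \<and> z \<le> u - w then 1 else 0)) \<partial>lborel)"
        using z by (intro nn_integral_cong) auto
      finally show "(\<integral>\<^sup>+v. ennreal (F (v - z) * (if z \<le> v \<and> 0 \<le> v \<and> v \<le> u then 1 else 0)) \<partial>lborel) = \<dots>" .
    qed
    also have "\<dots> = (\<integral>\<^sup>+w. (\<integral>\<^sup>+z. ennreal (F w * (if 0 \<le> w \<and> w \<le> u \<and> z \<le> u - w then 1 else 0)) \<partial>\<nu>) \<partial>lborel)"
    proof -
      interpret P: pair_sigma_finite \<nu> lborel ..
      show ?thesis by (rule P.Fubini'[symmetric]) measurable
    qed
    also have "\<dots> = (\<integral>\<^sup>+w. ennreal (F w * (1 - T (u - w)) * indicator {0..u} w) \<partial>lborel)"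
    proof (rule nn_integral_cong)
      fix w
      have "(\<integral>\<^sup>+z. ennreal (F w * (if 0 \<le> w \<and> w \<le> u \<and> z \<le> u - w then 1 else 0)) \<partial>\<nu>) =
         (\<integral>\<^sup>+z. ennreal (F w * indicator {0..u} w) * indicator {..u - w} z \<partial>\<nu>)"
        by (intro nn_integral_cong) (auto simp: indicator_def)
      also have "\<dots> = ennreal (F w * indicator {0..u} w) * ennreal (1 - T (u - w))"
        by (subst nn_integral_cmult) (auto simp: emeasure_eq_measure T_compl)
      also have "\<dots> = ennreal (F w * (1 - T (u - w)) * indicator {0..u} w)"
        using F01 T01 by (subst ennreal_mult[symmetric]) (auto simp: indicator_def)
      finally show "(\<integral>\<^sup>+z. ennreal (F w * (if 0 \<le> w \<and> w \<le> u \<and> z \<le> u - w then 1 else 0)) \<partial>\<nu>) = \<dots>" .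
    qed
    finally have nn: "(\<integral>\<^sup>+v. ennreal (Q v * indicator {0..u} v) \<partial>lborel) =
        (\<integral>\<^sup>+w. ennreal (F w * (1 - T (u - w)) * indicator {0..u} w) \<partial>lborel)" .
    have FT_abs: "\<bar>F w * T (u - w)\<bar> \<le> 1" "\<bar>F w * (1 - T (u - w))\<bar> \<le> 1" for w
      using F01[of w] T01[of "u - w"] by (auto simp: abs_mult intro!: mult_le_one)
    have iF: "integrable lborel (\<lambda>w. F w * indicator {0..u} w)"
      by (rule int_ind) (auto simp: F_abs)
    have iFT: "integrable lborel (\<lambda>w. F w * T (u - w) * indicator {0..u} w)"
      by (rule int_ind) (auto simp: FT_abs)
    have iT: "integrable lborel (\<lambda>w. T w * indicator {0..u} w)"
      by (rule int_ind) (auto simp: T01)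
    have iQ: "integrable lborel (\<lambda>w. Q w * indicator {0..u} w)"
      by (rule int_ind) (auto simp: Q_abs)
    have "(\<integral>v. Q v * indicator {0..u} v \<partial>lborel) = (\<integral>w. F w * (1 - T (u - w)) * indicator {0..u} w \<partial>lborel)"
      using nn Q0 F01 T01 by (subst (1 2) integral_eq_nn_integral) (auto simp: indicator_def)
    also have "\<dots> = (\<integral>w. F w * indicator {0..u} w - F w * T (u - w) * indicator {0..u} w \<partial>lborel)"
      by (intro Bochner_Integration.integral_cong) (auto simp: algebra_simps)
    also have "\<dots> = (\<integral>w. F w * indicator {0..u} w \<partial>lborel) - (\<integral>w. F w * T (u - w) * indicator {0..u} w \<partial>lborel)"
      using iF iFT by simp
    finally have Qint: "(\<integral>v. Q v * indicator {0..u} v \<partial>lborel) = \<dots>" .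
    have "(\<integral>v. (F v - A v) * indicator {0..u} v \<partial>lborel) =
        (\<integral>v. F v * indicator {0..u} v - (T v * indicator {0..u} v + Q v * indicator {0..u} v) \<partial>lborel)"
      by (intro Bochner_Integration.integral_cong) (auto simp: A_eq algebra_simps)
    also have "\<dots> = (\<integral>w. F w * T (u - w) * indicator {0..u} w \<partial>lborel) - (\<integral>w. T w * indicator {0..u} w \<partial>lborel)"
      using iF iT iQ Qint by simp
    also have "(\<integral>w. F w * T (u - w) * indicator {0..u} w \<partial>lborel) = (\<integral>x. F (u - x) * T x * indicator {0..u} x \<partial>lborel)"
      by (subst lborel_integral_real_affine[where c = "-1" and t = u])
         (auto simp: indicator_def intro!: Bochner_Integration.integral_cong)
    finally show ?thesis using eq[OF u] unfolding A_def by simp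
  qed
  \<comment> \<open>The constant \<open>F 0\<close> is now found from the limit \<open>u \<rightarrow> \<infinity>\<close>.\<close>
  have nnT: "(\<integral>\<^sup>+x. ennreal (T x * indicator {0..} x) \<partial>lborel) = ennreal m1"
    unfolding mean(1)[symmetric] T_def by (intro nn_integral_cong) (auto simp: indicator_def)
  have iT: "integrable lborel (\<lambda>x. T x * indicator {0..} x)"
    using nnT T01 by (intro integrableI_nonneg) (auto simp: indicator_def)
  have IT: "(\<integral>x. T x * indicator {0..} x \<partial>lborel) = m1"
    using nnT mean(2) T01 by (subst integral_eq_nn_integral) (auto simp: indicator_def)
  have l1: "((\<lambda>u. \<integral>x. F (u - x) * T x * indicator {0..u} x \<partial>lborel) \<longlongrightarrow> (\<integral>x. 0 \<partial>(lborel :: real measure))) at_top"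
  proof (rule integral_dominated_convergence_at_top[where w = "\<lambda>x. T x * indicator {0..} x"])
    show "AE x in lborel. ((\<lambda>u. F (u - x) * T x * indicator {0..u} x) \<longlongrightarrow> 0) at_top"
    proof (rule AE_I2)
      fix x :: real
      have "filterlim (\<lambda>u. - x + u) at_top at_top"
        using filterlim_tendsto_add_at_top[OF tendsto_const[where k = "- x"] filterlim_ident[where F = at_top]] by simp
      then have "((\<lambda>u. F (- x + u)) \<longlongrightarrow> 0) at_top" by (rule filterlim_compose[OF F_lim])
      then have "((\<lambda>u. F (u - x) * T x) \<longlongrightarrow> 0) at_top"
        by (intro tendsto_mult_left_zero) simp
      then show "((\<lambda>u. F (u - x) * T x * indicator {0..u} x) \<longlongrightarrow> 0) at_top"
        by (rule tendsto_0_le[where K = 1], intro always_eventually allI) (simp add: indicator_def)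
    qed
    show "\<forall>\<^sub>F u in at_top. AE x in lborel. norm (F (u - x) * T x * indicator {0..u} x) \<le> T x * indicator {0..} x"
      using T01 F01 by (intro always_eventually allI AE_I2) (auto simp: indicator_def abs_mult intro!: mult_left_le_one_le)
  qed (use iT in auto)
  have l2: "((\<lambda>u. \<integral>x. T x * indicator {0..u} x \<partial>lborel) \<longlongrightarrow> (\<integral>x. T x * indicator {0..} x \<partial>lborel)) at_top"
  proof (rule integral_dominated_convergence_at_top[where w = "\<lambda>x. T x * indicator {0..} x"])
    show "AE x in lborel. ((\<lambda>u. T x * indicator {0..u} x) \<longlongrightarrow> T x * indicator {0..} x) at_top"
    proof (rule AE_I2)
      fix x
      have "\<forall>\<^sub>F u in at_top. T x * indicator {0..u} x = T x * indicator {0..} x"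
        using eventually_ge_at_top[of x] by eventually_elim (auto simp: indicator_def)
      then show "((\<lambda>u. T x * indicator {0..u} x) \<longlongrightarrow> T x * indicator {0..} x) at_top"
        by (rule tendsto_eventually)
    qed
    show "\<forall>\<^sub>F u in at_top. AE x in lborel. norm (T x * indicator {0..u} x) \<le> T x * indicator {0..} x"
      using T01 by (intro always_eventually allI AE_I2) (auto simp: indicator_def)
  qed (use iT in auto)
  have "((\<lambda>u. c * (F u - F 0)) \<longlongrightarrow> c * (0 - F 0)) at_top"
    by (intro tendsto_intros F_lim)
  moreover have "((\<lambda>u. c * (F u - F 0)) \<longlongrightarrow> lam * (0 - m1)) at_top"
  proof (rule Lim_transform_eventually)
    show "((\<lambda>u. lam * ((\<integral>x. F (u - x) * T x * indicator {0..u} x \<partial>lborel) -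
      (\<integral>x. T x * indicator {0..u} x \<partial>lborel))) \<longlongrightarrow> lam * (0 - m1)) at_top"
      using l1 l2 unfolding IT by (intro tendsto_intros) auto
    show "\<forall>\<^sub>F u in at_top. lam * ((\<integral>x. F (u - x) * T x * indicator {0..u} x \<partial>lborel) -
      (\<integral>x. T x * indicator {0..u} x \<partial>lborel)) = c * (F u - F 0)"
      using eventually_ge_at_top[of 0] by eventually_elim (simp add: key)
  qed
  ultimately have "c * (0 - F 0) = lam * (0 - m1)"
    by (rule tendsto_unique[rotated]) simp
  then show ?thesis using key[OF u] unfolding T_def by (simp add: algebra_simps)
qed

section \<open>Ruin of a compound Poisson walk on a time grid\<close>

text \<open>The walk moves up by \<open>a\<close> in each step and down by the claims of that step; \<open>k l\<close> counts the claims of step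
\<open>l\<close>, and \<open>z\<close> lists all claims. The horizon \<open>n\<close> is an extended natural number, so that finite and
infinite horizons obey the same recursion.\<close>

definition grid_ruin :: "real \<Rightarrow> enat \<Rightarrow> real \<Rightarrow> (nat \<Rightarrow> nat) \<Rightarrow> (nat \<Rightarrow> real) \<Rightarrow> bool" where
  "grid_ruin a n u k z \<longleftrightarrow> (\<exists>j. enat j \<le> n \<and> u + a * real j - (\<Sum>i<(\<Sum>l<j. k l). z i) < 0)"

text \<open>The Markov property on paths: after one step with \<open>m\<close> claims the walk starts afresh with the remaining
counts and claims.\<close>

lemma grid_ruin_step:
  assumes "0 \<le> u"
  shows "grid_ruin a (eSuc n) u (case_nat m k) (comb_seq m z z') \<longleftrightarrow>
         grid_ruin a n (u + a - (\<Sum>i<m. z i)) k z'"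
proof -
  have split: "(\<Sum>i<m + s. comb_seq m z z' i) = (\<Sum>i<m. z i) + (\<Sum>i<s. z' i)" for s
  proof (induction s)
    case 0
    show ?case by (simp add: comb_seq_less)
  next
    case (Suc s)
    then show ?case using comb_seq_add[of m z z' s] by (simp add: add.commute[of m])
  qed
  have count: "(\<Sum>l<Suc j. case_nat m k l) = m + (\<Sum>l<j. k l)" for j
    by (simp add: sum.lessThan_Suc_shift del: sum.lessThan_Suc)
  show ?thesis
  proof
    assume "grid_ruin a (eSuc n) u (case_nat m k) (comb_seq m z z')"
    then obtain j where j: "enat j \<le> eSuc n"
      and r: "u + a * real j - (\<Sum>i<(\<Sum>l<j. case_nat m k l). comb_seq m z z' i) < 0"
      by (auto simp: grid_ruin_def)
    have "j \<noteq> 0" using r assms by (intro notI) simp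
    then obtain j' where j': "j = Suc j'" by (cases j) auto
    have "enat j' \<le> n" using j unfolding j' by (simp add: eSuc_enat[symmetric])
    moreover have "u + a - (\<Sum>i<m. z i) + a * real j' - (\<Sum>i<(\<Sum>l<j'. k l). z' i) < 0"
      using r unfolding j' count split by (simp add: algebra_simps)
    ultimately show "grid_ruin a n (u + a - (\<Sum>i<m. z i)) k z'"
      by (auto simp: grid_ruin_def)
  next
    assume "grid_ruin a n (u + a - (\<Sum>i<m. z i)) k z'"
    then obtain j where j: "enat j \<le> n"
      and r: "u + a - (\<Sum>i<m. z i) + a * real j - (\<Sum>i<(\<Sum>l<j. k l). z' i) < 0"
      by (auto simp: grid_ruin_def)
    have "enat (Suc j) \<le> eSuc n" using j by (simp add: eSuc_enat[symmetric])
    moreover have "u + a * real (Suc j) - (\<Sum>i<(\<Sum>l<Suc j. case_nat m k l). comb_seq m z z' i) < 0"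
      using r unfolding count split by (simp add: algebra_simps)
    ultimately show "grid_ruin a (eSuc n) u (case_nat m k) (comb_seq m z z')"
      unfolding grid_ruin_def by blast
  qed
qed

locale grid_model =
  fixes p :: "nat pmf" and \<nu> :: "real measure"
  assumes prob_space_\<nu>: "prob_space \<nu>" and sets_\<nu> [measurable_cong]: "sets \<nu> = sets borel"
begin

interpretation nu: prob_space \<nu> by (rule prob_space_\<nu>)

sublocale Z: sequence_space \<nu>
  by unfold_locales

sublocale N: sequence_space "measure_pmf p"
  by unfold_locales

sublocale NZ: pair_prob_space N.S Z.S
  by unfold_locales

lemma space_\<nu>: "space \<nu> = UNIV"
  using sets_eq_imp_space_eq[OF sets_\<nu>] by simp

lemma space_NZ: "space (N.S \<Otimes>\<^sub>M Z.S) = UNIV"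
  by (auto simp: space_pair_measure space_PiM space_\<nu>)

lemma measurable_claim: "(\<lambda>z. z i) \<in> borel_measurable Z.S"
proof -
  have "(\<lambda>z. z i) \<in> measurable Z.S \<nu>" by measurable
  then show ?thesis by (simp cong: measurable_cong_sets add: measurable_cong_sets[OF refl sets_\<nu>])
qed

lemma measurable_count: "(\<lambda>k. k l) \<in> measurable N.S (count_space UNIV)"
proof -
  have "(\<lambda>k. k l) \<in> measurable N.S (measure_pmf p)" by measurable
  then show ?thesis by (simp add: measurable_cong_sets[OF refl sets_measure_pmf_count_space])
qed

lemma measurable_total_count [measurable]: "(\<lambda>k. \<Sum>l<j. k l) \<in> measurable N.S (count_space UNIV)"
proof (induction j)
  case (Suc j)
  have "(\<lambda>k. (\<Sum>l<j. k l) + k j) \<in> measurable N.S (count_space UNIV)"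
  proof (rule measurable_compose_countable[where f = "\<lambda>m k. m + k j" and g = "\<lambda>k. \<Sum>l<j. k l"])
    show "(\<lambda>k. m + k j) \<in> measurable N.S (count_space UNIV)" for m
      by (rule measurable_compose[OF measurable_count measurable_count_space])
  qed (rule Suc)
  then show ?case by simp
qed simp

lemma measurable_grid_ruin [measurable]:
  assumes [measurable]: "f \<in> measurable M N.S" "g \<in> measurable M Z.S" "v \<in> borel_measurable M"
  shows "Measurable.pred M (\<lambda>x. grid_ruin a n (v x) (f x) (g x))"
proof -
  have 1: "(\<lambda>x. \<Sum>i<(\<Sum>l<j. f x l). g x i) \<in> borel_measurable M" for j
  proof (rule measurable_compose_countable[where f = "\<lambda>m x. \<Sum>i<m. g x i" and g = "\<lambda>x. \<Sum>l<j. f x l"])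
    show "(\<lambda>x. \<Sum>l<j. f x l) \<in> measurable M (count_space UNIV)"
      using measurable_compose[OF assms(1) measurable_total_count[of j]] .
    show "(\<lambda>x. \<Sum>i<m. g x i) \<in> borel_measurable M" for m
      using measurable_compose[OF assms(2) measurable_claim] by (intro borel_measurable_sum)
  qed
  note 1 [measurable]
  show ?thesis unfolding grid_ruin_def by measurable
qed

definition grid_prob :: "real \<Rightarrow> enat \<Rightarrow> real \<Rightarrow> ennreal" where
  "grid_prob a n u = (\<integral>\<^sup>+k. (\<integral>\<^sup>+z. indicator {(k, z). grid_ruin a n u k z} (k, z) \<partial>Z.S) \<partial>N.S)"

lemma grid_prob_eq_emeasure:
  "grid_prob a n u = emeasure (N.S \<Otimes>\<^sub>M Z.S) {(k, z). grid_ruin a n u k z}"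
proof -
  have *: "{(k, z). grid_ruin a n u k z} \<in> sets (N.S \<Otimes>\<^sub>M Z.S)"
  proof -
    have "{\<omega> \<in> space (N.S \<Otimes>\<^sub>M Z.S). grid_ruin a n u (fst \<omega>) (snd \<omega>)} \<in> sets (N.S \<Otimes>\<^sub>M Z.S)"
      by measurable
    then show ?thesis by (simp add: space_NZ case_prod_beta')
  qed
  then show ?thesis unfolding grid_prob_def
    by (subst Z.P.emeasure_pair_measure) auto
qed

lemma measurable_grid_prob [measurable]: "grid_prob a n \<in> borel_measurable borel"
proof -
  have *: "grid_prob a n = (\<lambda>u. \<integral>\<^sup>+k. (\<integral>\<^sup>+z. (if grid_ruin a n u k z then 1 else 0) \<partial>Z.S) \<partial>N.S)"
    unfolding grid_prob_def by (intro ext nn_integral_cong) (auto simp: indicator_def)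
  show ?thesis unfolding * by measurable
qed

lemma nn_integral_N:
  assumes [measurable]: "f \<in> borel_measurable N.S"
  shows "(\<integral>\<^sup>+k. f k \<partial>N.S) = (\<integral>\<^sup>+m. (\<integral>\<^sup>+k. f (case_nat m k) \<partial>N.S) \<partial>measure_pmf p)"
proof -
  have "(\<integral>\<^sup>+k. f k \<partial>N.S) = (\<integral>\<^sup>+x. f (case x of (m, k) \<Rightarrow> case_nat m k) \<partial>(measure_pmf p \<Otimes>\<^sub>M N.S))"
    by (subst N.PiM_iter[symmetric]) (subst nn_integral_distr; measurable)
  also have "\<dots> = (\<integral>\<^sup>+m. (\<integral>\<^sup>+k. f (case_nat m k) \<partial>N.S) \<partial>measure_pmf p)"
    by (subst N.P.nn_integral_fst[symmetric]) auto
  finally show ?thesis .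
qed

text \<open>Cutting an i.i.d. sequence at a fixed index \<open>m\<close> leaves two independent i.i.d. sequences.\<close>

lemma nn_integral_Z:
  assumes [measurable]: "f \<in> borel_measurable Z.S"
  shows "(\<integral>\<^sup>+z. f z \<partial>Z.S) = (\<integral>\<^sup>+z. (\<integral>\<^sup>+z'. f (comb_seq m z z') \<partial>Z.S) \<partial>Z.S)"
proof -
  have "(\<integral>\<^sup>+z. f z \<partial>Z.S) = (\<integral>\<^sup>+x. f (case x of (z, z') \<Rightarrow> comb_seq m z z') \<partial>(Z.S \<Otimes>\<^sub>M Z.S))"
    by (subst Z.PiM_comb_seq[symmetric, of m]) (subst nn_integral_distr; measurable)
  also have "\<dots> = (\<integral>\<^sup>+z. (\<integral>\<^sup>+z'. f (comb_seq m z z') \<partial>Z.S) \<partial>Z.S)"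
    by (subst Z.P.nn_integral_fst[symmetric]) auto
  finally show ?thesis .
qed

lemma nn_integral_Z_Suc:
  assumes [measurable]: "f \<in> borel_measurable Z.S"
  shows "(\<integral>\<^sup>+z. f z \<partial>Z.S) = (\<integral>\<^sup>+x. (\<integral>\<^sup>+z. f (case_nat x z) \<partial>Z.S) \<partial>\<nu>)"
proof -
  have "(\<integral>\<^sup>+z. f z \<partial>Z.S) = (\<integral>\<^sup>+x. f (case x of (m, z) \<Rightarrow> case_nat m z) \<partial>(\<nu> \<Otimes>\<^sub>M Z.S))"
    by (subst Z.PiM_iter[symmetric]) (subst nn_integral_distr; measurable)
  also have "\<dots> = (\<integral>\<^sup>+x. (\<integral>\<^sup>+z. f (case_nat x z) \<partial>Z.S) \<partial>\<nu>)"
    by (subst Z.P.nn_integral_fst[symmetric]) auto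
  finally show ?thesis .
qed

lemma grid_prob_step:
  assumes u: "0 \<le> u"
  shows "grid_prob a (eSuc n) u =
    (\<integral>\<^sup>+m. (\<integral>\<^sup>+z. grid_prob a n (u + a - (\<Sum>i<m. z i)) \<partial>Z.S) \<partial>measure_pmf p)"
proof -
  define I :: "enat \<Rightarrow> real \<Rightarrow> (nat \<Rightarrow> nat) \<Rightarrow> (nat \<Rightarrow> real) \<Rightarrow> ennreal"
    where "I n v k z = (if grid_ruin a n v k z then 1 else 0)" for n v k z
  have [measurable]: "(\<lambda>x. I n (v x) (f x) (g x)) \<in> borel_measurable M"
    if [measurable]: "f \<in> measurable M N.S" "g \<in> measurable M Z.S" "v \<in> borel_measurable M" for n f g v and M :: "'z measure"
    unfolding I_def by measurable
  have gp: "grid_prob a n v = (\<integral>\<^sup>+k. (\<integral>\<^sup>+z. I n v k z \<partial>Z.S) \<partial>N.S)" for n v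
    unfolding grid_prob_def I_def by (intro nn_integral_cong) (auto simp: indicator_def)
  have "grid_prob a (eSuc n) u =
      (\<integral>\<^sup>+m. (\<integral>\<^sup>+k. (\<integral>\<^sup>+z. I (eSuc n) u (case_nat m k) z \<partial>Z.S) \<partial>N.S) \<partial>measure_pmf p)"
    unfolding gp by (rule nn_integral_N) measurable
  also have "\<dots> = (\<integral>\<^sup>+m. (\<integral>\<^sup>+z. grid_prob a n (u + a - (\<Sum>i<m. z i)) \<partial>Z.S) \<partial>measure_pmf p)"
  proof (rule nn_integral_cong)
    fix m
    have "(\<integral>\<^sup>+k. (\<integral>\<^sup>+z. I (eSuc n) u (case_nat m k) z \<partial>Z.S) \<partial>N.S) =
        (\<integral>\<^sup>+k. (\<integral>\<^sup>+z. (\<integral>\<^sup>+z'. I (eSuc n) u (case_nat m k) (comb_seq m z z') \<partial>Z.S) \<partial>Z.S) \<partial>N.S)"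
      by (intro nn_integral_cong nn_integral_Z) (auto simp: space_PiM)
    also have "\<dots> = (\<integral>\<^sup>+k. (\<integral>\<^sup>+z. (\<integral>\<^sup>+z'. I n (u + a - (\<Sum>i<m. z i)) k z' \<partial>Z.S) \<partial>Z.S) \<partial>N.S)"
      by (simp add: I_def grid_ruin_step[OF u])
    also have "\<dots> = (\<integral>\<^sup>+z. (\<integral>\<^sup>+k. (\<integral>\<^sup>+z'. I n (u + a - (\<Sum>i<m. z i)) k z' \<partial>Z.S) \<partial>N.S) \<partial>Z.S)"
      by (rule NZ.Fubini'[symmetric]) measurable
    finally show "(\<integral>\<^sup>+k. (\<integral>\<^sup>+z. I (eSuc n) u (case_nat m k) z \<partial>Z.S) \<partial>N.S) =
        (\<integral>\<^sup>+z. grid_prob a n (u + a - (\<Sum>i<m. z i)) \<partial>Z.S)"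
      unfolding gp .
  qed
  finally show ?thesis .
qed

lemma grid_prob_neg: "u < 0 \<Longrightarrow> grid_prob a n u = 1"
proof -
  assume u: "u < 0"
  have "{(k, z). grid_ruin a n u k z} = space (N.S \<Otimes>\<^sub>M Z.S)"
    using u by (auto simp: grid_ruin_def space_NZ zero_enat_def[symmetric] intro!: exI[of _ "0::nat"])
  then show ?thesis unfolding grid_prob_eq_emeasure by (simp add: NZ.emeasure_space_1)
qed

lemma grid_prob_le_1: "grid_prob a n u \<le> 1"
  unfolding grid_prob_eq_emeasure by (rule NZ.emeasure_le_1)

lemma mgf_sum:
  assumes M: "(\<integral>\<^sup>+x. ennreal (exp (r * x)) \<partial>\<nu>) = ennreal M"
  shows "(\<integral>\<^sup>+z. ennreal (exp (r * (\<Sum>i<m. z i))) \<partial>Z.S) = ennreal M ^ m"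
proof (induction m)
  case 0
  show ?case by (simp add: Z.P.emeasure_space_1)
next
  case (Suc m)
  have meas: "(\<lambda>z. ennreal (exp (r * (\<Sum>i<Suc m. z i)))) \<in> borel_measurable Z.S"
  proof -
    have "(\<lambda>z. \<Sum>i<Suc m. z i) \<in> borel_measurable Z.S"
      by (rule borel_measurable_sum) (rule measurable_claim)
    then show ?thesis by (intro measurable_compose[OF _ measurable_ennreal] measurable_compose[OF _ borel_measurable_exp]
      borel_measurable_times borel_measurable_const)
  qed
  have "(\<integral>\<^sup>+z. ennreal (exp (r * (\<Sum>i<Suc m. z i))) \<partial>Z.S) =
      (\<integral>\<^sup>+x. (\<integral>\<^sup>+z. ennreal (exp (r * (\<Sum>i<Suc m. case_nat x z i))) \<partial>Z.S) \<partial>\<nu>)"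
    by (rule nn_integral_Z_Suc[OF meas])
  also have "\<dots> = (\<integral>\<^sup>+x. (\<integral>\<^sup>+z. ennreal (exp (r * x)) * ennreal (exp (r * (\<Sum>i<m. z i))) \<partial>Z.S) \<partial>\<nu>)"
    by (simp add: sum.lessThan_Suc_shift distrib_left exp_add ennreal_mult del: sum.lessThan_Suc)
  also have "\<dots> = ennreal M ^ Suc m"
  proof -
    have "(\<integral>\<^sup>+x. ennreal (exp (r * x)) * ennreal M ^ m \<partial>\<nu>) = ennreal M * ennreal M ^ m"
      unfolding M[symmetric] by (rule nn_integral_multc) measurable
    then show ?thesis by (simp add: nn_integral_cmult Suc.IH)
  qed
  finally show ?case .
qed

text \<open>Induction on the horizon: \<open>exp (- r * u)\<close> bounds the indicator of \<open>u < 0\<close> and is preserved by a step of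
the walk, because \<open>pgf\<close> says that \<open>exp (- r * walk)\<close> has constant mean.\<close>

lemma lundberg_grid:
  assumes M: "(\<integral>\<^sup>+x. ennreal (exp (r * x)) \<partial>\<nu>) = ennreal M"
    and pgf: "(\<integral>\<^sup>+m. ennreal M ^ m \<partial>measure_pmf p) = ennreal (exp (r * a))" and r: "0 < r"
  shows "grid_prob a (enat n) u \<le> ennreal (exp (- r * u))"
proof (induction n arbitrary: u)
  case 0
  show ?case
  proof (cases "u < 0")
    case True
    then have "1 \<le> exp (- r * u)" using r by (simp add: mult_nonneg_nonpos)
    then show ?thesis using grid_prob_neg[OF True] by simp
  next
    case False
    then have "{(k, z). grid_ruin a (enat 0) u k z} = {}"
      by (auto simp: grid_ruin_def zero_enat_def)
    then show ?thesis unfolding grid_prob_eq_emeasure by (simp only: emeasure_empty zero_le)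
  qed
next
  case (Suc n)
  show ?case
  proof (cases "u < 0")
    case True
    then have "1 \<le> exp (- r * u)" using r by (simp add: mult_nonneg_nonpos)
    then show ?thesis using grid_prob_neg[OF True] by simp
  next
    case False
    have "grid_prob a (enat (Suc n)) u =
      (\<integral>\<^sup>+m. (\<integral>\<^sup>+z. grid_prob a (enat n) (u + a - (\<Sum>i<m. z i)) \<partial>Z.S) \<partial>measure_pmf p)"
      using grid_prob_step[of u a "enat n"] False by (simp add: eSuc_enat)
    also have "\<dots> \<le> (\<integral>\<^sup>+m. (\<integral>\<^sup>+z. ennreal (exp (- r * (u + a))) * ennreal (exp (r * (\<Sum>i<m. z i))) \<partial>Z.S) \<partial>measure_pmf p)"
      by (intro nn_integral_mono order_trans[OF Suc.IH])
         (simp add: ennreal_mult[symmetric] exp_add[symmetric] algebra_simps)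
    also have "\<dots> = ennreal (exp (- r * (u + a))) * ennreal (exp (r * a))"
      by (simp add: nn_integral_cmult mgf_sum[OF M] pgf)
    also have "\<dots> = ennreal (exp (- r * u))"
      by (simp add: ennreal_mult[symmetric] exp_add[symmetric] algebra_simps)
    finally show ?thesis .
  qed
qed

lemma grid_prob_infinity_SUP: "grid_prob a \<infinity> u = (SUP n. grid_prob a (enat n) u)"
proof -
  have m: "{(k, z). grid_ruin a n u k z} \<in> sets (N.S \<Otimes>\<^sub>M Z.S)" for n
  proof -
    have "{\<omega> \<in> space (N.S \<Otimes>\<^sub>M Z.S). grid_ruin a n u (fst \<omega>) (snd \<omega>)} \<in> sets (N.S \<Otimes>\<^sub>M Z.S)"
      by measurable
    then show ?thesis by (simp add: space_NZ case_prod_beta')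
  qed
  have "(SUP n. grid_prob a (enat n) u) = emeasure (N.S \<Otimes>\<^sub>M Z.S) (\<Union>n. {(k, z). grid_ruin a (enat n) u k z})"
    unfolding grid_prob_eq_emeasure
  proof (rule SUP_emeasure_incseq)
    show "range (\<lambda>n. {(k, z). grid_ruin a (enat n) u k z}) \<subseteq> sets (N.S \<Otimes>\<^sub>M Z.S)"
      using m by blast
    show "incseq (\<lambda>n. {(k, z). grid_ruin a (enat n) u k z})"
      unfolding incseq_def grid_ruin_def by (auto intro: le_trans)
  qed
  also have "(\<Union>n. {(k, z). grid_ruin a (enat n) u k z}) = {(k, z). grid_ruin a \<infinity> u k z}"
    by (auto simp: grid_ruin_def)
  finally show ?thesis by (simp add: grid_prob_eq_emeasure)
qed

lemma lundberg_grid_infinity: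
  assumes "(\<integral>\<^sup>+x. ennreal (exp (r * x)) \<partial>\<nu>) = ennreal M"
    and "(\<integral>\<^sup>+m. ennreal M ^ m \<partial>measure_pmf p) = ennreal (exp (r * a))" "0 < r"
  shows "grid_prob a \<infinity> u \<le> ennreal (exp (- r * u))"
  unfolding grid_prob_infinity_SUP by (rule SUP_least) (rule lundberg_grid[OF assms])

definition grid_psi :: "real \<Rightarrow> real \<Rightarrow> real" where
  "grid_psi a u = enn2real (grid_prob a \<infinity> u)"

lemma ennreal_grid_psi: "ennreal (grid_psi a u) = grid_prob a \<infinity> u"
  unfolding grid_psi_def using grid_prob_le_1[of a \<infinity> u] by (intro ennreal_enn2real) (auto simp: less_top[symmetric] top_unique)

lemma grid_psi_01: "0 \<le> grid_psi a u" "grid_psi a u \<le> 1"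
  unfolding grid_psi_def using grid_prob_le_1[of a \<infinity> u] by (auto intro: enn2real_leI)

lemma measurable_grid_psi [measurable]: "grid_psi a \<in> borel_measurable borel"
  unfolding grid_psi_def by measurable

lemma integral_component:
  fixes f :: "real \<Rightarrow> real"
  assumes [measurable]: "f \<in> borel_measurable borel"
  shows "(\<integral>z. f (z 0) \<partial>Z.S) = (\<integral>x. f x \<partial>\<nu>)"
proof -
  have "(\<integral>x. f x \<partial>distr Z.S \<nu> (\<lambda>z. z 0)) = (\<integral>z. f (z 0) \<partial>Z.S)"
    by (rule integral_distr) measurable
  then show ?thesis using Z.PiM_component[of 0] by simp
qed

text \<open>Two or more claims occur with probability at most \<open>r\<^sup>2\<close>, and replacing \<open>exp (- r)\<close> by \<open>1 - r\<close> and
\<open>r * exp (- r)\<close> by \<open>r\<close> costs at most \<open>r\<^sup>2\<close> each.\<close>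

lemma grid_psi_one_step:
  assumes p: "p = poisson_pmf r" and r: "0 < r" and u: "0 \<le> u"
  shows "\<bar>grid_psi a u - (1 - r) * grid_psi a (u + a) - r * (\<integral>z. grid_psi a (u + a - z) \<partial>\<nu>)\<bar> \<le> 3 * r\<^sup>2"
proof -
  define A where "A m = (\<integral>z. grid_psi a (u + a - (\<Sum>i<m. z i)) \<partial>Z.S)" for m
  have int: "integrable Z.S (\<lambda>z. grid_psi a (u + a - (\<Sum>i<m. z i)))" for m
    using grid_psi_01 by (intro Z.P.integrable_const_bound[where B = 1]) auto
  have A01: "0 \<le> A m" "A m \<le> 1" for m
  proof -
    show "0 \<le> A m" unfolding A_def using grid_psi_01 by (intro integral_nonneg_AE) auto
    have "A m \<le> (\<integral>z. 1 \<partial>Z.S)" unfolding A_def using grid_psi_01 by (intro integral_mono int) auto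
    then show "A m \<le> 1" by (simp add: Z.P.prob_space)
  qed
  have A0: "A 0 = grid_psi a (u + a)" by (simp add: A_def Z.P.prob_space)
  have A1: "A 1 = (\<integral>z. grid_psi a (u + a - z) \<partial>\<nu>)"
    unfolding A_def using integral_component[of "\<lambda>z. grid_psi a (u + a - z)"] by simp
  have intA: "integrable (measure_pmf p) A"
    using A01 by (intro measure_pmf.integrable_const_bound[where B = 1]) auto
  have "grid_prob a \<infinity> u = (\<integral>\<^sup>+m. (\<integral>\<^sup>+z. grid_prob a \<infinity> (u + a - (\<Sum>i<m. z i)) \<partial>Z.S) \<partial>measure_pmf p)"
    using grid_prob_step[OF u, of a \<infinity>] by (simp add: eSuc_infinity)
  also have "\<dots> = (\<integral>\<^sup>+m. ennreal (A m) \<partial>measure_pmf p)"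
    unfolding A_def ennreal_grid_psi[symmetric] using int grid_psi_01
    by (intro nn_integral_cong nn_integral_eq_integral) auto
  also have "\<dots> = ennreal (\<integral>m. A m \<partial>measure_pmf p)"
    using intA A01 by (intro nn_integral_eq_integral) auto
  finally have psi: "grid_psi a u = (\<integral>m. A m \<partial>measure_pmf p)"
    unfolding grid_psi_def using A01 by (simp add: integral_nonneg_AE)
  have int_ind: "integrable (measure_pmf p) (\<lambda>m. b m * indicator S m)" if "\<And>m. \<bar>b m\<bar> \<le> 1" for b :: "nat \<Rightarrow> real" and S
    using that by (intro measure_pmf.integrable_const_bound[where B = 1]) (auto simp: indicator_def)
  have pm: "measure_pmf.prob p {0} = exp (- r)" "measure_pmf.prob p {1} = r * exp (- r)"
    using r by (auto simp: p measure_pmf_single)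
  define Q where "Q = measure_pmf.prob p {2..}"
  have "measure_pmf.prob p (UNIV - {0, 1}) = 1 - measure_pmf.prob p {0, 1}"
    using measure_pmf.prob_compl[of "{0, 1}" p] by simp
  also have "UNIV - {0, 1} = {2::nat..}" by auto
  also have "measure_pmf.prob p {0, 1} = measure_pmf.prob p {0} + measure_pmf.prob p {1}"
    using measure_pmf.finite_measure_Union[of "{0}" p "{1}"] by (simp add: insert_commute)
  finally have Q: "Q = 1 - exp (- r) - r * exp (- r)" unfolding Q_def pm by simp
  have "(\<integral>m. A m \<partial>measure_pmf p) = (\<integral>m. A 0 * indicator {0} m + (A 1 * indicator {1} m + A m * indicator {2..} m) \<partial>measure_pmf p)"
  proof (rule Bochner_Integration.integral_cong)
    fix m :: nat
    have "m = 0 \<or> m = 1 \<or> m \<ge> 2" by linarith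
    then show "A m = A 0 * indicator {0} m + (A 1 * indicator {1} m + A m * indicator {2..} m)"
      by (auto simp: indicator_def)
  qed simp
  also have "\<dots> = A 0 * exp (- r) + (A 1 * (r * exp (- r)) + (\<integral>m. A m * indicator {2..} m \<partial>measure_pmf p))"
  proof -
    have i: "integrable (measure_pmf p) (\<lambda>m. A m * indicator {2..} m)"
      "integrable (measure_pmf p) (\<lambda>m. A 0 * indicator {0} m)"
      "integrable (measure_pmf p) (\<lambda>m. A 1 * indicator {1} m)"
      by (rule int_ind; simp add: A01)+
    have e: "(\<integral>m. A 0 * indicator {0} m \<partial>measure_pmf p) = A 0 * exp (- r)"
      "(\<integral>m. A 1 * indicator {1} m \<partial>measure_pmf p) = A 1 * (r * exp (- r))"
      using pm by auto
    show ?thesis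
      using i by (subst Bochner_Integration.integral_add, simp, simp, subst Bochner_Integration.integral_add) (simp_all only: e)
  qed
  finally have decomp: "grid_psi a u = A 0 * exp (- r) + (A 1 * (r * exp (- r)) + (\<integral>m. A m * indicator {2..} m \<partial>measure_pmf p))"
    unfolding psi .
  have rest0: "0 \<le> (\<integral>m. A m * indicator {2..} m \<partial>measure_pmf p)"
    using A01 by (intro integral_nonneg_AE) (auto simp: indicator_def)
  have "(\<integral>m. A m * indicator {2..} m \<partial>measure_pmf p) \<le> (\<integral>m. 1 * indicator {2..} m \<partial>measure_pmf p)"
    using A01 by (intro integral_mono int_ind) (auto simp: indicator_def)
  then have rest1: "(\<integral>m. A m * indicator {2..} m \<partial>measure_pmf p) \<le> Q" by (simp add: Q_def)
  have e1: "1 - r \<le> exp (- r)" using exp_ge_add_one_self[of "- r"] by simp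
  have e2: "exp (- r) \<le> 1 - r + r\<^sup>2"
  proof -
    have "exp (- r) = 1 / exp r" by (simp add: exp_minus inverse_eq_divide)
    also have "\<dots> \<le> 1 / (1 + r)" using r exp_ge_add_one_self[of r] by (intro divide_left_mono) auto
    also have "\<dots> \<le> 1 - r + r\<^sup>2"
    proof -
      have "(1 - r + r\<^sup>2) * (1 + r) = 1 + r ^ 3" by (simp add: algebra_simps power2_eq_square power3_eq_cube)
      then have "1 \<le> (1 - r + r\<^sup>2) * (1 + r)" using r by simp
      then show ?thesis using r by (simp add: pos_divide_le_eq)
    qed
    finally show ?thesis .
  qed
  have rr: "r * (1 - r) \<le> r * exp (- r)" "r * exp (- r) \<le> r"
    using r e1 by (auto intro!: mult_left_mono)
  have Qle: "Q \<le> r\<^sup>2" using e1 rr unfolding Q by (simp add: algebra_simps power2_eq_square)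
  have "\<bar>A 0 * (exp (- r) - (1 - r))\<bar> \<le> 1 * r\<^sup>2"
    unfolding abs_mult using A01 e1 e2 by (intro mult_mono) auto
  moreover have "\<bar>A 1 * (r * exp (- r) - r)\<bar> \<le> 1 * r\<^sup>2"
    unfolding abs_mult using A01 rr by (intro mult_mono) (auto simp: algebra_simps power2_eq_square)
  moreover have "grid_psi a u - (1 - r) * A 0 - r * A 1 = A 0 * (exp (- r) - (1 - r)) + A 1 * (r * exp (- r) - r)
      + (\<integral>m. A m * indicator {2..} m \<partial>measure_pmf p)"
    unfolding decomp by (simp add: algebra_simps)
  ultimately have "\<bar>grid_psi a u - (1 - r) * A 0 - r * A 1\<bar> \<le> 3 * r\<^sup>2"
    using rest0 rest1 Qle by linarith
  then show ?thesis unfolding A0 A1 .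
qed

end

lemma nn_integral_poisson_power:
  assumes "0 < r" "0 \<le> M"
  shows "(\<integral>\<^sup>+m. ennreal M ^ m \<partial>measure_pmf (poisson_pmf r)) = ennreal (exp (r * (M - 1)))"
proof -
  have "(\<integral>\<^sup>+m. ennreal M ^ m \<partial>measure_pmf (poisson_pmf r)) =
      (\<integral>\<^sup>+m. ennreal (exp (- r) * ((r * M) ^ m /\<^sub>R fact m)) \<partial>count_space UNIV)"
    unfolding nn_integral_measure_pmf using assms
    by (intro nn_integral_cong) (simp add: ennreal_power ennreal_mult[symmetric] power_mult_distrib divide_inverse mult_ac)
  also have "\<dots> = (\<Sum>m. ennreal (exp (- r) * ((r * M) ^ m /\<^sub>R fact m)))"
    by (rule nn_integral_count_space_nat)
  also have "\<dots> = ennreal (exp (- r) * exp (r * M))"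
    using assms exp_converges[of "r * M"]
    by (intro suminf_ennreal_eq sums_mult) auto
  also have "exp (- r) * exp (r * M) = exp (r * (M - 1))"
    by (simp add: exp_add[symmetric] algebra_simps)
  finally show ?thesis .
qed

section \<open>Surplus paths and their integer skeletons\<close>

text \<open>Path properties of a reserve process, together with the law \<open>\<nu>\<close> of its claims but without any
independence.\<close>

locale risk_model = prob_space "sample X" for X :: "'a reserve_model" +
  fixes \<nu> :: "real measure"
  assumes premium_pos: "0 < premium X" and intensity_pos: "0 < intensity X"
    and measurable_claim [measurable]: "\<And>i. claim X i \<in> borel_measurable (sample X)"
    and measurable_arrivals: "\<And>t. 0 \<le> t \<Longrightarrow> arrivals X t \<in> measurable (sample X) (count_space UNIV)"
    and arrivals_0: "\<And>\<omega>. \<omega> \<in> space (sample X) \<Longrightarrow> arrivals X 0 \<omega> = 0"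
    and arrivals_mono: "\<And>\<omega> s t. \<omega> \<in> space (sample X) \<Longrightarrow> 0 \<le> s \<Longrightarrow> s \<le> t \<Longrightarrow> arrivals X s \<omega> \<le> arrivals X t \<omega>"
    and arrivals_right_cont: "\<And>\<omega> t. \<omega> \<in> space (sample X) \<Longrightarrow> 0 \<le> t \<Longrightarrow>
      ((\<lambda>s. arrivals X s \<omega>) \<longlongrightarrow> arrivals X t \<omega>) (at_right t)"
    and claim_pos: "\<And>i. AE \<omega> in sample X. 0 < claim X i \<omega>"
    and prob_space_\<nu>: "prob_space \<nu>" and sets_\<nu>: "sets \<nu> = sets borel"
    and AE_\<nu>_pos: "AE z in \<nu>. 0 < z"
begin

lemma grid_model_\<nu>: "grid_model \<nu>"
  by (rule grid_model.intro) (rule prob_space_\<nu> sets_\<nu>)+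

definition increments :: "real \<Rightarrow> 'a \<Rightarrow> nat \<Rightarrow> nat" where
  "increments h \<omega> l = arrivals X (h * Suc l) \<omega> - arrivals X (h * l) \<omega>"

lemma sum_increments:
  assumes "\<omega> \<in> space (sample X)" "0 < h"
  shows "(\<Sum>l<j. increments h \<omega> l) = arrivals X (h * j) \<omega>"
proof (induction j)
  case 0 then show ?case using arrivals_0[OF assms(1)] by simp
next
  case (Suc j)
  have "arrivals X (h * j) \<omega> \<le> arrivals X (h * Suc j) \<omega>"
    using assms by (intro arrivals_mono) (auto intro: mult_left_mono)
  then show ?case using Suc by (simp add: increments_def)
qed

text \<open>The arrivals in the cells of the grid of mesh \<open>h\<close> are i.i.d. Poisson variables, independent of the i.i.d.
claims.\<close>

definition joint_law :: "real \<Rightarrow> bool" where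
  "joint_law h \<longleftrightarrow> (\<lambda>\<omega>. (increments h \<omega>, \<lambda>i. claim X i \<omega>)) \<in>
       measurable (sample X) (PiM UNIV (\<lambda>_. count_space UNIV) \<Otimes>\<^sub>M PiM UNIV (\<lambda>_. borel)) \<and>
     distr (sample X) (PiM UNIV (\<lambda>_. count_space UNIV) \<Otimes>\<^sub>M PiM UNIV (\<lambda>_. borel))
       (\<lambda>\<omega>. (increments h \<omega>, \<lambda>i. claim X i \<omega>)) =
     PiM UNIV (\<lambda>_. measure_pmf (poisson_pmf (intensity X * h))) \<Otimes>\<^sub>M PiM UNIV (\<lambda>_. \<nu>)"

definition ruin_on_grid :: "real \<Rightarrow> real \<Rightarrow> 'a set" where
  "ruin_on_grid h u = {\<omega> \<in> space (sample X). \<exists>j::nat. reserve X u (h * j) \<omega> < 0}"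

lemma measurable_reserve [measurable]: "0 \<le> t \<Longrightarrow> reserve X u t \<in> borel_measurable (sample X)"
proof -
  assume t: "0 \<le> t"
  have "(\<lambda>\<omega>. \<Sum>i<arrivals X t \<omega>. claim X i \<omega>) \<in> borel_measurable (sample X)"
    by (rule measurable_compose_countable[where f = "\<lambda>m \<omega>. \<Sum>i<m. claim X i \<omega>", OF _ measurable_arrivals[OF t]]) measurable
  then show ?thesis unfolding reserve_def by measurable
qed

lemma sets_ruin_on_grid: "0 < h \<Longrightarrow> ruin_on_grid h u \<in> sets (sample X)"
  unfolding ruin_on_grid_def by measurable

lemma prob_ruin_on_grid:
  assumes h: "0 < h" and "joint_law h"
  shows "prob (ruin_on_grid h u) = grid_model.grid_psi (poisson_pmf (intensity X * h)) \<nu> (premium X * h) u"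
proof -
  let ?p = "poisson_pmf (intensity X * h)"
  interpret G: grid_model ?p \<nu> by (rule grid_model_\<nu>)
  let ?V = "\<lambda>\<omega>. (increments h \<omega>, \<lambda>i. claim X i \<omega>)"
  have law: "distr (sample X) (PiM UNIV (\<lambda>_. count_space UNIV) \<Otimes>\<^sub>M PiM UNIV (\<lambda>_. borel)) ?V = G.N.S \<Otimes>\<^sub>M G.Z.S"
    and Vm: "?V \<in> measurable (sample X) (PiM UNIV (\<lambda>_. count_space UNIV) \<Otimes>\<^sub>M PiM UNIV (\<lambda>_. borel))"
    using assms(2) by (simp_all add: joint_law_def)
  have sets_eq: "sets (PiM UNIV (\<lambda>_. count_space UNIV) \<Otimes>\<^sub>M PiM UNIV (\<lambda>_. borel)) = sets (G.N.S \<Otimes>\<^sub>M G.Z.S)"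
    by (intro sets_pair_measure_cong sets_PiM_cong) (auto simp: sets_\<nu>)
  let ?D = "{(k, z). grid_ruin (premium X * h) \<infinity> u k z}"
  have D: "?D \<in> sets (G.N.S \<Otimes>\<^sub>M G.Z.S)"
  proof -
    have "{\<omega> \<in> space (G.N.S \<Otimes>\<^sub>M G.Z.S). grid_ruin (premium X * h) \<infinity> u (fst \<omega>) (snd \<omega>)} \<in> sets (G.N.S \<Otimes>\<^sub>M G.Z.S)"
      by measurable
    then show ?thesis by (simp add: G.space_NZ case_prod_beta')
  qed
  have "grid_model.grid_prob ?p \<nu> (premium X * h) \<infinity> u = emeasure (sample X) (?V -` ?D \<inter> space (sample X))"
    unfolding G.grid_prob_eq_emeasure law[symmetric]
    by (rule emeasure_distr[OF Vm]) (use D sets_eq in simp)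
  also have "?V -` ?D \<inter> space (sample X) = ruin_on_grid h u"
    using h by (auto simp: ruin_on_grid_def grid_ruin_def sum_increments reserve_def mult.assoc)
  finally show ?thesis unfolding G.grid_psi_def by (simp add: measure_def)
qed

lemma ruin_time_finite_iff: "ruin_time X u \<omega> < \<infinity> \<longleftrightarrow> (\<exists>t\<ge>0. reserve X u t \<omega> < 0)"
  unfolding ruin_time_def by (auto simp only: Inf_less_iff) auto

lemma ruin_event_iff:
  "\<omega> \<in> {\<omega> \<in> space (sample X). ruin_time X u \<omega> < \<infinity>} \<longleftrightarrow> \<omega> \<in> space (sample X) \<and> (\<exists>t\<ge>0. reserve X u t \<omega> < 0)"
  by (simp only: mem_Collect_eq ruin_time_finite_iff)

definition dyadic :: "nat \<Rightarrow> real" where "dyadic n = 1 / 2 ^ n"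

lemma dyadic_pos: "0 < dyadic n" by (simp add: dyadic_def)

lemma dyadic_tendsto: "dyadic \<longlonglongrightarrow> 0"
  unfolding dyadic_def by (simp add: LIMSEQ_divide_realpow_zero)

lemma dyadic_mono: "m \<le> n \<Longrightarrow> dyadic n \<le> dyadic m"
  unfolding dyadic_def by (simp add: divide_le_cancel frac_le power_increasing)

lemma dyadic_refine: "m \<le> n \<Longrightarrow> dyadic m * real j = dyadic n * real (j * 2 ^ (n - m))"
proof -
  assume "m \<le> n"
  then have "(2::real) ^ n = 2 ^ m * 2 ^ (n - m)" by (simp add: power_add[symmetric])
  then show ?thesis unfolding dyadic_def by simp
qed

text \<open>After a time at which the reserve is negative it stays negative for a while, since the arrivals are
right-continuous; hence also at some dyadic time.\<close>

lemma ruin_iff_dyadic: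
  assumes \<omega>: "\<omega> \<in> space (sample X)"
  shows "(\<exists>t\<ge>0. reserve X u t \<omega> < 0) \<longleftrightarrow> (\<exists>n j::nat. reserve X u (dyadic n * real j) \<omega> < 0)"
proof
  assume "\<exists>t\<ge>0. reserve X u t \<omega> < 0"
  then obtain t where t: "0 \<le> t" "reserve X u t \<omega> < 0" by auto
  have "\<forall>\<^sub>F s in at_right t. arrivals X s \<omega> = arrivals X t \<omega>"
    using arrivals_right_cont[OF \<omega> t(1)] by (simp add: tendsto_discrete)
  moreover have "\<forall>\<^sub>F s in at_right t. premium X * (s - t) < - reserve X u t \<omega>"
  proof (rule order_tendstoD(2))
    show "((\<lambda>s. premium X * (s - t)) \<longlongrightarrow> premium X * (t - t)) (at_right t)"
      by (intro tendsto_intros)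
  qed (use t in simp)
  ultimately have "\<forall>\<^sub>F s in at_right t. reserve X u s \<omega> < 0"
    by eventually_elim (simp add: reserve_def algebra_simps)
  then obtain b where b: "t < b" "\<And>s. t < s \<Longrightarrow> s < b \<Longrightarrow> reserve X u s \<omega> < 0"
    by (auto simp: eventually_at_right_field)
  obtain n where n: "dyadic n < b - t"
    using order_tendstoD(2)[OF dyadic_tendsto, of "b - t"] b(1) by (auto simp: eventually_sequentially)
  \<comment> \<open>The first grid point strictly after \<open>t\<close>.\<close>
  define j where "j = nat \<lfloor>t / dyadic n\<rfloor> + 1"
  have r: "0 \<le> t / dyadic n" using t(1) dyadic_pos[of n] by simp
  have "real j = of_int \<lfloor>t / dyadic n\<rfloor> + 1" using r by (simp add: j_def)
  then have "t / dyadic n < real j" "real j \<le> t / dyadic n + 1" by linarith+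
  then have "t < dyadic n * real j" "dyadic n * real j \<le> t + dyadic n"
    using dyadic_pos[of n] by (simp_all add: field_simps)
  then have "reserve X u (dyadic n * real j) \<omega> < 0" using b n by auto
  then show "\<exists>n j::nat. reserve X u (dyadic n * real j) \<omega> < 0" by blast
next
  assume "\<exists>n j::nat. reserve X u (dyadic n * real j) \<omega> < 0"
  then show "\<exists>t\<ge>0. reserve X u t \<omega> < 0" using dyadic_pos by (metis less_imp_le mult_nonneg_nonneg of_nat_0_le_iff)
qed

text \<open>The shifts \<open>s n\<close> are allowed because the limit equation needs the grid probabilities along
\<open>u + c * h\<close> as well as at \<open>u\<close>; the ruin events increase to the event of ruin in either case.\<close>

lemma ruin_prob_limit:
  assumes s: "\<And>n. 0 \<le> s n" "decseq s" "s \<longlonglongrightarrow> 0"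
  shows "(\<lambda>n. prob (ruin_on_grid (dyadic n) (u + s n))) \<longlonglongrightarrow> ruin_prob X u"
proof -
  let ?E = "\<lambda>n. ruin_on_grid (dyadic n) (u + s n)"
  have inc: "incseq ?E"
    unfolding incseq_def
  proof (intro allI impI subsetI)
    fix m n :: nat and \<omega> assume mn: "m \<le> n" and "\<omega> \<in> ?E m"
    then obtain j where \<omega>: "\<omega> \<in> space (sample X)" and j: "reserve X (u + s m) (dyadic m * real j) \<omega> < 0"
      by (auto simp: ruin_on_grid_def)
    have "s n \<le> s m" using s(2) mn by (simp add: decseq_def)
    then have "reserve X (u + s n) (dyadic n * real (j * 2 ^ (n - m))) \<omega> < 0"
      using j unfolding dyadic_refine[OF mn, of j] by (simp add: reserve_def)
    then show "\<omega> \<in> ?E n" using \<omega> unfolding ruin_on_grid_def by blast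
  qed
  have Un: "(\<Union>n. ?E n) = {\<omega> \<in> space (sample X). ruin_time X u \<omega> < \<infinity>}"
  proof (rule set_eqI)
    fix \<omega>
    show "\<omega> \<in> (\<Union>n. ?E n) \<longleftrightarrow> \<omega> \<in> {\<omega> \<in> space (sample X). ruin_time X u \<omega> < \<infinity>}"
    proof
      assume "\<omega> \<in> (\<Union>n. ?E n)"
      then obtain n and j :: nat where \<omega>: "\<omega> \<in> space (sample X)" and j: "reserve X (u + s n) (dyadic n * real j) \<omega> < 0"
        by (auto simp: ruin_on_grid_def)
      then have "reserve X u (dyadic n * real j) \<omega> < 0" using s(1)[of n] by (simp add: reserve_def)
      then show "\<omega> \<in> {\<omega> \<in> space (sample X). ruin_time X u \<omega> < \<infinity>}"
        unfolding ruin_event_iff ruin_iff_dyadic[OF \<omega>] using \<omega> by blast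
    next
      assume "\<omega> \<in> {\<omega> \<in> space (sample X). ruin_time X u \<omega> < \<infinity>}"
      then have \<omega>: "\<omega> \<in> space (sample X)" and "\<exists>t\<ge>0. reserve X u t \<omega> < 0" unfolding ruin_event_iff by blast+
      then obtain n and j :: nat where j: "reserve X u (dyadic n * real j) \<omega> < 0" using ruin_iff_dyadic by blast
      have "\<forall>\<^sub>F m in sequentially. s m < - reserve X u (dyadic n * real j) \<omega>"
        using j by (intro order_tendstoD(2)[OF s(3)]) simp
      then obtain m0 where m0: "\<And>m. m0 \<le> m \<Longrightarrow> s m < - reserve X u (dyadic n * real j) \<omega>"
        by (auto simp: eventually_sequentially)
      define m where "m = max m0 n"
      have "reserve X (u + s m) (dyadic m * real (j * 2 ^ (m - n))) \<omega> < 0"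
        using m0[of m] dyadic_refine[of n m j] by (simp add: reserve_def m_def)
      then have "\<omega> \<in> ?E m" using \<omega> unfolding ruin_on_grid_def by blast
      then show "\<omega> \<in> (\<Union>n. ?E n)" by blast
    qed
  qed
  have "(\<lambda>n. prob (?E n)) \<longlonglongrightarrow> prob (\<Union>n. ?E n)"
    by (rule finite_Lim_measure_incseq[OF _ inc]) (auto intro: sets_ruin_on_grid dyadic_pos)
  then show ?thesis unfolding Un ruin_prob_def .
qed

lemma prob_ruin_on_grid_antimono: "0 < h \<Longrightarrow> antimono (\<lambda>u. prob (ruin_on_grid h u))"
proof (rule antimonoI, rule finite_measure_mono)
  fix u v :: real assume uv: "u \<le> v"
  show "ruin_on_grid h v \<subseteq> ruin_on_grid h u"
  proof
    fix \<omega> assume "\<omega> \<in> ruin_on_grid h v"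
    then obtain j :: nat where "\<omega> \<in> space (sample X)" "reserve X v (h * j) \<omega> < 0"
      by (auto simp: ruin_on_grid_def)
    moreover from this uv have "reserve X u (h * j) \<omega> < 0" by (simp add: reserve_def)
    ultimately show "\<omega> \<in> ruin_on_grid h u" unfolding ruin_on_grid_def by blast
  qed
qed (rule sets_ruin_on_grid)

lemma ruin_prob_dyadic_limit: "(\<lambda>n. prob (ruin_on_grid (dyadic n) u)) \<longlonglongrightarrow> ruin_prob X u"
  using ruin_prob_limit[of "\<lambda>_. 0" u] by (simp add: decseq_def)

lemma ruin_prob_antimono: "antimono (ruin_prob X)"
proof (rule antimonoI)
  fix u v :: real assume "u \<le> v"
  then show "ruin_prob X v \<le> ruin_prob X u"
    using prob_ruin_on_grid_antimono[OF dyadic_pos]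
    by (intro LIMSEQ_le[OF ruin_prob_dyadic_limit ruin_prob_dyadic_limit]) (auto simp: monotone_def)
qed

lemma ruin_prob_01: "0 \<le> ruin_prob X u" "ruin_prob X u \<le> 1"
  unfolding ruin_prob_def by auto

lemma ruin_prob_neg: "u < 0 \<Longrightarrow> ruin_prob X u = 1"
proof -
  assume u: "u < 0"
  have "\<omega> \<in> space (sample X) \<Longrightarrow> reserve X u 0 \<omega> < 0" for \<omega> using u arrivals_0 by (simp add: reserve_def)
  then have "{\<omega> \<in> space (sample X). ruin_time X u \<omega> < \<infinity>} = space (sample X)"
    unfolding set_eq_iff ruin_event_iff by blast
  then show ?thesis by (simp add: ruin_prob_def prob_space)
qed

lemma AE_partial_sums_mono:
  "AE \<omega> in sample X. \<forall>m n. m \<le> n \<longrightarrow> (\<Sum>i<m. claim X i \<omega>) \<le> (\<Sum>i<n. claim X i \<omega>)"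
proof -
  have "AE \<omega> in sample X. \<forall>i. 0 < claim X i \<omega>"
    using claim_pos by (simp add: AE_all_countable)
  then show ?thesis
  proof eventually_elim
    case (elim \<omega>)
    have "(\<Sum>i<m. claim X i \<omega>) \<le> (\<Sum>i<n. claim X i \<omega>)" if "m \<le> n" for m n
      using that elim by (intro sum_mono2) (auto intro: less_imp_le)
    then show ?case by blast
  qed
qed

lemma ruin_event_eq: "{\<omega> \<in> space (sample X). ruin_time X u \<omega> < \<infinity>} = (\<Union>n. ruin_on_grid (dyadic n) u)"
proof (rule set_eqI)
  fix \<omega>
  show "\<omega> \<in> {\<omega> \<in> space (sample X). ruin_time X u \<omega> < \<infinity>} \<longleftrightarrow> \<omega> \<in> (\<Union>n. ruin_on_grid (dyadic n) u)"
    unfolding ruin_event_iff ruin_on_grid_def using ruin_iff_dyadic[of \<omega> u] by blast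
qed

lemma sets_ruin_event: "{\<omega> \<in> space (sample X). ruin_time X u \<omega> < \<infinity>} \<in> sets (sample X)"
  unfolding ruin_event_eq by (auto intro: sets_ruin_on_grid dyadic_pos)

lemma skeleton_le_ruin_prob: "prob (ruin_on_grid 1 u) \<le> ruin_prob X u"
  unfolding ruin_prob_def
proof (rule finite_measure_mono[OF _ sets_ruin_event], rule subsetI)
  fix \<omega> assume "\<omega> \<in> ruin_on_grid 1 u"
  then obtain j :: nat where "\<omega> \<in> space (sample X)" "reserve X u (1 * real j) \<omega> < 0"
    unfolding ruin_on_grid_def by blast
  then show "\<omega> \<in> {\<omega> \<in> space (sample X). ruin_time X u \<omega> < \<infinity>}"
    unfolding ruin_event_iff by (intro conjI exI[of _ "1 * real j"]) auto
qed

text \<open>Claims are positive, so from a time at which the reserve is negative to the next integer it grows by at most the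
premium of one unit of time.\<close>

lemma ruin_prob_le_skeleton: "ruin_prob X u \<le> prob (ruin_on_grid 1 (u - premium X))"
  unfolding ruin_prob_def
proof (rule finite_measure_mono_AE)
  show "AE \<omega> in sample X. \<omega> \<in> {\<omega> \<in> space (sample X). ruin_time X u \<omega> < \<infinity>} \<longrightarrow> \<omega> \<in> ruin_on_grid 1 (u - premium X)"
    using AE_partial_sums_mono AE_space
  proof eventually_elim
    case (elim \<omega>)
    show ?case
    proof
      assume "\<omega> \<in> {\<omega> \<in> space (sample X). ruin_time X u \<omega> < \<infinity>}"
      then obtain t where t: "0 \<le> t" "reserve X u t \<omega> < 0" unfolding ruin_event_iff by blast
      define n where "n = nat \<lceil>t\<rceil>"
      have "real n = of_int \<lceil>t\<rceil>" using t(1) by (simp add: n_def)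
      then have n: "t \<le> real n" "real n \<le> t + 1" by linarith+
      have "(\<Sum>i<arrivals X t \<omega>. claim X i \<omega>) \<le> (\<Sum>i<arrivals X n \<omega>. claim X i \<omega>)"
        using elim arrivals_mono[OF elim(2) t(1) n(1)] by auto
      moreover have "premium X * real n \<le> premium X * t + premium X"
        using mult_left_mono[OF n(2), of "premium X"] premium_pos by (simp add: distrib_left)
      ultimately have "reserve X (u - premium X) (1 * real n) \<omega> < 0"
        using t(2) by (simp add: reserve_def)
      then show "\<omega> \<in> ruin_on_grid 1 (u - premium X)"
        using elim(2) unfolding ruin_on_grid_def by blast
    qed
  qed
qed (simp add: sets_ruin_on_grid)

lemma skeleton_lundberg:
  assumes M: "(\<integral>\<^sup>+x. ennreal (exp (r * x)) \<partial>\<nu>) = ennreal M" and M0: "0 \<le> M"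
    and eq: "intensity X * (M - 1) = r * premium X" and r: "0 < r" and h: "0 < h" "joint_law h"
  shows "prob (ruin_on_grid h u) \<le> exp (- r * u)"
proof -
  interpret G: grid_model "poisson_pmf (intensity X * h)" \<nu> by (rule grid_model_\<nu>)
  have "(\<integral>\<^sup>+m. ennreal M ^ m \<partial>measure_pmf (poisson_pmf (intensity X * h))) =
      ennreal (exp (intensity X * h * (M - 1)))"
    using intensity_pos h M0 by (intro nn_integral_poisson_power) auto
  also have "intensity X * h * (M - 1) = h * (intensity X * (M - 1))" by (simp add: mult_ac)
  also have "\<dots> = r * (premium X * h)" unfolding eq by (simp add: mult_ac)
  finally have "G.grid_prob (premium X * h) \<infinity> u \<le> ennreal (exp (- r * u))"
    by (intro G.lundberg_grid_infinity[OF M _ r])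
  then show "prob (ruin_on_grid h u) \<le> exp (- r * u)"
    unfolding prob_ruin_on_grid[OF h] G.grid_psi_def by (intro enn2real_leI) auto
qed

end

text \<open>For these models all the grid probabilities are those of compound Poisson walks, so that the mesh can be
refined.\<close>

locale independent_risk_model = risk_model +
  assumes joint_law: "\<And>h. 0 < h \<Longrightarrow> joint_law h"
begin

lemma ruin_prob_backward:
  assumes u: "0 \<le> u"
  shows "premium X * (ruin_prob X u - ruin_prob X 0) =
    intensity X * (\<integral>v. (ruin_prob X v - (\<integral>z. ruin_prob X (v - z) \<partial>\<nu>)) * indicator {0..u} v \<partial>lborel)"
proof (rule discretized_backward_equation_limit[where h = dyadic and f = "\<lambda>n u. prob (ruin_on_grid (dyadic n) u)" and C = "3 * (intensity X)\<^sup>2"])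
  show "antimono (\<lambda>u. prob (ruin_on_grid (dyadic n) u))" for n by (rule prob_ruin_on_grid_antimono[OF dyadic_pos])
  show "(\<lambda>n. prob (ruin_on_grid (dyadic n) (v + premium X * dyadic n))) \<longlonglongrightarrow> ruin_prob X v" for v
    using premium_pos dyadic_mono dyadic_tendsto
    by (intro ruin_prob_limit) (auto simp: decseq_def less_imp_le[OF dyadic_pos] intro!: tendsto_mult_right_zero)
  fix n and v :: real assume v: "0 \<le> v"
  interpret G: grid_model "poisson_pmf (intensity X * dyadic n)" \<nu> by (rule grid_model_\<nu>)
  show "\<bar>prob (ruin_on_grid (dyadic n) v) - (1 - intensity X * dyadic n) * prob (ruin_on_grid (dyadic n) (v + premium X * dyadic n)) -
         intensity X * dyadic n * (\<integral>z. prob (ruin_on_grid (dyadic n) (v + premium X * dyadic n - z)) \<partial>\<nu>)\<bar>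
       \<le> 3 * (intensity X)\<^sup>2 * (dyadic n)\<^sup>2"
    using G.grid_psi_one_step[OF refl _ v, of "premium X * dyadic n"] intensity_pos dyadic_pos[of n]
    unfolding prob_ruin_on_grid[OF dyadic_pos joint_law[OF dyadic_pos]] by (simp add: power_mult_distrib mult.assoc)
qed (use prob_space_\<nu> sets_\<nu> dyadic_pos dyadic_tendsto premium_pos ruin_prob_antimono ruin_prob_dyadic_limit u in auto)

lemma lundberg_inequality:
  assumes M: "(\<integral>\<^sup>+x. ennreal (exp (r * x)) \<partial>\<nu>) = ennreal M" and M0: "0 \<le> M"
    and eq: "intensity X * (M - 1) = r * premium X" and r: "0 < r"
  shows "ruin_prob X u \<le> exp (- r * u)"
  by (rule LIMSEQ_le_const2[OF ruin_prob_dyadic_limit])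
     (use skeleton_lundberg[OF assms dyadic_pos joint_law[OF dyadic_pos]] in auto)

end


section \<open>Arrivals and claims of a compound Poisson model\<close>

locale compound_poisson =
  fixes X :: "'a reserve_model"
  assumes model: "compound_poisson_model X"
begin

definition \<nu> :: "real measure" where "\<nu> = distr (sample X) borel (claim X 0)"

lemma poisson: "poisson_process (sample X) (intensity X) (arrivals X)"
  using model by (simp add: compound_poisson_model_def)

lemma claims_indep: "prob_space.indep_vars (sample X) (\<lambda>_. borel) (claim X) UNIV"
  using model by (simp add: compound_poisson_model_def)

lemma distr_claim: "distr (sample X) borel (claim X i) = \<nu>"
  using model by (simp add: compound_poisson_model_def \<nu>_def)

sublocale prob_space "sample X"
  using model by (simp add: compound_poisson_model_def)

lemma claim_measurable: "claim X i \<in> borel_measurable (sample X)"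
  using claims_indep by (simp add: indep_vars_def)

sublocale risk_model X \<nu>
proof (intro risk_model.intro risk_model_axioms.intro)
  show "prob_space (sample X)" by (rule prob_space_axioms)
  show "0 < premium X" "0 < intensity X" using model by (auto simp: compound_poisson_model_def)
  show "claim X i \<in> borel_measurable (sample X)" for i by (rule claim_measurable)
  show "arrivals X t \<in> measurable (sample X) (count_space UNIV)" if "0 \<le> t" for t
    using poisson that by (simp add: poisson_process_def)
  show "arrivals X 0 \<omega> = 0" if "\<omega> \<in> space (sample X)" for \<omega>
    using poisson that by (simp add: poisson_process_def)
  show "arrivals X s \<omega> \<le> arrivals X t \<omega>" if "\<omega> \<in> space (sample X)" "0 \<le> s" "s \<le> t" for \<omega> s t
    using poisson that by (auto simp: poisson_process_def mono_on_def)
  show "((\<lambda>s. arrivals X s \<omega>) \<longlongrightarrow> arrivals X t \<omega>) (at_right t)" if "\<omega> \<in> space (sample X)" "0 \<le> t" for \<omega> t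
    using poisson that by (auto simp: poisson_process_def)
  show pos: "AE \<omega> in sample X. 0 < claim X i \<omega>" for i
    using model by (simp add: compound_poisson_model_def)
  show "prob_space \<nu>" unfolding \<nu>_def by (rule prob_space_distr) (rule claim_measurable)
  show "sets \<nu> = sets borel" by (simp add: \<nu>_def)
  show "AE z in \<nu>. 0 < z"
    unfolding \<nu>_def using pos[of 0] claim_measurable by (subst AE_distr_iff) auto
qed

lemma distr_claims: "distr (sample X) (PiM UNIV (\<lambda>_. borel)) (\<lambda>\<omega> i. claim X i \<omega>) = PiM UNIV (\<lambda>_. \<nu>)"
proof -
  have "distr (sample X) (PiM UNIV (\<lambda>_. borel)) (\<lambda>\<omega>. \<lambda>i\<in>UNIV. claim X i \<omega>) =
      PiM UNIV (\<lambda>i. distr (sample X) borel (claim X i))"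
    using indep_vars_iff_distr_eq_PiM'[where I = UNIV and M' = "\<lambda>_. borel" and X = "claim X"] claims_indep by simp
  then show ?thesis unfolding restrict_UNIV distr_claim .
qed

text \<open>Independence as it is contained in the definition of the model: the arrival path is observed at
integer times.\<close>

lemma paths_indep: "indep_var
       (PiM UNIV (\<lambda>_. count_space UNIV)) (\<lambda>\<omega> n. real (arrivals X (real n) \<omega>))
       (PiM UNIV (\<lambda>_. borel)) (\<lambda>\<omega> i. claim X i \<omega>)"
proof -
  have "{0..} = (UNIV :: nat set)" by auto
  then show ?thesis using model by (simp add: compound_poisson_model_def)
qed

lemma distr_increments:
  assumes h: "0 < h"
  shows "distr (sample X) (PiM UNIV (\<lambda>_. count_space UNIV)) (increments h) =
    PiM UNIV (\<lambda>_. measure_pmf (poisson_pmf (intensity X * h)))"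
proof -
  have "mono (\<lambda>i. h * real i)" using h by (auto simp: monotone_def)
  then have fin: "indep_vars (\<lambda>_. count_space UNIV)
          (\<lambda>i \<omega>. arrivals X (h * real (Suc i)) \<omega> - arrivals X (h * real i) \<omega>) {..<n}" for n
    using poisson unfolding poisson_process_def
    by (elim conjE allE[of _ "\<lambda>i. h * real i"] allE[of _ n]) auto
  have rv: "(\<lambda>\<omega>. increments h \<omega> i) \<in> measurable (sample X) (count_space UNIV)" for i
    using fin[of "Suc i"] unfolding indep_vars_def2 increments_def by auto
  have ind: "indep_vars (\<lambda>_. count_space UNIV) (\<lambda>i \<omega>. increments h \<omega> i) UNIV"
    unfolding indep_vars_def2
  proof (intro conjI ballI rv, subst indep_sets_finite_index_sets, intro allI impI)
    fix J :: "nat set" assume J: "finite J"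
    have sub: "J \<subseteq> {..<Suc (Max J)}" using J by (auto simp: less_Suc_eq_le)
    show "indep_sets (\<lambda>i. {(\<lambda>\<omega>. increments h \<omega> i) -` A \<inter> space (sample X) |A. A \<in> sets (count_space UNIV)}) J"
      using fin[of "Suc (Max J)"] unfolding indep_vars_def2 increments_def
      by (intro indep_sets_mono_index[OF sub]) auto
  qed
  have d: "distr (sample X) (count_space UNIV) (\<lambda>\<omega>. increments h \<omega> i) = measure_pmf (poisson_pmf (intensity X * h))" for i
  proof -
    have "distr (sample X) (count_space UNIV) (\<lambda>\<omega>. arrivals X (h * Suc i) \<omega> - arrivals X (h * i) \<omega>) =
      measure_pmf (poisson_pmf (intensity X * (h * Suc i - h * i)))"
      using poisson h unfolding poisson_process_def by (auto simp: mult_left_mono)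
    then show ?thesis by (simp add: increments_def[abs_def] algebra_simps)
  qed
  have "distr (sample X) (PiM UNIV (\<lambda>_. count_space UNIV)) (\<lambda>\<omega>. \<lambda>i\<in>UNIV. increments h \<omega> i) =
      PiM UNIV (\<lambda>i. distr (sample X) (count_space UNIV) (\<lambda>\<omega>. increments h \<omega> i))"
    using indep_vars_iff_distr_eq_PiM'[where I = UNIV and M' = "\<lambda>_. count_space UNIV" and X = "\<lambda>i \<omega>. increments h \<omega> i"] ind rv by simp
  then show ?thesis unfolding restrict_UNIV d .
qed

lemma measurable_increments:
  "0 < h \<Longrightarrow> increments h \<in> measurable (sample X) (PiM UNIV (\<lambda>_. count_space UNIV))"
proof (rule measurable_PiM_single')
  fix l assume h: "0 < h"
  show "(\<lambda>\<omega>. increments h \<omega> l) \<in> measurable (sample X) (count_space UNIV)"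
    unfolding increments_def
    by (rule measurable_compose_countable[where f = "\<lambda>m \<omega>. m - arrivals X (h * real l) \<omega>" and g = "arrivals X (h * real (Suc l))"])
       (use h in \<open>auto intro!: measurable_arrivals measurable_compose[OF measurable_arrivals measurable_count_space]\<close>)
qed auto

text \<open>The increments over unit cells are functions of the arrivals at integer times.\<close>

lemma joint_law_1: "joint_law 1"
proof -
  let ?F = "\<lambda>(x :: nat \<Rightarrow> real) l. nat \<lfloor>x (Suc l)\<rfloor> - nat \<lfloor>x l\<rfloor>"
  have F: "?F \<in> measurable (PiM UNIV (\<lambda>_. count_space UNIV)) (PiM UNIV (\<lambda>_. count_space UNIV))"
  proof (rule measurable_PiM_single')
    fix l
    have c: "(\<lambda>x. x l) \<in> measurable (PiM UNIV (\<lambda>_. count_space (UNIV::real set))) (count_space UNIV)" for l :: nat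
      by (intro measurable_component_singleton) auto
    show "(\<lambda>x. ?F x l) \<in> measurable (PiM UNIV (\<lambda>_. count_space UNIV)) (count_space UNIV)"
      by (rule measurable_compose_countable[where f = "\<lambda>m x. m - nat \<lfloor>x l\<rfloor>" and g = "\<lambda>x. nat \<lfloor>x (Suc l)\<rfloor>"])
         (rule measurable_compose[OF c measurable_count_space])+
  qed auto
  let ?C = "PiM UNIV (\<lambda>_. count_space UNIV) :: (nat \<Rightarrow> real) measure"
  let ?N = "PiM UNIV (\<lambda>_. count_space UNIV) :: (nat \<Rightarrow> nat) measure"
  let ?B = "PiM UNIV (\<lambda>_. borel) :: (nat \<Rightarrow> real) measure"
  let ?path = "\<lambda>\<omega> n. real (arrivals X (real n) \<omega>)" and ?claims = "\<lambda>\<omega> i. claim X i \<omega>"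
  have path: "?path \<in> measurable (sample X) ?C" and claims: "?claims \<in> measurable (sample X) ?B"
    using paths_indep by (blast dest: indep_var_rv1 indep_var_rv2)+
  have inc: "increments 1 = (\<lambda>\<omega>. ?F (?path \<omega>))"
    by (auto simp: increments_def fun_eq_iff)
  have m: "(\<lambda>\<omega>. (increments 1 \<omega>, ?claims \<omega>)) \<in> measurable (sample X) (?N \<Otimes>\<^sub>M ?B)"
    using measurable_increments[of 1] claims by simp
  have "distr (sample X) (?N \<Otimes>\<^sub>M ?B) (\<lambda>\<omega>. (increments 1 \<omega>, ?claims \<omega>)) =
      distr (distr (sample X) (?C \<Otimes>\<^sub>M ?B) (\<lambda>\<omega>. (?path \<omega>, ?claims \<omega>))) (?N \<Otimes>\<^sub>M ?B) (\<lambda>(x, z). (?F x, z))"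
    using F path claims by (subst distr_distr) (auto simp: comp_def inc)
  also have "distr (sample X) (?C \<Otimes>\<^sub>M ?B) (\<lambda>\<omega>. (?path \<omega>, ?claims \<omega>)) = distr (sample X) ?C ?path \<Otimes>\<^sub>M PiM UNIV (\<lambda>_. \<nu>)"
    using paths_indep unfolding indep_var_distribution_eq distr_claims by simp
  also have "distr \<dots> (?N \<Otimes>\<^sub>M ?B) (\<lambda>(x, z). (?F x, z)) =
      distr (distr (sample X) ?C ?path) ?N ?F \<Otimes>\<^sub>M distr (PiM UNIV (\<lambda>_. \<nu>)) ?B (\<lambda>z. z)"
  proof (rule pair_measure_distr[symmetric])
    have sB: "sets (PiM UNIV (\<lambda>_. \<nu>) :: (nat \<Rightarrow> real) measure) = sets ?B" by (intro sets_PiM_cong) (auto simp: sets_\<nu>)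
    show "?F \<in> measurable (distr (sample X) ?C ?path) ?N" using F by simp
    show m': "(\<lambda>z. z) \<in> measurable (PiM UNIV (\<lambda>_. \<nu>)) ?B" by (rule measurable_ident_sets[OF sB])
    have "prob_space (PiM UNIV (\<lambda>_. \<nu>) :: (nat \<Rightarrow> real) measure)" by (intro prob_space_PiM prob_space_\<nu>)
    then have "prob_space (distr (PiM UNIV (\<lambda>_. \<nu>)) ?B (\<lambda>z. z))" using m' by (rule prob_space.prob_space_distr)
    then show "sigma_finite_measure (distr (PiM UNIV (\<lambda>_. \<nu>)) ?B (\<lambda>z. z))" by (rule prob_space_imp_sigma_finite)
  qed
  also have "distr (distr (sample X) ?C ?path) ?N ?F = distr (sample X) ?N (increments 1)"
    using F path by (subst distr_distr) (auto simp: comp_def inc)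
  also have "\<dots> = PiM UNIV (\<lambda>_. measure_pmf (poisson_pmf (intensity X * 1)))"
    by (rule distr_increments) simp
  also have "distr (PiM UNIV (\<lambda>_. \<nu>)) ?B (\<lambda>z. z) = PiM UNIV (\<lambda>_. \<nu>)"
    by (rule distr_id2) (intro sets_PiM_cong, auto simp: sets_\<nu>)
  finally show ?thesis using m unfolding joint_law_def by blast
qed

text \<open>The claims are drawn anew on an extended sample space. The arrival process is kept, and it is independent
of the new claims at all times.\<close>

definition indep_copy :: "('a \<times> (nat \<Rightarrow> real)) reserve_model" where
  "indep_copy = \<lparr>sample = sample X \<Otimes>\<^sub>M PiM UNIV (\<lambda>_. \<nu>), premium = premium X, intensity = intensity X,
     arrivals = (\<lambda>t \<omega>. arrivals X t (fst \<omega>)), claim = (\<lambda>i \<omega>. snd \<omega> i)\<rparr>"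

sublocale copy: independent_risk_model indep_copy \<nu>
proof -
  interpret Z: prob_space "PiM UNIV (\<lambda>_. \<nu>) :: (nat \<Rightarrow> real) measure"
    by (intro prob_space_PiM prob_space_\<nu>)
  interpret P: pair_prob_space "sample X" "PiM UNIV (\<lambda>_. \<nu>) :: (nat \<Rightarrow> real) measure" ..
  have sample: "sample indep_copy = sample X \<Otimes>\<^sub>M PiM UNIV (\<lambda>_. \<nu>)" by (simp add: indep_copy_def)
  interpret C: risk_model indep_copy \<nu>
  proof (intro risk_model.intro risk_model_axioms.intro)
    show "prob_space (sample indep_copy)"
      unfolding sample by (rule P.prob_space_axioms)
    show "0 < premium indep_copy" "0 < intensity indep_copy"
      using premium_pos intensity_pos by (auto simp: indep_copy_def)
    have comp: "(\<lambda>z. z i) \<in> measurable (PiM UNIV (\<lambda>_. \<nu>)) \<nu>" for i :: nat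
      by (intro measurable_component_singleton) auto
    show claim: "claim indep_copy i \<in> borel_measurable (sample indep_copy)" for i
      using measurable_compose[OF measurable_snd comp] unfolding sample
      by (simp add: indep_copy_def measurable_cong_sets[OF refl sets_\<nu>])
    show "arrivals indep_copy t \<in> measurable (sample indep_copy) (count_space UNIV)" if "0 \<le> t" for t
      using measurable_compose[OF measurable_fst measurable_arrivals[OF that]] unfolding sample
      by (simp add: indep_copy_def)
    show "arrivals indep_copy 0 \<omega> = 0" if "\<omega> \<in> space (sample indep_copy)" for \<omega>
      using that arrivals_0 by (auto simp: indep_copy_def space_pair_measure)
    show "arrivals indep_copy s \<omega> \<le> arrivals indep_copy t \<omega>" if "\<omega> \<in> space (sample indep_copy)" "0 \<le> s" "s \<le> t" for \<omega> s t
      using that arrivals_mono by (auto simp: indep_copy_def space_pair_measure)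
    show "((\<lambda>s. arrivals indep_copy s \<omega>) \<longlongrightarrow> arrivals indep_copy t \<omega>) (at_right t)" if "\<omega> \<in> space (sample indep_copy)" "0 \<le> t" for \<omega> t
      using that arrivals_right_cont by (auto simp: indep_copy_def space_pair_measure)
    show "prob_space \<nu>" "sets \<nu> = sets borel" "AE z in \<nu>. 0 < z"
      by (rule prob_space_\<nu> sets_\<nu> AE_\<nu>_pos)+
    show "AE \<omega> in sample indep_copy. 0 < claim indep_copy i \<omega>" for i
    proof -
      have 1: "AE z in PiM UNIV (\<lambda>_. \<nu>). 0 < z i"
        by (rule AE_PiM_component) (auto intro: prob_space_\<nu> AE_\<nu>_pos)
      have s: "{\<omega> \<in> space (sample indep_copy). 0 < claim indep_copy i \<omega>} \<in> sets (sample indep_copy)"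
        using claim by measurable
      have "AE x in sample X. AE z in PiM UNIV (\<lambda>_. \<nu>). 0 < claim indep_copy i (x, z)"
        using 1 by (auto simp: indep_copy_def)
      then show ?thesis using s unfolding sample by (intro P.AE_pair_measure)
    qed
  qed
  have inc: "C.increments h \<omega> = increments h (fst \<omega>)" for h \<omega>
    by (rule ext) (unfold C.increments_def increments_def, simp add: indep_copy_def)
  show "independent_risk_model indep_copy \<nu>"
  proof
    fix h :: real assume h: "0 < h"
    let ?N = "PiM UNIV (\<lambda>_. count_space UNIV) :: (nat \<Rightarrow> nat) measure"
    let ?B = "PiM UNIV (\<lambda>_. borel) :: (nat \<Rightarrow> real) measure"
    have sB: "sets (PiM UNIV (\<lambda>_. \<nu>) :: (nat \<Rightarrow> real) measure) = sets ?B" by (intro sets_PiM_cong) (auto simp: sets_\<nu>)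
    have m': "(\<lambda>z. z) \<in> measurable (PiM UNIV (\<lambda>_. \<nu>)) ?B" by (rule measurable_ident_sets[OF sB])
    have V: "(\<lambda>\<omega>. (C.increments h \<omega>, \<lambda>i. claim indep_copy i \<omega>)) = (\<lambda>(x, z). (increments h x, z))"
      by (rule ext) (simp add: inc case_prod_beta', simp add: indep_copy_def)
    have "(\<lambda>(x, z). (increments h x, z)) \<in> measurable (sample indep_copy) (?N \<Otimes>\<^sub>M ?B)"
      unfolding sample case_prod_beta'
      by (intro measurable_Pair measurable_compose[OF measurable_fst measurable_increments[OF h]] measurable_compose[OF measurable_snd m'])
    moreover have "distr (sample indep_copy) (?N \<Otimes>\<^sub>M ?B) (\<lambda>(x, z). (increments h x, z)) =
       distr (sample X) ?N (increments h) \<Otimes>\<^sub>M distr (PiM UNIV (\<lambda>_. \<nu>)) ?B (\<lambda>z. z)"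
      unfolding sample
    proof (rule pair_measure_distr[symmetric])
      show "sigma_finite_measure (distr (PiM UNIV (\<lambda>_. \<nu>)) ?B (\<lambda>z. z))"
        by (intro prob_space_imp_sigma_finite Z.prob_space_distr m')
    qed (rule measurable_increments[OF h] m')+
    moreover have "distr (PiM UNIV (\<lambda>_. \<nu>)) ?B (\<lambda>z. z) = PiM UNIV (\<lambda>_. \<nu>)"
      by (rule distr_id2) (rule sB[symmetric])
    ultimately show "C.joint_law h"
      unfolding C.joint_law_def V distr_increments[OF h] by (simp add: indep_copy_def)
  qed
qed

lemma skeleton_copy: "copy.prob (copy.ruin_on_grid 1 u) = prob (ruin_on_grid 1 u)"
  using copy.prob_ruin_on_grid[of 1 u] prob_ruin_on_grid[of 1 u] joint_law_1 copy.joint_law[of 1]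
  by (simp add: indep_copy_def)

text \<open>Both models have the same integer skeleton, from which either ruin probability is recovered up to a shift
by the premium of one unit of time.\<close>

lemma ruin_prob_copy_le: "ruin_prob indep_copy (u + premium X) \<le> ruin_prob X u"
proof -
  have "ruin_prob indep_copy (u + premium X) \<le> copy.prob (copy.ruin_on_grid 1 u)"
    using copy.ruin_prob_le_skeleton[of "u + premium X"] by (simp add: indep_copy_def)
  then show ?thesis using skeleton_copy skeleton_le_ruin_prob[of u] by simp
qed

end

section \<open>Uniform bounds for the tilted ruin probability\<close>

lemma nn_integral_less_Icc:
  fixes f :: "real \<Rightarrow> ennreal"
  assumes [measurable]: "f \<in> borel_measurable borel"
  shows "(\<integral>\<^sup>+x. f x * indicator {a..<b} x \<partial>lborel) = (\<integral>\<^sup>+x. f x * indicator {a..b} x \<partial>lborel)"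
  by (rule nn_integral_cong_AE, use AE_lborel_singleton[of b] in eventually_elim) (auto simp: indicator_def)

context compound_poisson
begin

definition tail :: "real \<Rightarrow> real" where "tail x = measure \<nu> {x<..}"

sublocale nu: prob_space \<nu> by (rule prob_space_\<nu>)

lemma space_\<nu>: "space \<nu> = UNIV"
  using sets_eq_imp_space_eq[OF sets_\<nu>] by simp

lemma tail_eq_cdf: "tail x = 1 - claim_cdf X x"
proof -
  have "{..x} = space \<nu> - {x<..}" by (auto simp: space_\<nu>)
  then have "measure \<nu> {..x} = 1 - tail x"
    unfolding tail_def using nu.prob_compl[of "{x<..}"] by (simp add: sets_\<nu>)
  then show ?thesis by (simp add: claim_cdf_def cdf_def \<nu>_def)
qed

lemma tail_pos: "0 < tail x"
  using model by (simp add: tail_eq_cdf compound_poisson_model_def)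

lemma tail_antimono: "x \<le> y \<Longrightarrow> tail y \<le> tail x"
  unfolding tail_def by (intro nu.finite_measure_mono) (auto simp: sets_\<nu>)

lemma measurable_tail [measurable]: "tail \<in> borel_measurable borel"
  by (rule measurable_antimono) (simp add: monotone_def tail_antimono)

text \<open>Writing the tail as \<open>E (indicator {x<..} Z)\<close> and exchanging integrals.\<close>

lemma nn_integral_tail:
  assumes [measurable]: "w \<in> borel_measurable borel"
  shows "(\<integral>\<^sup>+x. w x * ennreal (tail x) * indicator {0..} x \<partial>lborel) =
    (\<integral>\<^sup>+z. (\<integral>\<^sup>+x. w x * indicator {0..z} x \<partial>lborel) \<partial>\<nu>)"
proof -
  note [measurable_cong] = sets_\<nu>
  interpret P: pair_sigma_finite lborel \<nu> ..
  have "(\<integral>\<^sup>+x. w x * ennreal (tail x) * indicator {0..} x \<partial>lborel) =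
     (\<integral>\<^sup>+x. (\<integral>\<^sup>+z. w x * (if 0 \<le> x \<and> x < z then 1 else 0) \<partial>\<nu>) \<partial>lborel)"
  proof (rule nn_integral_cong)
    fix x
    have "w x * ennreal (tail x) * indicator {0..} x = (\<integral>\<^sup>+z. w x * indicator {0..} x * indicator {x<..} z \<partial>\<nu>)"
      by (subst nn_integral_cmult_indicator) (auto simp: sets_\<nu> tail_def nu.emeasure_eq_measure mult_ac)
    also have "\<dots> = (\<integral>\<^sup>+z. w x * (if 0 \<le> x \<and> x < z then 1 else 0) \<partial>\<nu>)"
      by (intro nn_integral_cong) (auto simp: indicator_def)
    finally show "w x * ennreal (tail x) * indicator {0..} x = \<dots>" .
  qed
  also have "\<dots> = (\<integral>\<^sup>+z. (\<integral>\<^sup>+x. w x * (if 0 \<le> x \<and> x < z then 1 else 0) \<partial>lborel) \<partial>\<nu>)"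
    by (rule P.Fubini'[symmetric]) measurable
  also have "\<dots> = (\<integral>\<^sup>+z. (\<integral>\<^sup>+x. w x * indicator {0..<z} x \<partial>lborel) \<partial>\<nu>)"
    by (intro nn_integral_cong) (auto simp: indicator_def)
  finally show ?thesis by (simp add: nn_integral_less_Icc)
qed

text \<open>Integrals against the tail of \<open>\<nu>\<close> are expectations of primitives; this turns the integrals in the
assumptions into moments and exponential moments of the claims.\<close>

lemma nn_integral_tail_FTC:
  assumes [measurable]: "w \<in> borel_measurable borel" and w: "\<And>x. 0 \<le> x \<Longrightarrow> 0 \<le> w x"
    and W: "\<And>x. (W has_real_derivative w x) (at x)" "W 0 = 0"
  shows "(\<integral>\<^sup>+x. ennreal (w x * tail x) * indicator {0..} x \<partial>lborel) = (\<integral>\<^sup>+z. ennreal (W z) \<partial>\<nu>)"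
proof -
  have "(\<integral>\<^sup>+x. ennreal (w x * tail x) * indicator {0..} x \<partial>lborel) =
      (\<integral>\<^sup>+x. ennreal (w x) * ennreal (tail x) * indicator {0..} x \<partial>lborel)"
    using w by (intro nn_integral_cong) (auto simp: indicator_def ennreal_mult'' tail_def)
  also have "\<dots> = (\<integral>\<^sup>+z. (\<integral>\<^sup>+x. ennreal (w x) * indicator {0..z} x \<partial>lborel) \<partial>\<nu>)"
    by (rule nn_integral_tail) measurable
  also have "\<dots> = (\<integral>\<^sup>+z. ennreal (W z) \<partial>\<nu>)"
  proof (rule nn_integral_cong_AE, use AE_\<nu>_pos in eventually_elim)
    fix z :: real assume "0 < z"
    then have "(\<integral>\<^sup>+x. ennreal (w x) * indicator {0..z} x \<partial>lborel) = ennreal (W z - W 0)"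
      using w by (intro nn_integral_FTC_Icc) (auto intro: has_field_derivative_at_within W)
    then show "(\<integral>\<^sup>+x. ennreal (w x) * indicator {0..z} x \<partial>lborel) = ennreal (W z)" by (simp add: W)
  qed
  finally show ?thesis .
qed

lemma claim_moment_eq: "claim_moment X j = (\<integral>z. z ^ j \<partial>\<nu>)"
  unfolding claim_moment_def \<nu>_def by (subst integral_distr) (auto intro: claim_measurable)

lemma tail_moment_nn: "(\<integral>\<^sup>+x. ennreal (x ^ j * tail x) * indicator {0..} x \<partial>lborel) = (\<integral>\<^sup>+z. ennreal (z ^ Suc j / real (Suc j)) \<partial>\<nu>)"
proof (rule nn_integral_tail_FTC)
  fix x
  have "((\<lambda>z. z ^ Suc j / real (Suc j)) has_real_derivative (real (Suc j) * x ^ j) / real (Suc j)) (at x)"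
    using DERIV_cdivide[OF DERIV_pow[of "Suc j" x], of "real (Suc j)"] by simp
  then show "((\<lambda>z. z ^ Suc j / real (Suc j)) has_real_derivative x ^ j) (at x)" by simp
qed auto

end

text \<open>The constants \<open>B\<close> and \<open>H\<close> are upper bounds for the quantities in (A2) and (A3), so that one pair of constants
serves a whole family of models.\<close>

locale adjusted_model = compound_poisson X for X :: "'a reserve_model" +
  fixes k :: nat and R H B :: real
  assumes k: "2 \<le> k" and R: "is_adjustment_coeff X R"
    and B: "(\<integral>\<^sup>+x\<in>{0..}. ennreal (x ^ k * exp (R * x) * (f_I X x / (1 + safety_loading X))) \<partial>lborel) \<le> ennreal B"
    and B_nonneg: "0 \<le> B"
    and H: "h_I X \<le> ennreal H" and H_nonneg: "0 \<le> H"
begin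

abbreviation "c \<equiv> premium X"
abbreviation "lam \<equiv> intensity X"
abbreviation "m1 \<equiv> claim_moment X 1"

text \<open>The loaded density \<open>f_I / (1 + \<theta>)\<close> equals \<open>q\<close> times the tail of the claims.\<close>

definition q :: real where "q = lam / c"

lemma q_pos: "0 < q" using intensity_pos premium_pos by (simp add: q_def)

lemma R_pos: "0 < R" using R by (simp add: is_adjustment_coeff_def)

text \<open>A claim law without a finite mean would have \<open>claim_moment X 1 = 0\<close>, the default value of the integral, and
then \<open>f_I = 0\<close>, which contradicts the existence of an adjustment coefficient.\<close>

lemma m1_pos: "0 < m1"
proof -
  have "m1 \<noteq> 0"
  proof
    assume "m1 = 0"
    then have "f_I X x = 0" for x by (simp add: f_I_def)
    then show False using R by (simp add: is_adjustment_coeff_def)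
  qed
  moreover have "0 \<le> m1"
    unfolding claim_moment_eq using AE_\<nu>_pos by (intro integral_nonneg_AE) (auto elim: eventually_mono)
  ultimately show ?thesis by simp
qed

lemma f_I_eq: "f_I X x = tail x / m1"
  by (simp add: f_I_def tail_eq_cdf)

lemma f_I_loaded: "f_I X x / (1 + safety_loading X) = q * tail x"
  using m1_pos intensity_pos premium_pos by (simp add: q_def f_I_eq safety_loading_def field_simps)

lemma adjust_nn: "(\<integral>\<^sup>+x. ennreal (q * (exp (R * x) * tail x)) * indicator {0..} x \<partial>lborel) = 1"
  using R unfolding is_adjustment_coeff_def f_I_loaded by (simp add: mult_ac)

lemma B_nn: "(\<integral>\<^sup>+x. ennreal (q * (x ^ k * exp (R * x) * tail x)) * indicator {0..} x \<partial>lborel) \<le> ennreal B"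
  using B unfolding f_I_loaded by (simp add: mult_ac)

lemma power_le_1_plus: "0 \<le> x \<Longrightarrow> j \<le> k \<Longrightarrow> x ^ j \<le> 1 + x ^ k" for x :: real
proof (cases "x \<le> 1")
  case True
  assume "0 \<le> x" then show ?thesis using True power_le_one[of x j] zero_le_power[of x k] by linarith
next
  case False
  assume "j \<le> k" then have "x ^ j \<le> x ^ k" using False by (intro power_increasing) auto
  then show ?thesis by simp
qed

lemma exp_moment_nn:
  assumes "j \<le> k"
  shows "(\<integral>\<^sup>+x. ennreal (q * (x ^ j * exp (R * x) * tail x)) * indicator {0..} x \<partial>lborel) \<le> ennreal (1 + B)"
proof -
  note q = q_pos
  have "(\<integral>\<^sup>+x. ennreal (q * (x ^ j * exp (R * x) * tail x)) * indicator {0..} x \<partial>lborel) \<le>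
     (\<integral>\<^sup>+x. ennreal (q * (exp (R * x) * tail x)) * indicator {0..} x +
        ennreal (q * (x ^ k * exp (R * x) * tail x)) * indicator {0..} x \<partial>lborel)"
  proof (rule nn_integral_mono)
    fix x :: real
    show "ennreal (q * (x ^ j * exp (R * x) * tail x)) * indicator {0..} x \<le>
       ennreal (q * (exp (R * x) * tail x)) * indicator {0..} x +
        ennreal (q * (x ^ k * exp (R * x) * tail x)) * indicator {0..} x"
    proof (cases "0 \<le> x")
      case True
      have "q * (x ^ j * exp (R * x) * tail x) = x ^ j * (q * (exp (R * x) * tail x))"
        by simp
      also have "\<dots> \<le> (1 + x ^ k) * (q * (exp (R * x) * tail x))"
        using q tail_pos[of x] power_le_1_plus[OF True assms] by (intro mult_right_mono) auto
      also have "\<dots> = q * (exp (R * x) * tail x) + q * (x ^ k * exp (R * x) * tail x)"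
        by (simp add: algebra_simps)
      finally have "ennreal (q * (x ^ j * exp (R * x) * tail x)) \<le>
          ennreal (q * (exp (R * x) * tail x) + q * (x ^ k * exp (R * x) * tail x))"
        by (rule ennreal_leI)
      also have "\<dots> = ennreal (q * (exp (R * x) * tail x)) + ennreal (q * (x ^ k * exp (R * x) * tail x))"
        using q tail_pos[of x] True by (intro ennreal_plus) (auto intro!: mult_nonneg_nonneg less_imp_le)
      finally show ?thesis using True by simp
    qed simp
  qed
  also have "\<dots> \<le> 1 + ennreal B"
    by (subst nn_integral_add) (auto simp: adjust_nn intro: add_mono B_nn)
  also have "\<dots> = ennreal (1 + B)" using B_nonneg by simp
  finally show ?thesis .
qed

lemma moment_integrable:
  assumes "j \<le> Suc k"
  shows "integrable \<nu> (\<lambda>z. z ^ j)"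
proof (cases j)
  case (Suc i)
  note [measurable_cong] = sets_\<nu>
  note q = q_pos
  have "ennreal q * (\<integral>\<^sup>+x. ennreal (x ^ i * tail x) * indicator {0..} x \<partial>lborel) =
    (\<integral>\<^sup>+x. ennreal q * (ennreal (x ^ i * tail x) * indicator {0..} x) \<partial>lborel)"
    by (rule nn_integral_cmult[symmetric]) measurable
  also have "\<dots> \<le> (\<integral>\<^sup>+x. ennreal (q * (x ^ i * exp (R * x) * tail x)) * indicator {0..} x \<partial>lborel)"
  proof (rule nn_integral_mono)
    fix x :: real
    show "ennreal q * (ennreal (x ^ i * tail x) * indicator {0..} x) \<le>
        ennreal (q * (x ^ i * exp (R * x) * tail x)) * indicator {0..} x"
    proof (cases "0 \<le> x")
      case True
      have "(x ^ i * tail x) * 1 \<le> (x ^ i * tail x) * exp (R * x)"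
        using True R_pos tail_pos[of x] by (intro mult_left_mono) auto
      then show ?thesis using True q tail_pos[of x]
        by (simp add: ennreal_mult[symmetric] mult_ac ennreal_leI mult_left_mono)
    qed simp
  qed
  also have "\<dots> \<le> ennreal (1 + B)" using assms Suc by (intro exp_moment_nn) simp
  finally have "ennreal q * (\<integral>\<^sup>+x. ennreal (x ^ i * tail x) * indicator {0..} x \<partial>lborel) < \<infinity>"
    by (simp add: le_less_trans)
  then have fin: "(\<integral>\<^sup>+z. ennreal (z ^ Suc i / real (Suc i)) \<partial>\<nu>) < \<infinity>"
    unfolding tail_moment_nn using q by (auto simp: ennreal_mult_less_top)
  have "integrable \<nu> (\<lambda>z. z ^ Suc i / real (Suc i))"
    using fin AE_\<nu>_pos by (intro integrableI_nonneg) (auto elim!: eventually_mono)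
  then have "integrable \<nu> (\<lambda>z. real (Suc i) * (z ^ Suc i / real (Suc i)))" by (rule integrable_mult_right)
  then show ?thesis unfolding Suc by simp
qed simp

lemma tail_moment:
  assumes "j \<le> k"
  shows "(\<integral>\<^sup>+x. ennreal (x ^ j * tail x) * indicator {0..} x \<partial>lborel) = ennreal (claim_moment X (Suc j) / real (Suc j))"
proof -
  have "(\<integral>\<^sup>+z. ennreal (z ^ Suc j / real (Suc j)) \<partial>\<nu>) = ennreal (\<integral>z. z ^ Suc j / real (Suc j) \<partial>\<nu>)"
    using moment_integrable[of "Suc j"] assms AE_\<nu>_pos
    by (intro nn_integral_eq_integral) (auto elim!: eventually_mono simp del: power_Suc)
  also have "(\<integral>z. z ^ Suc j / real (Suc j) \<partial>\<nu>) = claim_moment X (Suc j) / real (Suc j)"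
    unfolding claim_moment_eq by (simp del: power_Suc of_nat_Suc)
  finally show ?thesis unfolding tail_moment_nn .
qed

lemma mean_tail: "(\<integral>\<^sup>+x. ennreal (tail x) * indicator {0..} x \<partial>lborel) = ennreal m1"
  using tail_moment[of 0] by simp

lemma tail_integrable: "integrable lborel (\<lambda>x. tail x * indicator {0..} x)"
  and tail_integral: "(\<integral>x. tail x * indicator {0..} x \<partial>lborel) = m1"
proof -
  have *: "(\<integral>\<^sup>+x. ennreal (tail x * indicator {0..} x) \<partial>lborel) = ennreal m1"
    unfolding mean_tail[symmetric] by (intro nn_integral_cong) (auto simp: indicator_def)
  show "integrable lborel (\<lambda>x. tail x * indicator {0..} x)"
    using * tail_pos by (intro integrableI_nonneg) (auto simp: indicator_def less_imp_le)
  show "(\<integral>x. tail x * indicator {0..} x \<partial>lborel) = m1"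
    using * tail_pos m1_pos by (subst integral_eq_nn_integral) (auto simp: indicator_def less_imp_le)
qed

text \<open>The tail of \<open>F_I\<close>, up to the factor \<open>m1\<close>.\<close>

definition mean_excess :: "real \<Rightarrow> real" where
  "mean_excess u = (\<integral>x. tail x * indicator {u<..} x \<partial>lborel)"

lemma tail_integrable_sub: "S \<subseteq> {0..} \<Longrightarrow> S \<in> sets borel \<Longrightarrow> integrable lborel (\<lambda>x. tail x * indicator S x)"
  by (rule Bochner_Integration.integrable_bound[OF tail_integrable]) (auto simp: indicator_def)

lemma mean_excess_eq:
  assumes "0 \<le> u"
  shows "mean_excess u = m1 - (\<integral>x. tail x * indicator {0..u} x \<partial>lborel)"
proof -
  have "m1 = (\<integral>x. tail x * indicator {0..u} x + tail x * indicator {u<..} x \<partial>lborel)"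
    unfolding tail_integral[symmetric] using assms
    by (intro Bochner_Integration.integral_cong) (auto simp: indicator_def)
  also have "\<dots> = (\<integral>x. tail x * indicator {0..u} x \<partial>lborel) + mean_excess u"
    unfolding mean_excess_def using assms
    by (intro Bochner_Integration.integral_add tail_integrable_sub) auto
  finally show ?thesis by simp
qed

lemma mean_excess_pos:
  assumes "0 \<le> u" shows "0 < mean_excess u"
proof -
  have "(\<integral>x. tail (u + 1) * indicator {u<..u+1} x \<partial>lborel) \<le> mean_excess u"
    unfolding mean_excess_def
  proof (rule integral_mono)
    show "integrable lborel (\<lambda>x. tail (u + 1) * indicator {u<..u+1} x)"
      by (intro integrable_mult_right integrable_real_indicator) auto
    show "integrable lborel (\<lambda>x. tail x * indicator {u<..} x)"
      using assms by (intro tail_integrable_sub) auto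
    show "tail (u + 1) * indicator {u<..u+1} x \<le> tail x * indicator {u<..} x" for x
      using tail_antimono[of x "u + 1"] tail_pos[of x] by (auto simp: indicator_def less_imp_le)
  qed
  then show ?thesis using tail_pos[of "u + 1"] by simp
qed

lemma F_I_compl: "0 \<le> u \<Longrightarrow> 1 - F_I X u = mean_excess u / m1"
proof -
  assume u: "0 \<le> u"
  have "F_I X u = (\<integral>x. tail x * indicator {0..u} x / m1 \<partial>lborel)"
    unfolding F_I_def set_lebesgue_integral_def f_I_eq by (intro Bochner_Integration.integral_cong) auto
  then have "F_I X u = (\<integral>x. tail x * indicator {0..u} x \<partial>lborel) / m1" by simp
  then show ?thesis unfolding mean_excess_eq[OF u] using m1_pos by (simp add: diff_divide_distrib)
qed

lemma tail_hazard: "0 \<le> u \<Longrightarrow> tail u \<le> H * mean_excess u"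
proof -
  assume u: "0 \<le> u"
  have "ennreal (f_I X u / (1 - F_I X u)) \<le> h_I X"
    unfolding h_I_def using u by (intro SUP_upper) auto
  also note H
  finally have "f_I X u / (1 - F_I X u) \<le> H" using H_nonneg by simp
  then have "tail u / mean_excess u \<le> H"
    unfolding F_I_compl[OF u] f_I_eq using m1_pos by simp
  then show ?thesis using mean_excess_pos[OF u] by (simp add: pos_divide_le_eq)
qed

definition mgfR :: real where "mgfR = 1 + R * c / lam"

text \<open>The adjustment equation in its usual form \<open>lam * (E (exp (R * Z)) - 1) = R * c\<close>.\<close>

lemma mgfR: "(\<integral>\<^sup>+z. ennreal (exp (R * z)) \<partial>\<nu>) = ennreal mgfR"
proof -
  note [measurable_cong] = sets_\<nu>
  note q = q_pos
  have "(\<integral>\<^sup>+x. ennreal (q * (exp (R * x) * tail x)) * indicator {0..} x \<partial>lborel) =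
     (\<integral>\<^sup>+x. ennreal ((q * exp (R * x)) * tail x) * indicator {0..} x \<partial>lborel)"
    by (simp add: mult_ac)
  also have "\<dots> = (\<integral>\<^sup>+z. ennreal (q * ((exp (R * z) - 1) / R)) \<partial>\<nu>)"
  proof (rule nn_integral_tail_FTC)
    fix x
    show "((\<lambda>z. q * ((exp (R * z) - 1) / R)) has_real_derivative q * exp (R * x)) (at x)"
      using R_pos by (auto intro!: derivative_eq_intros)
  qed (use q in auto)
  finally have "(\<integral>\<^sup>+z. ennreal (q * ((exp (R * z) - 1) / R)) \<partial>\<nu>) = 1" using adjust_nn by simp
  then have "ennreal (R * c / lam) * (\<integral>\<^sup>+z. ennreal (q * ((exp (R * z) - 1) / R)) \<partial>\<nu>) = ennreal (R * c / lam)"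
    by simp
  then have 1: "(\<integral>\<^sup>+z. ennreal (R * c / lam) * ennreal (q * ((exp (R * z) - 1) / R)) \<partial>\<nu>) = ennreal (R * c / lam)"
    by (subst nn_integral_cmult) auto
  have 2: "ennreal (R * c / lam) * ennreal (q * ((exp (R * z) - 1) / R)) = ennreal (exp (R * z) - 1)" for z
  proof -
    have "R * c / lam * (q * ((exp (R * z) - 1) / R)) = exp (R * z) - 1"
      using R_pos intensity_pos premium_pos by (simp add: q_def)
    then show ?thesis using R_pos intensity_pos premium_pos
      by (subst ennreal_mult'[symmetric]) (auto intro!: divide_nonneg_nonneg)
  qed
  have "(\<integral>\<^sup>+z. ennreal (exp (R * z)) \<partial>\<nu>) = (\<integral>\<^sup>+z. 1 + ennreal (exp (R * z) - 1) \<partial>\<nu>)"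
  proof (rule nn_integral_cong_AE, use AE_\<nu>_pos in eventually_elim)
    fix z :: real assume "0 < z"
    then have "0 \<le> exp (R * z) - 1" using R_pos by simp
    then have "1 + ennreal (exp (R * z) - 1) = ennreal (1 + (exp (R * z) - 1))"
      by (subst ennreal_plus) auto
    then show "ennreal (exp (R * z)) = 1 + ennreal (exp (R * z) - 1)" by simp
  qed
  also have "\<dots> = 1 + ennreal (R * c / lam)"
    using 1 unfolding 2 by (subst nn_integral_add) (auto simp: nu.emeasure_space_1)
  also have "\<dots> = ennreal mgfR"
    unfolding mgfR_def using R_pos intensity_pos premium_pos by (subst ennreal_plus) auto
  finally show ?thesis .
qed

lemma mgfR_nonneg: "0 \<le> mgfR"
  unfolding mgfR_def using R_pos intensity_pos premium_pos by (intro add_nonneg_nonneg) auto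

lemma mgfR_eq: "lam * (mgfR - 1) = R * c"
  using intensity_pos by (simp add: mgfR_def)

text \<open>The exponentially tilted ladder height density.\<close>

definition g :: "real \<Rightarrow> real" where
  "g x = q * (exp (R * x) * tail x) * indicator {0..} x"

lemma measurable_g [measurable]: "g \<in> borel_measurable borel"
  unfolding g_def by measurable

lemma g_nonneg: "0 \<le> g x"
  unfolding g_def using q_pos tail_pos[of x] by (intro mult_nonneg_nonneg) (auto simp: less_imp_le)

lemma g_total: "(\<integral>\<^sup>+x. ennreal (g x) \<partial>lborel) = 1"
  unfolding adjust_nn[symmetric] g_def by (intro nn_integral_cong) (auto simp: indicator_def)

lemma g_integrable: "integrable lborel g"
  using g_total g_nonneg by (intro integrableI_nonneg) auto

lemma g_integrable_ind: "S \<in> sets borel \<Longrightarrow> integrable lborel (\<lambda>x. g x * indicator S x)"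
  by (rule Bochner_Integration.integrable_bound[OF g_integrable]) (auto simp: indicator_def)

text \<open>The tilt \<open>exp (R * x)\<close> is at least \<open>exp (R * u)\<close> on \<open>(u, \<infinity>)\<close>. Hence tilting does not increase the hazard
rate.\<close>

lemma g_tail_ge:
  assumes u: "0 \<le> u"
  shows "exp (R * u) * q * mean_excess u \<le> (\<integral>x. g x * indicator {u<..} x \<partial>lborel)"
proof -
  have i: "integrable lborel (\<lambda>x. tail x * indicator {u<..} x)"
    using u by (intro tail_integrable_sub) auto
  have "exp (R * u) * q * mean_excess u = (\<integral>x. exp (R * u) * q * (tail x * indicator {u<..} x) \<partial>lborel)"
    unfolding mean_excess_def by simp
  also have "\<dots> \<le> (\<integral>x. g x * indicator {u<..} x \<partial>lborel)"
  proof (rule integral_mono)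
    fix x
    show "exp (R * u) * q * (tail x * indicator {u<..} x) \<le> g x * indicator {u<..} x"
    proof (cases "u < x")
      case True
      have "exp (R * u) * (q * tail x) \<le> exp (R * x) * (q * tail x)"
        using True R_pos q_pos tail_pos[of x] by (intro mult_right_mono) auto
      then show ?thesis using True u by (simp add: g_def mult_ac)
    qed simp
  qed (use i g_integrable_ind[of "{u<..}"] in auto)
  finally show ?thesis .
qed

sublocale G: bounded_hazard_density g H "1 + B"
proof
  show "(\<integral>\<^sup>+x. ennreal (g x) \<partial>lborel) = 1" by (rule g_total)
  show "0 \<le> g x" for x by (rule g_nonneg)
  show "g x = 0" if "x < 0" for x using that by (simp add: g_def)
  show "0 < (\<integral>x. g x * indicator {u<..} x \<partial>lborel)" for u
  proof -
    define v where "v = max 0 u"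
    have v: "0 \<le> v" "u \<le> v" by (auto simp: v_def)
    have "0 < exp (R * v) * q * mean_excess v"
      using q_pos mean_excess_pos[OF v(1)] by (intro mult_pos_pos) auto
    also have "\<dots> \<le> (\<integral>x. g x * indicator {v<..} x \<partial>lborel)" by (rule g_tail_ge[OF v(1)])
    also have "\<dots> \<le> (\<integral>x. g x * indicator {u<..} x \<partial>lborel)"
      using v g_nonneg by (intro integral_mono g_integrable_ind) (auto simp: indicator_def)
    finally show ?thesis .
  qed
  show "g x \<le> H * (\<integral>y. g y * indicator {x<..} y \<partial>lborel)" if x: "0 \<le> x" for x
  proof -
    have "g x = exp (R * x) * q * tail x" using x by (simp add: g_def)
    also have "\<dots> \<le> exp (R * x) * q * (H * mean_excess x)"
      using tail_hazard[OF x] q_pos by (intro mult_left_mono) auto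
    also have "\<dots> = H * (exp (R * x) * q * mean_excess x)" by (simp add: mult_ac)
    also have "\<dots> \<le> H * (\<integral>y. g y * indicator {x<..} y \<partial>lborel)"
      using g_tail_ge[OF x] H_nonneg by (rule mult_left_mono)
    finally show ?thesis .
  qed
  show "0 \<le> H" by (rule H_nonneg)
  show "0 \<le> 1 + B" using B_nonneg by simp
  have eq: "(\<integral>\<^sup>+x. ennreal (x ^ j * g x) \<partial>lborel) =
    (\<integral>\<^sup>+x. ennreal (q * (x ^ j * exp (R * x) * tail x)) * indicator {0..} x \<partial>lborel)" for j
    by (intro nn_integral_cong) (auto simp: g_def indicator_def mult_ac)
  show "(\<integral>\<^sup>+x. ennreal (x * g x) \<partial>lborel) \<le> ennreal (1 + B)"
    using exp_moment_nn[of 1] k eq[of 1] by simp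
  show "(\<integral>\<^sup>+x. ennreal (x\<^sup>2 * g x) \<partial>lborel) \<le> ennreal (1 + B)"
    using exp_moment_nn[of 2] k eq[of 2] by simp
qed measurable

abbreviation "psi \<equiv> ruin_prob indep_copy"

lemma psi_lundberg: "psi u \<le> exp (- R * u)"
  by (rule copy.lundberg_inequality[OF mgfR mgfR_nonneg _ R_pos])
     (use mgfR_eq in \<open>simp add: indep_copy_def\<close>)

lemma psi_renewal:
  assumes u: "0 \<le> u"
  shows "c * psi u = lam * (mean_excess u + (\<integral>x. psi (u - x) * tail x * indicator {0..u} x \<partial>lborel))"
proof -
  have "c * psi u = lam * (m1 - (\<integral>x. measure \<nu> {x<..} * indicator {0..u} x \<partial>lborel) +
     (\<integral>x. psi (u - x) * measure \<nu> {x<..} * indicator {0..u} x \<partial>lborel))"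
  proof (rule renewal_equation_of_backward_equation[OF prob_space_\<nu> sets_\<nu> AE_\<nu>_pos])
    show "(\<integral>\<^sup>+x. ennreal (measure \<nu> {x<..}) * indicator {0..} x \<partial>lborel) = ennreal m1"
      using mean_tail unfolding tail_def .
    show "0 \<le> m1" using m1_pos by simp
    show "0 \<le> psi v" "psi v \<le> 1" for v by (rule copy.ruin_prob_01)+
    show "antimono psi" by (rule copy.ruin_prob_antimono)
    show "v < 0 \<Longrightarrow> psi v = 1" for v by (rule copy.ruin_prob_neg)
    show "(psi \<longlongrightarrow> 0) at_top"
    proof (rule tendsto_sandwich[OF always_eventually always_eventually])
      show "\<forall>u. 0 \<le> psi u" "\<forall>u. psi u \<le> exp (- R * u)" using copy.ruin_prob_01 psi_lundberg by auto
      have "filterlim (\<lambda>u. R * u) at_top at_top"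
        using R_pos by (intro filterlim_tendsto_pos_mult_at_top[OF tendsto_const _ filterlim_ident])
      then have "filterlim (\<lambda>u. - (R * u)) at_bot at_top" by (simp add: filterlim_uminus_at_bot)
      then have "((\<lambda>u. exp (- (R * u))) \<longlongrightarrow> 0) at_top" by (rule filterlim_compose[OF exp_at_bot])
      then show "((\<lambda>u. exp (- R * u)) \<longlongrightarrow> 0) at_top" by simp
    qed auto
    show "c * (psi u - psi 0) = lam * (\<integral>v. (psi v - (\<integral>z. psi (v - z) \<partial>\<nu>)) * indicator {0..u} v \<partial>lborel)" if "0 \<le> u" for u
      using copy.ruin_prob_backward[OF that] by (simp add: indep_copy_def)
  qed (rule u)
  then show ?thesis unfolding mean_excess_eq[OF u] tail_def .
qed

definition K :: "real \<Rightarrow> real" where "K u = exp (R * u) * psi u * indicator {0..} u"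

lemma measurable_psi [measurable]: "psi \<in> borel_measurable borel"
  by (rule measurable_antimono) (rule copy.ruin_prob_antimono)

lemma measurable_K [measurable]: "K \<in> borel_measurable borel"
  unfolding K_def by measurable

lemma K_01: "0 \<le> K u" "K u \<le> 1"
proof -
  show "0 \<le> K u" unfolding K_def using copy.ruin_prob_01 by (auto simp: indicator_def)
  have "exp (R * u) * psi u \<le> exp (R * u) * exp (- R * u)"
    using psi_lundberg by (intro mult_left_mono) auto
  also have "\<dots> = 1" by (simp add: exp_add[symmetric])
  finally show "K u \<le> 1" unfolding K_def by (auto simp: indicator_def)
qed

text \<open>Multiplication of the defective renewal equation by \<open>exp (R * u)\<close> tilts the kernel into the proper density
\<open>g\<close>.\<close>

lemma K_renewal:
  assumes u: "0 \<le> u"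
  shows "K u = exp (R * u) * q * mean_excess u + G.conv K u"
proof -
  have "G.conv K u = (\<integral>x. exp (R * u) * q * (psi (u - x) * tail x * indicator {0..u} x) \<partial>lborel)"
    unfolding G.conv_def K_def g_def
    by (intro Bochner_Integration.integral_cong) (auto simp: indicator_def exp_diff right_diff_distrib)
  then have *: "G.conv K u = exp (R * u) * q * (\<integral>x. psi (u - x) * tail x * indicator {0..u} x \<partial>lborel)"
    by simp
  have "psi u = q * (mean_excess u + (\<integral>x. psi (u - x) * tail x * indicator {0..u} x \<partial>lborel))"
    using psi_renewal[OF u] premium_pos by (simp add: field_simps q_def)
  then show ?thesis unfolding * K_def using u by (simp add: distrib_left mult_ac)
qed

text \<open>The function \<open>d - K\<close> satisfies the renewal equation with inhomogeneous term
\<open>d * (1 - cdf_g) - z\<close>, where \<open>z\<close> is the inhomogeneous term of \<open>K\<close>.\<close>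

lemma K_lower_bound:
  assumes a: "0 \<le> a" and d: "0 \<le> d" and u: "0 \<le> u"
    and majorant: "\<And>v. 0 \<le> v \<Longrightarrow>
      d * (\<integral>x. g x * indicator {v<..} x \<partial>lborel) - exp (R * v) * q * mean_excess v \<le> a * G.moment_tail v"
  shows "d - a * ((1 + B) * (1 + H)) \<le> K u"
proof -
  let ?w = "\<lambda>v. d * indicator {0..} v - K v"
  have "?w u \<le> a * ((1 + B) * (1 + H))"
  proof (rule G.renewal_majorant[where b = "d + 1" and w = ?w])
    show "?w \<in> borel_measurable borel" by measurable
    show "\<bar>?w v\<bar> \<le> d + 1" for v using K_01[of v] d by (auto simp: indicator_def)
    show "?w v = 0" if "v < 0" for v using that by (simp add: K_def)
    show "?w v \<le> a * G.moment_tail v + G.conv ?w v" if v: "0 \<le> v" for v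
    proof -
      have "G.conv ?w v = (\<integral>x. d * (g x * indicator {..v} x) - K (v - x) * g x \<partial>lborel)"
        unfolding G.conv_def by (intro Bochner_Integration.integral_cong) (auto simp: indicator_def algebra_simps)
      also have "\<dots> = d * G.cdf_g v - G.conv K v"
        unfolding G.conv_def G.cdf_g_def using K_01 g_integrable_ind[of "{..v}"] G.integrable_g_times[of "\<lambda>x. K (v - x)" 1]
        by (subst Bochner_Integration.integral_diff) auto
      finally have "G.conv ?w v = d * G.cdf_g v - G.conv K v" .
      moreover have "d * (1 - G.cdf_g v) - exp (R * v) * q * mean_excess v \<le> a * G.moment_tail v"
        using majorant[OF v] unfolding G.tail_eq .
      ultimately have "d - K v \<le> a * G.moment_tail v + G.conv ?w v"
        using K_renewal[OF v] unfolding right_diff_distrib by linarith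
      moreover have "?w v = d - K v" using v by (simp only: indicator_simps atLeast_iff mult_1_right)
      ultimately show ?thesis by (simp only:)
    qed
  qed (use a u in auto)
  then show ?thesis using u by simp
qed

text \<open>Here \<open>d = 1\<close>, and \<open>exp (R * x) - exp (R * v) \<le> R * x * exp (R * x)\<close> bounds the inhomogeneous term by
\<open>R * moment_tail v\<close>.\<close>

lemma K_near_1:
  assumes u: "0 \<le> u"
  shows "1 - R * ((1 + B) * (1 + H)) \<le> K u"
proof (rule K_lower_bound[OF _ _ u])
  fix v :: real assume v: "0 \<le> v"
  have i: "integrable lborel (\<lambda>x. tail x * indicator {v<..} x)"
    using v by (intro tail_integrable_sub) auto
  have j: "integrable lborel (\<lambda>x. R * (x * g x * indicator {v..} x))"
    by (intro integrable_mult_right G.integrable_xg_ind)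
  have "1 * (\<integral>x. g x * indicator {v<..} x \<partial>lborel) - exp (R * v) * q * mean_excess v =
     (\<integral>x. g x * indicator {v<..} x - exp (R * v) * q * (tail x * indicator {v<..} x) \<partial>lborel)"
    unfolding mean_excess_def using i g_integrable_ind[of "{v<..}"]
    by (subst Bochner_Integration.integral_diff) auto
  also have "\<dots> \<le> (\<integral>x. R * (x * g x * indicator {v..} x) \<partial>lborel)"
  proof (rule integral_mono)
    show "integrable lborel (\<lambda>x. g x * indicator {v<..} x - exp (R * v) * q * (tail x * indicator {v<..} x))"
      using i g_integrable_ind[of "{v<..}"] by (intro Bochner_Integration.integrable_diff integrable_mult_right) auto
    fix x
    show "g x * indicator {v<..} x - exp (R * v) * q * (tail x * indicator {v<..} x) \<le> R * (x * g x * indicator {v..} x)"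
    proof (cases "v < x")
      case True
      have "exp (R * x) * (1 + (R * v - R * x)) \<le> exp (R * x) * exp (R * v - R * x)"
        using exp_ge_add_one_self[of "R * v - R * x"] by (intro mult_left_mono) auto
      also have "\<dots> = exp (R * v)" by (simp add: exp_add[symmetric])
      finally have "exp (R * x) - exp (R * v) \<le> exp (R * x) * (R * x) - exp (R * x) * (R * v)"
        by (simp add: algebra_simps)
      also have "\<dots> \<le> exp (R * x) * (R * x)" using R_pos v by simp
      finally have "(exp (R * x) - exp (R * v)) * (q * tail x) \<le> exp (R * x) * (R * x) * (q * tail x)"
        using q_pos tail_pos[of x] by (intro mult_right_mono) auto
      then show ?thesis using True v by (simp add: g_def algebra_simps)
    next
      case False
      then show ?thesis using R_pos G.xg_nonneg[of x] by (auto simp: indicator_def)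
    qed
  qed (rule j)
  also have "\<dots> = R * G.moment_tail v" using v by (simp add: G.moment_tail_def)
  finally show "1 * (\<integral>x. g x * indicator {v<..} x \<partial>lborel) - exp (R * v) * q * mean_excess v \<le> R * G.moment_tail v" .
qed (use R_pos in auto)

text \<open>Below the level \<open>A = 2 * (1 + B) * (1 + H)\<close> the inhomogeneous term of \<open>K\<close> dominates the constant
\<open>d = q * mean_excess A\<close>, and beyond it Markov's inequality bounds the tail of \<open>g\<close> by \<open>moment_tail v / A\<close>.
The level is chosen such that the resulting perturbation costs half of \<open>d\<close>.\<close>

lemma K_uniformly_positive:
  assumes u: "0 \<le> u"
  shows "q * mean_excess (2 * ((1 + B) * (1 + H))) / 2 \<le> K u"
proof -
  define A where "A = 2 * ((1 + B) * (1 + H))"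
  have BH: "0 < (1 + B) * (1 + H)" using B_nonneg H_nonneg by (intro mult_pos_pos) auto
  then have A: "0 < A" by (simp add: A_def)
  define d where "d = q * mean_excess A"
  have d: "0 < d" using q_pos mean_excess_pos[of A] A by (simp add: d_def)
  have tail_bd: "(\<integral>x. g x * indicator {v<..} x \<partial>lborel) \<le> 1" for v
    using G.cdf_g_nonneg[of v] G.tail_eq[of v] by simp
  have "d - d / A * ((1 + B) * (1 + H)) \<le> K u"
  proof (rule K_lower_bound[OF _ _ u])
    fix v :: real assume v: "0 \<le> v"
    have me: "0 \<le> exp (R * v) * q * mean_excess v"
      using q_pos mean_excess_pos[OF v] by (intro mult_nonneg_nonneg) auto
    show "d * (\<integral>x. g x * indicator {v<..} x \<partial>lborel) - exp (R * v) * q * mean_excess v \<le> d / A * G.moment_tail v"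
    proof (cases "v \<le> A")
      case True
      have "d * (\<integral>x. g x * indicator {v<..} x \<partial>lborel) \<le> d * 1" using tail_bd d by (intro mult_left_mono) auto
      also have "\<dots> \<le> q * mean_excess v"
      proof -
        have "mean_excess A \<le> mean_excess v"
          unfolding mean_excess_def using True v A tail_pos
          by (intro integral_mono tail_integrable_sub) (auto simp: indicator_def less_imp_le)
        then show ?thesis unfolding d_def using q_pos by (simp add: mult_left_mono)
      qed
      also have "\<dots> \<le> exp (R * v) * (q * mean_excess v)"
      proof -
        have "1 * (q * mean_excess v) \<le> exp (R * v) * (q * mean_excess v)"
          using R_pos v q_pos mean_excess_pos[OF v] by (intro mult_right_mono mult_nonneg_nonneg) auto
        then show ?thesis by simp
      qed
      finally have "d * (\<integral>x. g x * indicator {v<..} x \<partial>lborel) - exp (R * v) * q * mean_excess v \<le> 0"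
        by simp
      also have "0 \<le> d / A * G.moment_tail v" using d A G.moment_tail_nonneg by simp
      finally show ?thesis .
    next
      case False
      have "(\<integral>x. A * (g x * indicator {v<..} x) \<partial>lborel) \<le> (\<integral>x. x * g x * indicator {v..} x \<partial>lborel)"
      proof (rule integral_mono)
        show "integrable lborel (\<lambda>x. A * (g x * indicator {v<..} x))"
          by (intro integrable_mult_right g_integrable_ind) auto
        fix x
        show "A * (g x * indicator {v<..} x) \<le> x * g x * indicator {v..} x"
        proof (cases "v < x")
          case True
          then have "A * g x \<le> x * g x" using False g_nonneg by (intro mult_right_mono) auto
          then show ?thesis using True by simp
        next
          case 2: False
          then show ?thesis using G.xg_nonneg[of x] by (auto simp: indicator_def)
        qed
      qed (rule G.integrable_xg_ind)
      then have "(\<integral>x. g x * indicator {v<..} x \<partial>lborel) \<le> G.moment_tail v / A"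
        using v A by (simp add: G.moment_tail_def pos_le_divide_eq mult.commute)
      then have "d * (\<integral>x. g x * indicator {v<..} x \<partial>lborel) \<le> d * (G.moment_tail v / A)"
        using d by (intro mult_left_mono) auto
      then show ?thesis using me by simp
    qed
  qed (use d A in auto)
  moreover have "d / (2 * y) * y = d / 2" if "0 < y" for y using that by simp
  from this[OF BH] have "d / A * ((1 + B) * (1 + H)) = d / 2" unfolding A_def .
  ultimately show ?thesis by (simp add: d_def A_def)
qed

text \<open>Lundberg's inequality for the integer skeleton.\<close>

lemma ruin_prob_upper: "exp (R * u) * ruin_prob X u \<le> exp (R * c)"
proof -
  have "ruin_prob X u \<le> exp (- R * (u - c))"
    using ruin_prob_le_skeleton[of u] skeleton_lundberg[OF mgfR mgfR_nonneg mgfR_eq R_pos _ joint_law_1, of "u - c"] by simp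
  then have "exp (R * u) * ruin_prob X u \<le> exp (R * u) * exp (- R * (u - c))" by (intro mult_left_mono) auto
  also have "\<dots> = exp (R * c)" by (simp add: exp_add[symmetric] algebra_simps)
  finally show ?thesis .
qed

lemma ruin_prob_lower:
  assumes u: "0 \<le> u"
  shows "exp (- R * c) * K (u + c) \<le> exp (R * u) * ruin_prob X u"
proof -
  have "exp (- R * c) * K (u + c) = exp (R * u) * psi (u + c)"
    using u premium_pos by (simp add: K_def exp_add[symmetric] algebra_simps)
  also have "\<dots> \<le> exp (R * u) * ruin_prob X u" using ruin_prob_copy_le by (intro mult_left_mono) auto
  finally show ?thesis .
qed

end

section \<open>Adjustment coefficients and cumulants\<close>

lemma power_over_fact_le_exp:
  fixes y :: real
  assumes "0 \<le> y"
  shows "y ^ n / fact n \<le> exp y"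
proof -
  obtain t where t: "exp y = (\<Sum>j<Suc n. y ^ j / fact j) + exp t / fact (Suc n) * y ^ Suc n"
    using Maclaurin_exp_le[of y "Suc n"] by auto
  have "0 \<le> (\<Sum>j<n. y ^ j / fact j)" using assms by (intro sum_nonneg) auto
  moreover have "0 \<le> exp t / fact (Suc n) * y ^ Suc n" using assms by (intro mult_nonneg_nonneg) auto
  ultimately show ?thesis using t by simp
qed

text \<open>Half of the exponential moment of order \<open>r\<close> absorbs the power \<open>\<bar>x\<bar> ^ n\<close>, the other half the factor
\<open>exp (s * \<bar>x\<bar>)\<close> of the Lagrange remainder.\<close>

lemma exp_taylor_remainder:
  fixes x s r :: real
  assumes s: "0 < s" "s \<le> r / 2"
  shows "\<bar>exp (s * x) - (\<Sum>j<n. (s * x) ^ j / fact j)\<bar> \<le> s ^ n * ((2 / r) ^ n * exp (r * \<bar>x\<bar>))"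
proof -
  have r: "0 < r" using s by simp
  obtain t where t: "\<bar>t\<bar> \<le> \<bar>s * x\<bar>" "exp (s * x) = (\<Sum>j<n. (s * x) ^ j / fact j) + exp t / fact n * (s * x) ^ n"
    using Maclaurin_exp_le[of "s * x" n] by auto
  have "(r / 2 * \<bar>x\<bar>) ^ n / fact n \<le> exp (r / 2 * \<bar>x\<bar>)"
    using r by (intro power_over_fact_le_exp) simp
  then have "(2 / r) ^ n * ((r / 2 * \<bar>x\<bar>) ^ n / fact n) \<le> (2 / r) ^ n * exp (r / 2 * \<bar>x\<bar>)"
    using r by (intro mult_left_mono) auto
  moreover have "(2 / r) ^ n * ((r / 2 * \<bar>x\<bar>) ^ n / fact n) = \<bar>x\<bar> ^ n / fact n"
    using r by (simp add: power_mult_distrib[symmetric])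
  ultimately have pow: "\<bar>x\<bar> ^ n / fact n \<le> (2 / r) ^ n * exp (r / 2 * \<bar>x\<bar>)" by simp
  have "s * \<bar>x\<bar> \<le> r / 2 * \<bar>x\<bar>" using s by (intro mult_right_mono) auto
  then have "\<bar>s * x\<bar> \<le> r / 2 * \<bar>x\<bar>" using s by (simp add: abs_mult)
  then have et: "exp t \<le> exp (r / 2 * \<bar>x\<bar>)" using t(1) by simp
  have "\<bar>exp (s * x) - (\<Sum>j<n. (s * x) ^ j / fact j)\<bar> = s ^ n * (exp t * (\<bar>x\<bar> ^ n / fact n))"
    using s unfolding t(2) by (simp add: abs_mult power_mult_distrib power_abs)
  also have "\<dots> \<le> s ^ n * (exp (r / 2 * \<bar>x\<bar>) * ((2 / r) ^ n * exp (r / 2 * \<bar>x\<bar>)))"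
    using et pow s by (intro mult_left_mono mult_mono) auto
  also have "\<dots> = s ^ n * ((2 / r) ^ n * exp (r * \<bar>x\<bar>))"
  proof -
    have "exp (r * \<bar>x\<bar>) = exp (r / 2 * \<bar>x\<bar>) * exp (r / 2 * \<bar>x\<bar>)" by (simp add: exp_add[symmetric])
    then show ?thesis by (simp add: mult_ac)
  qed
  finally show ?thesis .
qed

lemma (in prob_space) mgf_taylor:
  fixes V :: "'a \<Rightarrow> real" and r s :: real
  assumes [measurable]: "V \<in> borel_measurable M" and int: "integrable M (\<lambda>\<omega>. exp (r * \<bar>V \<omega>\<bar>))" and r: "0 < r"
    and s: "0 < s" "s \<le> r / 2"
  shows "integrable M (\<lambda>\<omega>. exp (s * V \<omega>))"
    and "\<bar>(\<integral>\<omega>. exp (s * V \<omega>) \<partial>M) - (\<Sum>j<n. s ^ j * (\<integral>\<omega>. V \<omega> ^ j \<partial>M) / fact j)\<bar> \<le>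
       s ^ n * ((2 / r) ^ n * (\<integral>\<omega>. exp (r * \<bar>V \<omega>\<bar>) \<partial>M))"
proof -
  show i1: "integrable M (\<lambda>\<omega>. exp (s * V \<omega>))"
  proof (rule Bochner_Integration.integrable_bound[OF int])
    show "AE \<omega> in M. norm (exp (s * V \<omega>)) \<le> norm (exp (r * \<bar>V \<omega>\<bar>))"
    proof (rule AE_I2)
      fix \<omega>
      have "s * V \<omega> \<le> s * \<bar>V \<omega>\<bar>" using s by (intro mult_left_mono) auto
      also have "\<dots> \<le> r * \<bar>V \<omega>\<bar>" using s r by (intro mult_right_mono) auto
      finally show "norm (exp (s * V \<omega>)) \<le> norm (exp (r * \<bar>V \<omega>\<bar>))" by simp
    qed
  qed measurable
  have ip: "integrable M (\<lambda>\<omega>. V \<omega> ^ j)" for j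
  proof (rule Bochner_Integration.integrable_bound[OF integrable_mult_right[OF int, of "fact j / r ^ j"]])
    show "AE \<omega> in M. norm (V \<omega> ^ j) \<le> norm (fact j / r ^ j * exp (r * \<bar>V \<omega>\<bar>))"
    proof (rule AE_I2)
      fix \<omega>
      have nn: "0 \<le> r * \<bar>V \<omega>\<bar>" using r by simp
      have "(r * \<bar>V \<omega>\<bar>) ^ j / fact j \<le> exp (r * \<bar>V \<omega>\<bar>)" by (rule power_over_fact_le_exp[OF nn])
      then have "r ^ j * \<bar>V \<omega>\<bar> ^ j \<le> fact j * exp (r * \<bar>V \<omega>\<bar>)"
        by (simp add: power_mult_distrib field_simps)
      then have "\<bar>V \<omega>\<bar> ^ j \<le> fact j / r ^ j * exp (r * \<bar>V \<omega>\<bar>)"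
        using r by (simp add: field_simps)
      then show "norm (V \<omega> ^ j) \<le> norm (fact j / r ^ j * exp (r * \<bar>V \<omega>\<bar>))"
        using r by (simp add: power_abs)
    qed
  qed measurable
  have "(\<integral>\<omega>. exp (s * V \<omega>) \<partial>M) - (\<Sum>j<n. s ^ j * (\<integral>\<omega>. V \<omega> ^ j \<partial>M) / fact j) =
      (\<integral>\<omega>. exp (s * V \<omega>) - (\<Sum>j<n. (s * V \<omega>) ^ j / fact j) \<partial>M)"
    using i1 ip by (simp add: power_mult_distrib)
  also have "\<bar>(\<integral>\<omega>. exp (s * V \<omega>) - (\<Sum>j<n. (s * V \<omega>) ^ j / fact j) \<partial>M)\<bar> \<le>
      (\<integral>\<omega>. s ^ n * ((2 / r) ^ n * exp (r * \<bar>V \<omega>\<bar>)) \<partial>M)"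
  proof (rule order_trans[OF integral_abs_bound integral_mono])
    have i: "integrable M (\<lambda>\<omega>. exp (s * V \<omega>) - (\<Sum>j<n. (s * V \<omega>) ^ j / fact j))"
      unfolding power_mult_distrib using i1 ip by auto
    then show "integrable M (\<lambda>\<omega>. \<bar>exp (s * V \<omega>) - (\<Sum>j<n. (s * V \<omega>) ^ j / fact j)\<bar>)"
      by (rule integrable_abs)
    show "integrable M (\<lambda>\<omega>. s ^ n * ((2 / r) ^ n * exp (r * \<bar>V \<omega>\<bar>)))"
      by (intro integrable_mult_right int)
  qed (rule exp_taylor_remainder[OF s])
  finally show "\<bar>(\<integral>\<omega>. exp (s * V \<omega>) \<partial>M) - (\<Sum>j<n. s ^ j * (\<integral>\<omega>. V \<omega> ^ j \<partial>M) / fact j)\<bar> \<le>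
       s ^ n * ((2 / r) ^ n * (\<integral>\<omega>. exp (r * \<bar>V \<omega>\<bar>) \<partial>M))" by simp
qed

text \<open>Let \<open>s \<rightarrow> 0\<close> to see that the constant coefficient vanishes, then divide by \<open>s\<close>.\<close>

lemma polynomial_coeffs_zero:
  fixes a :: "nat \<Rightarrow> real"
  assumes "0 < \<delta>" "\<And>s. 0 < s \<Longrightarrow> s \<le> \<delta> \<Longrightarrow> \<bar>\<Sum>j<n. a j * s ^ j\<bar> \<le> C * s ^ n" "j < n"
  shows "a j = 0"
  using assms(2,3)
proof (induction n arbitrary: a j)
  case (Suc n)
  have ev: "\<forall>\<^sub>F s in at_right 0. 0 < s \<and> s \<le> \<delta>"
    using assms(1) by (auto simp: eventually_at_right_field intro!: exI[of _ \<delta>])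
  have lim: "((\<lambda>s. C * s ^ Suc n) \<longlongrightarrow> C * 0 ^ Suc n) (at_right (0::real))"
    by (intro tendsto_intros)
  have "((\<lambda>s. \<Sum>j<Suc n. a j * s ^ j) \<longlongrightarrow> (\<Sum>j<Suc n. a j * 0 ^ j)) (at_right (0::real))"
    by (intro tendsto_intros)
  moreover have "((\<lambda>s. \<Sum>j<Suc n. a j * s ^ j) \<longlongrightarrow> 0) (at_right (0::real))"
  proof (rule Lim_null_comparison)
    show "\<forall>\<^sub>F s in at_right 0. norm (\<Sum>j<Suc n. a j * s ^ j) \<le> C * s ^ Suc n"
      using ev by eventually_elim (use Suc.prems(1) in auto)
    show "((\<lambda>s. C * s ^ Suc n) \<longlongrightarrow> 0) (at_right 0)" using lim by simp
  qed
  ultimately have "(\<Sum>j<Suc n. a j * 0 ^ j) = 0" by (intro tendsto_unique[of "at_right (0::real)"]) auto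
  moreover have "(\<Sum>j<Suc n. a j * 0 ^ j) = a 0" by (simp add: sum.lessThan_Suc_shift del: sum.lessThan_Suc)
  ultimately have a0: "a 0 = 0" by simp
  have "a (Suc i) = 0" if "i < n" for i
  proof (rule Suc.IH[OF _ that])
    fix s :: real assume s: "0 < s" "s \<le> \<delta>"
    have "(\<Sum>j<Suc n. a j * s ^ j) = s * (\<Sum>j<n. a (Suc j) * s ^ j)"
      by (simp add: sum.lessThan_Suc_shift a0 sum_distrib_left mult_ac del: sum.lessThan_Suc)
    then have "s * \<bar>\<Sum>j<n. a (Suc j) * s ^ j\<bar> \<le> s * (C * s ^ n)"
      using Suc.prems(1)[OF s] s by (simp add: abs_mult mult_ac del: sum.lessThan_Suc)
    then show "\<bar>\<Sum>j<n. a (Suc j) * s ^ j\<bar> \<le> C * s ^ n" using s by simp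
  qed
  then show ?case using a0 Suc.prems(2) by (cases j) auto
qed simp

text \<open>Where the integrand is positive it strictly increases with \<open>r\<close>, and it cannot vanish almost everywhere as
its integral is \<open>1\<close>.\<close>

lemma adjustment_coeff_unique:
  assumes "compound_poisson X" "is_adjustment_coeff X r" "is_adjustment_coeff X s"
  shows "r = s"
proof -
  interpret compound_poisson X by fact
  define \<phi> where "\<phi> x = f_I X x / (1 + safety_loading X)" for x
  have [measurable]: "\<phi> \<in> borel_measurable borel"
    unfolding \<phi>_def f_I_def tail_eq_cdf[symmetric] by measurable
  have one: "(\<integral>\<^sup>+x\<in>{0..}. ennreal (exp (r * x) * \<phi> x) \<partial>lborel) = 1" if "is_adjustment_coeff X r" for r
    using that unfolding is_adjustment_coeff_def \<phi>_def by simp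
  have no: False if rs: "r < s" and r: "is_adjustment_coeff X r" and s: "is_adjustment_coeff X s" for r s
  proof -
    have "(\<integral>\<^sup>+x\<in>{0..}. ennreal (exp (s * x) * \<phi> x) \<partial>lborel) =
       (\<integral>\<^sup>+x. ennreal (exp (r * x) * \<phi> x) * indicator {0..} x + ennreal ((exp (s * x) - exp (r * x)) * \<phi> x) * indicator {0..} x \<partial>lborel)"
    proof (rule nn_integral_cong)
      fix x :: real
      show "ennreal (exp (s * x) * \<phi> x) * indicator {0..} x =
        ennreal (exp (r * x) * \<phi> x) * indicator {0..} x + ennreal ((exp (s * x) - exp (r * x)) * \<phi> x) * indicator {0..} x"
      proof (cases "0 \<le> x \<and> 0 \<le> \<phi> x")
        case True
        then have "exp (r * x) \<le> exp (s * x)" using rs by (simp add: mult_right_mono)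
        then have "ennreal (exp (r * x) * \<phi> x) + ennreal ((exp (s * x) - exp (r * x)) * \<phi> x) =
           ennreal (exp (r * x) * \<phi> x + (exp (s * x) - exp (r * x)) * \<phi> x)"
          using True by (intro ennreal_plus[symmetric]) auto
        then show ?thesis using True by (simp add: algebra_simps)
      next
        case False
        show ?thesis
        proof (cases "0 \<le> x")
          case True
          then have "exp (r * x) \<le> exp (s * x)" "\<phi> x \<le> 0" using rs False by (auto simp: mult_right_mono)
          then show ?thesis by (simp add: ennreal_neg mult_nonneg_nonpos)
        qed simp
      qed
    qed
    also have "\<dots> = 1 + (\<integral>\<^sup>+x. ennreal ((exp (s * x) - exp (r * x)) * \<phi> x) * indicator {0..} x \<partial>lborel)"
      using one[OF r] by (subst nn_integral_add) auto
    finally have "1 + 0 = 1 + (\<integral>\<^sup>+x. ennreal ((exp (s * x) - exp (r * x)) * \<phi> x) * indicator {0..} x \<partial>lborel)"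
      unfolding one[OF s] by simp
    then have "(\<integral>\<^sup>+x. ennreal ((exp (s * x) - exp (r * x)) * \<phi> x) * indicator {0..} x \<partial>lborel) = 0"
      unfolding ennreal_add_left_cancel by simp
    then have "AE x in lborel. ennreal ((exp (s * x) - exp (r * x)) * \<phi> x) * indicator {0..} x = 0"
      by (subst (asm) nn_integral_0_iff_AE) auto
    then have "AE x in lborel. ennreal (exp (r * x) * \<phi> x) * indicator {0..} x = 0"
      using AE_lborel_singleton[of 0]
    proof eventually_elim
      case (elim x)
      show ?case
      proof (cases "0 < x")
        case True
        then have "0 < exp (s * x) - exp (r * x)" using rs by simp
        moreover have "(exp (s * x) - exp (r * x)) * \<phi> x \<le> 0" using elim(1) True by (simp add: ennreal_eq_0_iff)
        ultimately have "\<phi> x \<le> 0" by (simp add: mult_le_0_iff)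
        then show ?thesis by (simp add: ennreal_neg mult_nonneg_nonpos)
      next
        case False
        then show ?thesis using elim(2) by (simp add: indicator_def)
      qed
    qed
    then have "(\<integral>\<^sup>+x\<in>{0..}. ennreal (exp (r * x) * \<phi> x) \<partial>lborel) = 0"
      by (subst nn_integral_0_iff_AE) auto
    then show False using one[OF r] by simp
  qed
  show ?thesis using no[of r s] no[of s r] assms(2,3) by (cases r s rule: linorder_cases) auto
qed

context adjusted_model
begin

lemma exp_tail_integrable: "integrable lborel (\<lambda>x. exp (R * x) * tail x * indicator {0..} x)"
  and exp_tail_integral: "(\<integral>x. exp (R * x) * tail x * indicator {0..} x \<partial>lborel) = c / lam"
proof -
  have eq: "(\<lambda>x. exp (R * x) * tail x * indicator {0..} x) = (\<lambda>x. g x / q)"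
    unfolding g_def using q_pos by (auto simp: fun_eq_iff)
  show "integrable lborel (\<lambda>x. exp (R * x) * tail x * indicator {0..} x)"
    unfolding eq using g_integrable by simp
  show "(\<integral>x. exp (R * x) * tail x * indicator {0..} x \<partial>lborel) = c / lam"
    unfolding eq using G.integral_g by (simp add: q_def)
qed

lemma tail_moment_integrable: "j \<le> k \<Longrightarrow> integrable lborel (\<lambda>x. x ^ j * tail x * indicator {0..} x)"
  and tail_moment_integral: "j \<le> k \<Longrightarrow> (\<integral>x. x ^ j * tail x * indicator {0..} x \<partial>lborel) = claim_moment X (Suc j) / real (Suc j)"
proof -
  assume j: "j \<le> k"
  have *: "(\<integral>\<^sup>+x. ennreal (x ^ j * tail x * indicator {0..} x) \<partial>lborel) = ennreal (claim_moment X (Suc j) / real (Suc j))"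
    unfolding tail_moment[OF j, symmetric] by (intro nn_integral_cong) (auto simp: indicator_def)
  have nn: "0 \<le> x ^ j * tail x * indicator {0..} x" for x
    using tail_pos[of x] by (auto simp: indicator_def less_imp_le)
  have m0: "0 \<le> claim_moment X (Suc j)"
    unfolding claim_moment_eq using AE_\<nu>_pos by (intro integral_nonneg_AE) (auto elim!: eventually_mono)
  show "integrable lborel (\<lambda>x. x ^ j * tail x * indicator {0..} x)"
    using * nn by (intro integrableI_nonneg) auto
  show "(\<integral>x. x ^ j * tail x * indicator {0..} x \<partial>lborel) = claim_moment X (Suc j) / real (Suc j)"
    using * nn m0 by (subst integral_eq_nn_integral) auto
qed

lemma claim_moment_pos: "1 \<le> j \<Longrightarrow> j \<le> k \<Longrightarrow> 0 < claim_moment X j"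
proof -
  assume "1 \<le> j" "j \<le> k"
  then obtain i where i: "j = Suc i" "i \<le> k" by (cases j) auto
  have "(\<integral>x. tail 2 * indicator {1..2::real} x \<partial>lborel) \<le> (\<integral>x. x ^ i * tail x * indicator {0..} x \<partial>lborel)"
  proof (rule integral_mono)
    show "integrable lborel (\<lambda>x. tail 2 * indicator {1..2::real} x)"
      by (intro integrable_mult_right integrable_real_indicator) auto
    show "integrable lborel (\<lambda>x. x ^ i * tail x * indicator {0..} x)" by (rule tail_moment_integrable[OF i(2)])
    fix x :: real
    show "tail 2 * indicator {1..2} x \<le> x ^ i * tail x * indicator {0..} x"
    proof (cases "x \<in> {1..2}")
      case True
      then have "1 * tail 2 \<le> x ^ i * tail x"
        using tail_antimono[of x 2] tail_pos[of 2] one_le_power[of x i] by (intro mult_mono) auto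
      then show ?thesis using True by simp
    next
      case False
      then show ?thesis using tail_pos[of x] by (auto simp: indicator_def less_imp_le)
    qed
  qed
  then have "tail 2 \<le> claim_moment X j / real j" unfolding tail_moment_integral[OF i(2)] i(1) by simp
  then have "0 < claim_moment X j / real j" using tail_pos[of 2] by linarith
  then show ?thesis using i(1) by (simp add: zero_less_divide_iff)
qed

text \<open>Since \<open>0 \<le> exp y - (\<Sum>j<n. y ^ j / fact j) \<le> y ^ n * exp y\<close> for \<open>y \<ge> 0\<close>, expanding \<open>exp (R * x)\<close> in the
equation \<open>lam * (\<integral>exp (R * x) * tail x) = c\<close> leaves a remainder that the exponential moment of order \<open>n\<close>
bounds.\<close>

lemma adjustment_taylor:
  assumes n: "1 \<le> n" "n \<le> k"
  shows "(\<Sum>j=1..<n. R ^ j * (lam * claim_moment X (Suc j)) / fact (Suc j)) \<le> c - lam * m1"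
    and "c - lam * m1 - (\<Sum>j=1..<n. R ^ j * (lam * claim_moment X (Suc j)) / fact (Suc j)) \<le> c * (1 + B) * R ^ n"
proof -
  define P where "P = (\<Sum>j=1..<n. R ^ j * (lam * claim_moment X (Suc j)) / fact (Suc j))"
  define D where "D = (\<integral>x. exp (R * x) * tail x * indicator {0..} x - (\<Sum>j<n. R ^ j / fact j * (x ^ j * tail x * indicator {0..} x)) \<partial>lborel)"
  have intD: "integrable lborel (\<lambda>x. exp (R * x) * tail x * indicator {0..} x - (\<Sum>j<n. R ^ j / fact j * (x ^ j * tail x * indicator {0..} x)))"
    using n tail_moment_integrable exp_tail_integrable by (intro Bochner_Integration.integrable_diff Bochner_Integration.integrable_sum integrable_mult_right) auto
  have "D = c / lam - (\<Sum>j<n. R ^ j / fact j * (claim_moment X (Suc j) / real (Suc j)))"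
  proof -
    have "D = c / lam - (\<integral>x. (\<Sum>j<n. R ^ j / fact j * (x ^ j * tail x * indicator {0..} x)) \<partial>lborel)"
      unfolding D_def exp_tail_integral[symmetric] using n tail_moment_integrable exp_tail_integrable
      by (intro Bochner_Integration.integral_diff Bochner_Integration.integrable_sum integrable_mult_right) auto
    also have "(\<integral>x. (\<Sum>j<n. R ^ j / fact j * (x ^ j * tail x * indicator {0..} x)) \<partial>lborel) =
       (\<Sum>j<n. (\<integral>x. R ^ j / fact j * (x ^ j * tail x * indicator {0..} x) \<partial>lborel))"
      using n tail_moment_integrable by (intro Bochner_Integration.integral_sum integrable_mult_right) auto
    also have "\<dots> = (\<Sum>j<n. R ^ j / fact j * (claim_moment X (Suc j) / real (Suc j)))"
      using n tail_moment_integral by (intro sum.cong refl) (simp del: of_nat_Suc)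
    finally show ?thesis .
  qed
  then have "lam * D = c - (\<Sum>j<n. R ^ j * (lam * claim_moment X (Suc j)) / fact (Suc j))"
    using intensity_pos by (simp add: right_diff_distrib sum_distrib_left mult_ac)
  moreover have "(\<Sum>j<n. R ^ j * (lam * claim_moment X (Suc j)) / fact (Suc j)) = lam * m1 + P"
  proof -
    have "{..<n} = insert 0 {1..<n}" using n by auto
    then show ?thesis by (simp add: P_def)
  qed
  ultimately have DP: "lam * D = c - lam * m1 - P" by simp
  have lo: "0 \<le> exp (R * x) * tail x * indicator {0..} x - (\<Sum>j<n. R ^ j / fact j * (x ^ j * tail x * indicator {0..} x))"
    and hi: "exp (R * x) * tail x * indicator {0..} x - (\<Sum>j<n. R ^ j / fact j * (x ^ j * tail x * indicator {0..} x)) \<le>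
       R ^ n / q * (x ^ n * g x)" for x
  proof -
    have "(0 \<le> exp (R * x) - (\<Sum>j<n. (R * x) ^ j / fact j)) \<and> exp (R * x) - (\<Sum>j<n. (R * x) ^ j / fact j) \<le> (R * x) ^ n * exp (R * x)" if x: "0 \<le> x"
    proof -
      have y: "0 \<le> R * x" using R_pos x by simp
      obtain t where t: "\<bar>t\<bar> \<le> \<bar>R * x\<bar>" "exp (R * x) = (\<Sum>j<n. (R * x) ^ j / fact j) + exp t / fact n * (R * x) ^ n"
        using Maclaurin_exp_le[of "R * x" n] by auto
      have "exp t / fact n \<le> exp (R * x) / 1" using t(1) y by (intro frac_le) auto
      then have "exp t / fact n * (R * x) ^ n \<le> exp (R * x) * (R * x) ^ n" using y by (intro mult_right_mono) auto
      then show ?thesis using t(2) y by (auto simp: mult.commute)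
    qed
    note e = this
    have s: "exp (R * x) * tail x * indicator {0..} x - (\<Sum>j<n. R ^ j / fact j * (x ^ j * tail x * indicator {0..} x)) =
      (exp (R * x) - (\<Sum>j<n. (R * x) ^ j / fact j)) * (tail x * indicator {0..} x)"
    proof -
      have "(\<Sum>j<n. R ^ j / fact j * (x ^ j * tail x * indicator {0..} x)) =
        (\<Sum>j<n. (R * x) ^ j / fact j) * (tail x * indicator {0..} x)"
        unfolding sum_distrib_right by (intro sum.cong refl) (simp add: power_mult_distrib)
      then show ?thesis by (simp add: left_diff_distrib)
    qed
    show "0 \<le> exp (R * x) * tail x * indicator {0..} x - (\<Sum>j<n. R ^ j / fact j * (x ^ j * tail x * indicator {0..} x))"
      unfolding s using e tail_pos[of x] by (cases "0 \<le> x") (auto intro!: mult_nonneg_nonneg simp: less_imp_le)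
    show "exp (R * x) * tail x * indicator {0..} x - (\<Sum>j<n. R ^ j / fact j * (x ^ j * tail x * indicator {0..} x)) \<le> R ^ n / q * (x ^ n * g x)"
      unfolding s
    proof (cases "0 \<le> x")
      case True
      have "(exp (R * x) - (\<Sum>j<n. (R * x) ^ j / fact j)) * tail x \<le> (R * x) ^ n * exp (R * x) * tail x"
        using e[OF True] tail_pos[of x] by (intro mult_right_mono) auto
      then show "(exp (R * x) - (\<Sum>j<n. (R * x) ^ j / fact j)) * (tail x * indicator {0..} x) \<le> R ^ n / q * (x ^ n * g x)"
        using True q_pos by (simp add: g_def power_mult_distrib mult_ac)
    qed (simp add: g_def)
  qed
  have "0 \<le> D" unfolding D_def using lo by (intro integral_nonneg_AE) auto
  then have "0 \<le> lam * D" using intensity_pos by simp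
  then show "P \<le> c - lam * m1" using DP by simp
  have gm: "(\<integral>\<^sup>+x. ennreal (x ^ n * g x) \<partial>lborel) \<le> ennreal (1 + B)"
  proof -
    have "(\<integral>\<^sup>+x. ennreal (x ^ n * g x) \<partial>lborel) = (\<integral>\<^sup>+x. ennreal (q * (x ^ n * exp (R * x) * tail x)) * indicator {0..} x \<partial>lborel)"
      by (intro nn_integral_cong) (auto simp: g_def indicator_def mult_ac)
    then show ?thesis using exp_moment_nn[OF n(2)] by simp
  qed
  have xg: "0 \<le> x ^ n * g x" for x using q_pos tail_pos[of x] by (cases "0 \<le> x") (auto simp: g_def less_imp_le)
  have ig: "integrable lborel (\<lambda>x. x ^ n * g x)"
    using gm xg by (intro integrableI_nonneg) (auto simp: less_top[symmetric] top_unique)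
  have Ig: "(\<integral>x. x ^ n * g x \<partial>lborel) \<le> 1 + B"
    using gm xg B_nonneg by (subst integral_eq_nn_integral) (auto intro!: enn2real_leI)
  have "D \<le> (\<integral>x. R ^ n / q * (x ^ n * g x) \<partial>lborel)"
    unfolding D_def using hi by (intro integral_mono intD integrable_mult_right ig) auto
  also have "\<dots> = R ^ n / q * (\<integral>x. x ^ n * g x \<partial>lborel)" by simp
  also have "\<dots> \<le> R ^ n / q * (1 + B)" using Ig R_pos q_pos by (intro mult_left_mono) auto
  finally have "lam * D \<le> lam * (R ^ n / q * (1 + B))" using intensity_pos by (intro mult_left_mono) auto
  also have "\<dots> = c * (1 + B) * R ^ n" using intensity_pos premium_pos by (simp add: q_def)
  finally show "c - lam * m1 - P \<le> c * (1 + B) * R ^ n" using DP by simp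
qed

text \<open>By the joint law at mesh \<open>1\<close> the total claims up to time \<open>1\<close> form a compound Poisson sum. The exponent \<open>r\<close> may
be negative: \<open>r = R\<close> gives integrability, and \<open>r = - s\<close> the generating function of the reserve.\<close>

lemma mgf_claim_total:
  assumes M: "(\<integral>\<^sup>+x. ennreal (exp (r * x)) \<partial>\<nu>) = ennreal M" "0 \<le> M"
  shows "(\<integral>\<^sup>+\<omega>. ennreal (exp (r * (\<Sum>i<arrivals X 1 \<omega>. claim X i \<omega>))) \<partial>sample X) = ennreal (exp (lam * (M - 1)))"
proof -
  interpret Gr: grid_model "poisson_pmf lam" \<nu> by (rule grid_model_\<nu>)
  let ?NB = "PiM UNIV (\<lambda>_. count_space UNIV) \<Otimes>\<^sub>M PiM UNIV (\<lambda>_. borel) :: ((nat \<Rightarrow> nat) \<times> (nat \<Rightarrow> real)) measure"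
  let ?V = "\<lambda>\<omega>. (increments 1 \<omega>, \<lambda>i. claim X i \<omega>)"
  let ?f = "\<lambda>(k, z). ennreal (exp (r * (\<Sum>i<k (0::nat). z i)))"
  have Vm: "?V \<in> measurable (sample X) ?NB"
    and law: "distr (sample X) ?NB ?V = Gr.N.S \<Otimes>\<^sub>M Gr.Z.S"
    using joint_law_1 by (simp_all add: joint_law_def)
  have sets_eq: "sets ?NB = sets (Gr.N.S \<Otimes>\<^sub>M Gr.Z.S)"
    by (intro sets_pair_measure_cong sets_PiM_cong) (auto simp: sets_\<nu>)
  have fS: "(\<lambda>x. \<Sum>i<fst x (0::nat). snd x i) \<in> borel_measurable (Gr.N.S \<Otimes>\<^sub>M Gr.Z.S)"
  proof (rule measurable_compose_countable[where f = "\<lambda>m x. \<Sum>i<m. snd x i" and g = "\<lambda>x. fst x 0"])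
    show "(\<lambda>x. \<Sum>i<m. snd x i) \<in> borel_measurable (Gr.N.S \<Otimes>\<^sub>M Gr.Z.S)" for m
      by (intro borel_measurable_sum measurable_compose[OF measurable_snd Gr.measurable_claim])
    show "(\<lambda>x. fst x 0) \<in> measurable (Gr.N.S \<Otimes>\<^sub>M Gr.Z.S) (count_space UNIV)"
      by (intro measurable_compose[OF measurable_fst Gr.measurable_count])
  qed
  have fm: "?f \<in> borel_measurable (Gr.N.S \<Otimes>\<^sub>M Gr.Z.S)"
    unfolding case_prod_beta'
    by (intro measurable_compose[OF _ measurable_ennreal] measurable_compose[OF _ borel_measurable_exp] borel_measurable_times borel_measurable_const fS)
  have fm': "?f \<in> borel_measurable ?NB" using fm by (simp add: measurable_cong_sets[OF sets_eq refl])
  have arr: "arrivals X 1 \<omega> = increments 1 \<omega> 0" if "\<omega> \<in> space (sample X)" for \<omega>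
    using sum_increments[OF that, of 1 1] by simp
  have "(\<integral>\<^sup>+\<omega>. ennreal (exp (r * (\<Sum>i<arrivals X 1 \<omega>. claim X i \<omega>))) \<partial>sample X) = (\<integral>\<^sup>+\<omega>. ?f (?V \<omega>) \<partial>sample X)"
    by (intro nn_integral_cong) (simp add: arr)
  also have "\<dots> = (\<integral>\<^sup>+x. ?f x \<partial>(Gr.N.S \<Otimes>\<^sub>M Gr.Z.S))"
    unfolding law[symmetric] by (rule nn_integral_distr[OF Vm, symmetric]) (use fm' in simp)
  also have "\<dots> = (\<integral>\<^sup>+k. (\<integral>\<^sup>+z. ?f (k, z) \<partial>Gr.Z.S) \<partial>Gr.N.S)"
    by (rule Gr.Z.P.nn_integral_fst[OF fm, symmetric])
  also have "\<dots> = (\<integral>\<^sup>+k. ennreal M ^ (k 0) \<partial>Gr.N.S)"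
    by (intro nn_integral_cong) (simp add: Gr.mgf_sum[OF M(1)])
  also have "\<dots> = (\<integral>\<^sup>+m. ennreal M ^ m \<partial>distr Gr.N.S (measure_pmf (poisson_pmf lam)) (\<lambda>k. k 0))"
    by (subst nn_integral_distr) auto
  also have "distr Gr.N.S (measure_pmf (poisson_pmf lam)) (\<lambda>k. k 0) = measure_pmf (poisson_pmf lam)"
    using Gr.N.PiM_component[of 0] by simp
  also have "(\<integral>\<^sup>+m. ennreal M ^ m \<partial>measure_pmf (poisson_pmf lam)) = ennreal (exp (lam * (M - 1)))"
    using intensity_pos M(2) by (rule nn_integral_poisson_power)
  finally show ?thesis .
qed

text \<open>The cumulant generating function of the reserve at time \<open>1\<close> from initial reserve \<open>0\<close>.\<close>

definition kappa :: "real \<Rightarrow> real" where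
  "kappa s = c * s + lam * ((\<integral>z. exp (s * - z) \<partial>\<nu>) - 1)"

text \<open>The coefficients of \<open>kappa\<close>.\<close>

definition cumulant :: "nat \<Rightarrow> real" where
  "cumulant j = (if j = 0 then 0 else if j = 1 then c - lam * m1 else (-1) ^ j * (lam * claim_moment X j))"

text \<open>The absolute value and the sign bring the claims into the form in which \<open>mgf_taylor\<close> is applied, to the
random variable \<open>- Z\<close>.\<close>

lemma exp_claim_integrable: "integrable \<nu> (\<lambda>z. exp (R * \<bar>- z\<bar>))"
proof (rule integrableI_nonneg)
  have "(\<integral>\<^sup>+z. ennreal (exp (R * \<bar>- z\<bar>)) \<partial>\<nu>) = (\<integral>\<^sup>+z. ennreal (exp (R * z)) \<partial>\<nu>)"
    by (rule nn_integral_cong_AE, use AE_\<nu>_pos in eventually_elim) simp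
  then show "(\<integral>\<^sup>+z. ennreal (exp (R * \<bar>- z\<bar>)) \<partial>\<nu>) < \<infinity>" by (simp add: mgfR)
qed (auto simp: measurable_cong_sets[OF sets_\<nu> refl])

lemma kappa_taylor:
  "\<exists>C. \<forall>s. 0 < s \<longrightarrow> s \<le> R / 2 \<longrightarrow> \<bar>kappa s - (\<Sum>j<Suc k. cumulant j / fact j * s ^ j)\<bar> \<le> C * s ^ Suc k"
proof (intro exI allI impI)
  fix s :: real assume s: "0 < s" "s \<le> R / 2"
  note [measurable_cong] = sets_\<nu>
  let ?E = "\<integral>z. exp (s * - z) \<partial>\<nu>" and ?D = "(2 / R) ^ Suc k * (\<integral>z. exp (R * \<bar>- z\<bar>) \<partial>\<nu>)"
  have *: "\<bar>?E - (\<Sum>j<Suc k. s ^ j * (\<integral>z. (- z) ^ j \<partial>\<nu>) / fact j)\<bar> \<le> s ^ Suc k * ?D"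
    by (rule nu.mgf_taylor(2)[OF _ exp_claim_integrable R_pos s]) measurable
  have mom: "(\<integral>z. (- z) ^ j \<partial>\<nu>) = (-1) ^ j * claim_moment X j" for j
    unfolding claim_moment_eq by (subst power_minus) simp
  have "(\<Sum>j<Suc k. cumulant j / fact j * s ^ j) = c * s + lam * ((\<Sum>j<Suc k. s ^ j * (\<integral>z. (- z) ^ j \<partial>\<nu>) / fact j) - 1)"
  proof -
    have "{..<Suc k} = insert 0 (insert 1 {2..<Suc k})" using k by auto
    then have split: "(\<Sum>j<Suc k. f j) = f 0 + (f 1 + (\<Sum>j\<in>{2..<Suc k}. f j))" for f :: "nat \<Rightarrow> real" by simp
    have "(\<Sum>j\<in>{2..<Suc k}. cumulant j / fact j * s ^ j) = lam * (\<Sum>j\<in>{2..<Suc k}. s ^ j * (\<integral>z. (- z) ^ j \<partial>\<nu>) / fact j)"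
      unfolding sum_distrib_left by (intro sum.cong refl) (simp add: cumulant_def mom mult_ac)
    then show ?thesis unfolding split by (simp add: mom cumulant_def claim_moment_eq nu.prob_space algebra_simps)
  qed
  then have "kappa s - (\<Sum>j<Suc k. cumulant j / fact j * s ^ j) = lam * (?E - (\<Sum>j<Suc k. s ^ j * (\<integral>z. (- z) ^ j \<partial>\<nu>) / fact j))"
    unfolding kappa_def by (simp only: right_diff_distrib)
  then have "\<bar>kappa s - (\<Sum>j<Suc k. cumulant j / fact j * s ^ j)\<bar> = lam * \<bar>?E - (\<Sum>j<Suc k. s ^ j * (\<integral>z. (- z) ^ j \<partial>\<nu>) / fact j)\<bar>"
    using intensity_pos by (simp only: abs_mult abs_of_pos)
  also have "\<dots> \<le> lam * (s ^ Suc k * ?D)" using * intensity_pos by (intro mult_left_mono) auto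
  also have "\<dots> = (lam * ?D) * s ^ Suc k" by (simp add: mult_ac)
  finally show "\<bar>kappa s - (\<Sum>j<Suc k. cumulant j / fact j * s ^ j)\<bar> \<le> (lam * ?D) * s ^ Suc k" .
qed

lemma claim_total_nonneg: "AE \<omega> in sample X. 0 \<le> (\<Sum>i<arrivals X t \<omega>. claim X i \<omega>)"
  using AE_partial_sums_mono
proof eventually_elim
  case (elim \<omega>)
  then have "(\<Sum>i<0. claim X i \<omega>) \<le> (\<Sum>i<arrivals X t \<omega>. claim X i \<omega>)" by blast
  then show ?case by simp
qed

lemma exp_reserve_integrable: "integrable (sample X) (\<lambda>\<omega>. exp (R * \<bar>reserve X 0 1 \<omega>\<bar>))"
proof (rule integrableI_nonneg)
  have "(\<integral>\<^sup>+\<omega>. ennreal (exp (R * \<bar>reserve X 0 1 \<omega>\<bar>)) \<partial>sample X) \<le>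
     (\<integral>\<^sup>+\<omega>. ennreal (exp (R * c)) * ennreal (exp (R * (\<Sum>i<arrivals X 1 \<omega>. claim X i \<omega>))) \<partial>sample X)"
  proof (rule nn_integral_mono_AE, use claim_total_nonneg[of 1] in eventually_elim)
    fix \<omega> assume "0 \<le> (\<Sum>i<arrivals X 1 \<omega>. claim X i \<omega>)"
    then have "\<bar>reserve X 0 1 \<omega>\<bar> \<le> c + (\<Sum>i<arrivals X 1 \<omega>. claim X i \<omega>)"
      using premium_pos by (simp add: reserve_def)
    then have "R * \<bar>reserve X 0 1 \<omega>\<bar> \<le> R * (c + (\<Sum>i<arrivals X 1 \<omega>. claim X i \<omega>))"
      using R_pos by (intro mult_left_mono) auto
    then show "ennreal (exp (R * \<bar>reserve X 0 1 \<omega>\<bar>)) \<le> ennreal (exp (R * c)) * ennreal (exp (R * (\<Sum>i<arrivals X 1 \<omega>. claim X i \<omega>)))"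
      by (simp add: ennreal_mult[symmetric] exp_add[symmetric] distrib_left ennreal_leI)
  qed
  also have "\<dots> = ennreal (exp (R * c)) * ennreal (exp (lam * (mgfR - 1)))"
  proof -
    have m: "(\<lambda>\<omega>. ennreal (exp (R * (\<Sum>i<arrivals X 1 \<omega>. claim X i \<omega>)))) \<in> borel_measurable (sample X)"
    proof -
      have "(\<lambda>\<omega>. c * 1 - reserve X 0 1 \<omega>) \<in> borel_measurable (sample X)"
        by (intro borel_measurable_diff measurable_reserve) auto
      then have [measurable]: "(\<lambda>\<omega>. \<Sum>i<arrivals X 1 \<omega>. claim X i \<omega>) \<in> borel_measurable (sample X)"
        by (simp add: reserve_def)
      show ?thesis by measurable
    qed
    show ?thesis unfolding mgf_claim_total[OF mgfR mgfR_nonneg, symmetric] by (rule nn_integral_cmult[OF m])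
  qed
  also have "\<dots> < \<infinity>" by (simp add: ennreal_mult[symmetric])
  finally show "(\<integral>\<^sup>+\<omega>. ennreal (exp (R * \<bar>reserve X 0 1 \<omega>\<bar>)) \<partial>sample X) < \<infinity>" .
qed (use measurable_reserve[of 1 0] in auto)

lemma exp_kappa:
  assumes s: "0 < s" "s \<le> R / 2"
  shows "(\<integral>\<omega>. exp (s * reserve X 0 1 \<omega>) \<partial>sample X) = exp (kappa s)"
proof -
  note [measurable_cong] = sets_\<nu>
  let ?L = "\<integral>z. exp (s * - z) \<partial>\<nu>"
  have L: "(\<integral>\<^sup>+z. ennreal (exp (- s * z)) \<partial>\<nu>) = ennreal ?L"
    using nu.mgf_taylor(1)[OF _ exp_claim_integrable R_pos s]
    by (subst nn_integral_eq_integral[symmetric]) auto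
  have L0: "0 \<le> ?L" by (intro integral_nonneg_AE) auto
  have "(\<integral>\<^sup>+\<omega>. ennreal (exp (s * reserve X 0 1 \<omega>)) \<partial>sample X) =
     (\<integral>\<^sup>+\<omega>. ennreal (exp (c * s)) * ennreal (exp (- s * (\<Sum>i<arrivals X 1 \<omega>. claim X i \<omega>))) \<partial>sample X)"
    by (intro nn_integral_cong) (simp add: reserve_def ennreal_mult[symmetric] exp_add[symmetric] algebra_simps)
  also have "\<dots> = ennreal (exp (c * s)) * ennreal (exp (lam * (?L - 1)))"
  proof -
    have m: "(\<lambda>\<omega>. ennreal (exp (- s * (\<Sum>i<arrivals X 1 \<omega>. claim X i \<omega>)))) \<in> borel_measurable (sample X)"
    proof -
      have "(\<lambda>\<omega>. c * 1 - reserve X 0 1 \<omega>) \<in> borel_measurable (sample X)"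
        by (intro borel_measurable_diff measurable_reserve) auto
      then have [measurable]: "(\<lambda>\<omega>. \<Sum>i<arrivals X 1 \<omega>. claim X i \<omega>) \<in> borel_measurable (sample X)"
        by (simp add: reserve_def)
      show ?thesis by measurable
    qed
    show ?thesis unfolding mgf_claim_total[OF L L0, symmetric] by (rule nn_integral_cmult[OF m])
  qed
  also have "\<dots> = ennreal (exp (kappa s))"
    by (simp add: kappa_def ennreal_mult[symmetric] exp_add[symmetric])
  finally show ?thesis using measurable_reserve[of 1 0] by (subst integral_eq_nn_integral) auto
qed

text \<open>The coefficients of \<open>exp \<circ> kappa\<close> are the moments of the reserve, those of \<open>kappa\<close> the cumulants.\<close>

lemma exp_kappa_taylor:
  "\<exists>C. \<forall>s. 0 < s \<longrightarrow> s \<le> R / 2 \<longrightarrow> \<bar>exp (kappa s) - (\<Sum>j<Suc k. s ^ j * reserve_moment X 0 1 j / fact j)\<bar> \<le> C * s ^ Suc k"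
proof (intro exI allI impI)
  fix s :: real assume s: "0 < s" "s \<le> R / 2"
  show "\<bar>exp (kappa s) - (\<Sum>j<Suc k. s ^ j * reserve_moment X 0 1 j / fact j)\<bar> \<le>
     ((2 / R) ^ Suc k * (\<integral>\<omega>. exp (R * \<bar>reserve X 0 1 \<omega>\<bar>) \<partial>sample X)) * s ^ Suc k"
    using mgf_taylor(2)[OF _ exp_reserve_integrable R_pos s, of "Suc k"] measurable_reserve[of 1 0]
    unfolding exp_kappa[OF s] reserve_moment_def by (simp add: mult.commute)
qed

lemma kappa_ge: "0 < s \<Longrightarrow> - lam \<le> kappa s"
proof -
  assume s: "0 < s"
  have "0 \<le> (\<integral>z. exp (s * - z) \<partial>\<nu>)" by (intro integral_nonneg_AE) auto
  then have "0 \<le> lam * (\<integral>z. exp (s * - z) \<partial>\<nu>)" using intensity_pos by simp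
  moreover have "0 \<le> c * s" using s premium_pos by simp
  ultimately show ?thesis by (simp add: kappa_def right_diff_distrib)
qed

end

lemma exp_diff_lower:
  fixes x y :: real
  assumes "- l \<le> x" "- l \<le> y"
  shows "\<bar>x - y\<bar> \<le> exp l * \<bar>exp x - exp y\<bar>"
proof -
  have main: "x - y \<le> exp l * (exp x - exp y)" if "y \<le> x" "- l \<le> y" for x y :: real
  proof -
    have "x - y \<le> exp (x - y) - 1" using exp_ge_add_one_self[of "x - y"] by linarith
    then have "exp y * (x - y) \<le> exp y * (exp (x - y) - 1)" by (rule mult_left_mono) simp
    also have "\<dots> = exp x - exp y" by (simp add: right_diff_distrib exp_add[symmetric])
    finally have "exp l * (exp y * (x - y)) \<le> exp l * (exp x - exp y)" by (rule mult_left_mono) simp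
    moreover have "x - y \<le> exp l * (exp y * (x - y))"
    proof -
      have "1 * (x - y) \<le> (exp l * exp y) * (x - y)"
        using that by (intro mult_right_mono) (auto simp: exp_add[symmetric])
      then show ?thesis by simp
    qed
    ultimately show ?thesis by (rule order_trans[rotated])
  qed
  show ?thesis
  proof (cases "y \<le> x")
    case True
    then show ?thesis using main[of y x] assms by simp
  next
    case False
    then show ?thesis using main[of x y] assms by (simp add: abs_minus_commute[of x] abs_minus_commute[of "exp x"])
  qed
qed

text \<open>Equality of the moments up to order \<open>k\<close> makes the generating functions \<open>exp \<circ> kappa\<close> agree up to
\<open>O(s ^ Suc k)\<close> as \<open>s\<close> decreases to \<open>0\<close>. Both functions \<open>kappa\<close> are bounded below, so the same holds for
their logarithms, and then the coefficients up to order \<open>k\<close> agree.\<close>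

lemma cumulants_match:
  assumes "adjusted_model X k R H B" "adjusted_model Y k R' H' B'"
    and mom: "\<And>j. j \<in> {1..k} \<Longrightarrow> reserve_moment X 0 1 j = reserve_moment Y 0 1 j"
    and j: "j \<le> k"
  shows "adjusted_model.cumulant X j = adjusted_model.cumulant Y j"
proof -
  interpret X: adjusted_model X k R H B by fact
  interpret Y: adjusted_model Y k R' H' B' by fact
  obtain C1 where C1: "\<And>s. 0 < s \<Longrightarrow> s \<le> R / 2 \<Longrightarrow> \<bar>X.kappa s - (\<Sum>j<Suc k. X.cumulant j / fact j * s ^ j)\<bar> \<le> C1 * s ^ Suc k"
    using X.kappa_taylor by blast
  obtain C2 where C2: "\<And>s. 0 < s \<Longrightarrow> s \<le> R' / 2 \<Longrightarrow> \<bar>Y.kappa s - (\<Sum>j<Suc k. Y.cumulant j / fact j * s ^ j)\<bar> \<le> C2 * s ^ Suc k"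
    using Y.kappa_taylor by blast
  obtain C3 where C3: "\<And>s. 0 < s \<Longrightarrow> s \<le> R / 2 \<Longrightarrow> \<bar>exp (X.kappa s) - (\<Sum>j<Suc k. s ^ j * reserve_moment X 0 1 j / fact j)\<bar> \<le> C3 * s ^ Suc k"
    using X.exp_kappa_taylor by blast
  obtain C4 where C4: "\<And>s. 0 < s \<Longrightarrow> s \<le> R' / 2 \<Longrightarrow> \<bar>exp (Y.kappa s) - (\<Sum>j<Suc k. s ^ j * reserve_moment Y 0 1 j / fact j)\<bar> \<le> C4 * s ^ Suc k"
    using Y.exp_kappa_taylor by blast
  define l where "l = max X.lam Y.lam"
  have same: "(\<Sum>j<Suc k. s ^ j * reserve_moment X 0 1 j / fact j) = (\<Sum>j<Suc k. s ^ j * reserve_moment Y 0 1 j / fact j)" for s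
  proof (rule sum.cong[OF refl])
    fix i assume "i \<in> {..<Suc k}"
    then show "s ^ i * reserve_moment X 0 1 i / fact i = s ^ i * reserve_moment Y 0 1 i / fact i"
      using mom[of i] by (cases "i = 0") (auto simp: reserve_moment_def X.prob_space Y.prob_space)
  qed
  have "(X.cumulant j - Y.cumulant j) / fact j = 0"
  proof (rule polynomial_coeffs_zero[where a = "\<lambda>j. (X.cumulant j - Y.cumulant j) / fact j" and n = "Suc k" and \<delta> = "min (R / 2) (R' / 2)" and C = "C1 + C2 + exp l * (C3 + C4)"])
    show "0 < min (R / 2) (R' / 2)" using X.R_pos Y.R_pos by simp
    show "j < Suc k" using j by simp
    fix s :: real assume s: "0 < s" "s \<le> min (R / 2) (R' / 2)"
    then have sx: "s \<le> R / 2" and sy: "s \<le> R' / 2" by auto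
    have "\<bar>exp (X.kappa s) - exp (Y.kappa s)\<bar> \<le> C3 * s ^ Suc k + C4 * s ^ Suc k"
      using C3[OF s(1) sx] C4[OF s(1) sy] unfolding same by linarith
    then have "exp l * \<bar>exp (X.kappa s) - exp (Y.kappa s)\<bar> \<le> exp l * (C3 * s ^ Suc k + C4 * s ^ Suc k)"
      by (intro mult_left_mono) auto
    moreover have "\<bar>X.kappa s - Y.kappa s\<bar> \<le> exp l * \<bar>exp (X.kappa s) - exp (Y.kappa s)\<bar>"
      using X.kappa_ge[OF s(1)] Y.kappa_ge[OF s(1)] by (intro exp_diff_lower) (auto simp: l_def)
    ultimately have "\<bar>X.kappa s - Y.kappa s\<bar> \<le> exp l * (C3 * s ^ Suc k + C4 * s ^ Suc k)" by linarith
    then have "\<bar>(\<Sum>j<Suc k. X.cumulant j / fact j * s ^ j) - (\<Sum>j<Suc k. Y.cumulant j / fact j * s ^ j)\<bar> \<le>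
      C1 * s ^ Suc k + C2 * s ^ Suc k + exp l * (C3 * s ^ Suc k + C4 * s ^ Suc k)"
      using C1[OF s(1) sx] C2[OF s(1) sy] by linarith
    moreover have "(\<Sum>j<Suc k. (X.cumulant j - Y.cumulant j) / fact j * s ^ j) =
      (\<Sum>j<Suc k. X.cumulant j / fact j * s ^ j) - (\<Sum>j<Suc k. Y.cumulant j / fact j * s ^ j)"
      unfolding sum_subtractf[symmetric] by (intro sum.cong refl) (simp add: diff_divide_distrib left_diff_distrib)
    ultimately show "\<bar>\<Sum>j<Suc k. (X.cumulant j - Y.cumulant j) / fact j * s ^ j\<bar> \<le> (C1 + C2 + exp l * (C3 + C4)) * s ^ Suc k"
      by (simp add: distrib_right distrib_left mult.assoc del: sum.lessThan_Suc power_Suc)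
  qed
  then show ?thesis by simp
qed

section \<open>Comparison of the two models\<close>

text \<open>The difference is split at the two pure exponentials, whose difference is at most \<open>\<bar>r - r'\<bar> * u\<close> times the
larger one.\<close>

lemma exp_decay_difference:
  fixes K K' r r' u e :: real
  assumes K: "\<bar>K - 1\<bar> \<le> e" "\<bar>K' - 1\<bar> \<le> e" and u: "0 \<le> u"
  shows "\<bar>K * exp (- r * u) - K' * exp (- r' * u)\<bar> \<le> (2 * e + \<bar>r - r'\<bar> * u) * exp (- (min r r' * u))"
proof -
  let ?m = "exp (- (min r r' * u))"
  have e: "0 \<le> e" using K(1) by linarith
  have le: "exp (- r * u) \<le> ?m" "exp (- r' * u) \<le> ?m"
    using u by (auto intro!: mult_right_mono)
  have diff: "\<bar>exp (- x * u) - exp (- y * u)\<bar> \<le> (y - x) * u * exp (- (x * u))" if "x \<le> y" for x y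
  proof -
    have "1 + (- ((y - x) * u)) \<le> exp (- ((y - x) * u))" by (rule exp_ge_add_one_self)
    then have "exp (- (x * u)) * (1 - exp (- ((y - x) * u))) \<le> exp (- (x * u)) * ((y - x) * u)"
      by (intro mult_left_mono) auto
    also have "exp (- (x * u)) * (1 - exp (- ((y - x) * u))) = exp (- (x * u)) - exp (- (y * u))"
      by (simp add: right_diff_distrib exp_add[symmetric] algebra_simps)
    finally have "exp (- (x * u)) - exp (- (y * u)) \<le> (y - x) * u * exp (- (x * u))" by (simp add: mult_ac)
    moreover have "exp (- (y * u)) \<le> exp (- (x * u))" using that u by (simp add: mult_right_mono)
    ultimately show ?thesis by simp
  qed
  have mid: "\<bar>exp (- r * u) - exp (- r' * u)\<bar> \<le> \<bar>r - r'\<bar> * u * ?m"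
  proof (cases "r \<le> r'")
    case True
    then show ?thesis using diff[OF True] by (simp add: min_def)
  next
    case False
    then show ?thesis using diff[of r' r] by (simp add: min_def abs_minus_commute)
  qed
  have "K * exp (- r * u) - K' * exp (- r' * u) =
      (K - 1) * exp (- r * u) + (exp (- r * u) - exp (- r' * u)) + (1 - K') * exp (- r' * u)"
    by (simp add: algebra_simps)
  also have "\<bar>\<dots>\<bar> \<le> \<bar>K - 1\<bar> * exp (- r * u) + \<bar>exp (- r * u) - exp (- r' * u)\<bar> + \<bar>1 - K'\<bar> * exp (- r' * u)"
    by (rule order_trans[OF abs_triangle_ineq]) (intro add_mono order_trans[OF abs_triangle_ineq], auto simp: abs_mult)
  also have "\<dots> \<le> e * ?m + \<bar>r - r'\<bar> * u * ?m + e * ?m"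
    using K e by (intro add_mono mult_mono mid le) (auto simp: abs_minus_commute)
  also have "\<dots> = (2 * e + \<bar>r - r'\<bar> * u) * ?m" by (simp add: algebra_simps)
  finally show ?thesis .
qed

text \<open>The polynomial \<open>P\<close> has nonnegative coefficients and linear coefficient \<open>a 2 / 2\<close>, so on \<open>{0..}\<close> its slope is at
least \<open>a 2 / 2\<close>: approximate roots for the same right-hand side are close to each other.\<close>

lemma truncated_equation_roots:
  fixes a :: "nat \<Rightarrow> real" and r r' \<mu> D :: real and k :: nat
  defines "P \<equiv> \<lambda>x. \<Sum>j=1..<k. x ^ j * a (Suc j) / fact (Suc j)"
  assumes k: "2 \<le> k" and a: "\<And>j. 2 \<le> j \<Longrightarrow> j \<le> k \<Longrightarrow> 0 < a j" and D: "0 \<le> D"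
    and r: "0 \<le> r" "P r \<le> \<mu>" "\<mu> - P r \<le> D * r ^ k"
    and r': "0 \<le> r'" "P r' \<le> \<mu>" "\<mu> - P r' \<le> D * r' ^ k"
  shows "r \<le> 2 * \<mu> / a 2" and "\<bar>r - r'\<bar> \<le> 2 / a 2 * D * (2 * \<mu> / a 2) ^ k"
proof -
  have a2: "0 < a 2" using a k by simp
  define Q where "Q x = (\<Sum>j=2..<k. x ^ j * a (Suc j) / fact (Suc j))" for x
  have P: "P x = x * a 2 / 2 + Q x" for x
  proof -
    have "{1..<k} = insert 1 {2..<k}" using k by auto
    then show ?thesis by (simp add: P_def Q_def numeral_2_eq_2)
  qed
  have Qmono: "Q x \<le> Q y" if "0 \<le> x" "x \<le> y" for x y
    unfolding Q_def using that a by (intro sum_mono divide_right_mono mult_right_mono power_mono) (auto simp: less_imp_le)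
  have Q0: "Q 0 = 0" unfolding Q_def by (intro sum.neutral) auto
  have bound: "x \<le> 2 * \<mu> / a 2" if "0 \<le> x" "P x \<le> \<mu>" for x
    using that Qmono[of 0 x] a2 by (simp add: P Q0 field_simps)
  show rb: "r \<le> 2 * \<mu> / a 2" by (rule bound[OF r(1,2)])
  have rb': "r' \<le> 2 * \<mu> / a 2" by (rule bound[OF r'(1,2)])
  have main: "x - y \<le> 2 / a 2 * D * (2 * \<mu> / a 2) ^ k"
    if "0 \<le> y" "y \<le> x" "P x \<le> \<mu>" "\<mu> - P y \<le> D * y ^ k" "y \<le> 2 * \<mu> / a 2" for x y
  proof -
    have "(x - y) * a 2 / 2 \<le> P x - P y" using Qmono[OF that(1,2)] by (simp add: P left_diff_distrib diff_divide_distrib)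
    also have "\<dots> \<le> D * y ^ k" using that by linarith
    also have "\<dots> \<le> D * (2 * \<mu> / a 2) ^ k" using that D by (intro mult_left_mono power_mono) auto
    finally show ?thesis using a2 by (simp add: field_simps)
  qed
  show "\<bar>r - r'\<bar> \<le> 2 / a 2 * D * (2 * \<mu> / a 2) ^ k"
  proof (cases "r' \<le> r")
    case True
    then show ?thesis using main[of r' r] r r' rb' by simp
  next
    case False
    then show ?thesis using main[of r r'] r r' rb by simp
  qed
qed

context adjusted_model
begin

text \<open>The constants \<open>Cm\<close> and \<open>Rm\<close> bound the premium and the adjustment coefficient over a family of models, so that
the factor \<open>exp (R * c)\<close> from the shift by one premium is \<open>1 + O(R)\<close> uniformly.\<close>

lemma ruin_prob_near_exp:
  assumes c: "c \<le> Cm" and r: "R \<le> Rm" and u: "0 \<le> u"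
  shows "\<bar>exp (R * u) * ruin_prob X u - 1\<bar> \<le> R * (Cm * exp (Rm * Cm) + (1 + B) * (1 + H))"
proof -
  have Cm: "0 < Cm" using c premium_pos by linarith
  have Rc: "R * c \<le> R * Cm" "R * Cm \<le> Rm * Cm" "0 \<le> R * c"
    using c r R_pos Cm premium_pos by (auto intro: mult_left_mono mult_right_mono)
  have BH: "0 \<le> (1 + B) * (1 + H)" using B_nonneg H_nonneg by simp
  have "exp (R * c) * (1 - R * c) \<le> exp (R * c) * exp (- (R * c))"
    using exp_ge_add_one_self[of "- (R * c)"] by (intro mult_left_mono) auto
  then have "exp (R * c) - 1 \<le> R * c * exp (R * c)" by (simp add: exp_add[symmetric] algebra_simps)
  also have "\<dots> \<le> (R * Cm) * exp (Rm * Cm)"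
    by (rule mult_mono) (use Rc in auto)
  finally have up: "exp (R * c) - 1 \<le> R * (Cm * exp (Rm * Cm))" by (simp add: mult_ac)
  have Kc: "1 - R * ((1 + B) * (1 + H)) \<le> K (u + c)" "K (u + c) \<le> 1"
    using K_near_1[of "u + c"] K_01 u premium_pos by auto
  have "1 - R * c \<le> exp (- R * c)" using exp_ge_add_one_self[of "- (R * c)"] by simp
  moreover have "exp (- R * c) * (1 - K (u + c)) \<le> 1 * (1 - K (u + c))"
    using Rc Kc by (intro mult_right_mono) auto
  ultimately have "1 - exp (- R * c) * K (u + c) \<le> R * c + R * ((1 + B) * (1 + H))"
    using Kc by (simp add: right_diff_distrib)
  moreover have "R * c \<le> R * (Cm * exp (Rm * Cm))"
  proof -
    have "R * Cm * 1 \<le> R * Cm * exp (Rm * Cm)" using Rc R_pos Cm by (intro mult_left_mono) auto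
    then show ?thesis using Rc by (simp add: mult_ac)
  qed
  ultimately have lo: "1 - exp (- R * c) * K (u + c) \<le> R * (Cm * exp (Rm * Cm)) + R * ((1 + B) * (1 + H))"
    by linarith
  have "0 \<le> R * ((1 + B) * (1 + H))" using R_pos BH by simp
  then show ?thesis
    using up lo ruin_prob_lower[OF u] ruin_prob_upper[of u] unfolding distrib_left by linarith
qed

text \<open>The left-hand side depends on the model only through the intensity and the claim law, which do not vary with
\<open>\<theta>\<close>.\<close>

lemma ruin_prob_bounded_below:
  assumes c: "c \<le> Cm" and r: "R \<le> Rm" and u: "0 \<le> u"
  shows "exp (- (Rm * Cm)) * (lam / Cm * mean_excess (2 * ((1 + B) * (1 + H))) / 2) \<le> exp (R * u) * ruin_prob X u"
proof -
  have Cm: "0 < Cm" using c premium_pos by linarith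
  have Rc: "R * c \<le> Rm * Cm"
    using c r R_pos premium_pos by (intro mult_mono) auto
  have A: "0 \<le> 2 * ((1 + B) * (1 + H))" using B_nonneg H_nonneg by simp
  have "lam / Cm \<le> q" unfolding q_def using c premium_pos intensity_pos by (intro divide_left_mono) auto
  then have "lam / Cm * mean_excess (2 * ((1 + B) * (1 + H))) / 2 \<le> q * mean_excess (2 * ((1 + B) * (1 + H))) / 2"
    using mean_excess_pos[OF A] by (intro divide_right_mono mult_right_mono) auto
  also have "\<dots> \<le> K (u + c)" using K_uniformly_positive[of "u + c"] u premium_pos by simp
  finally have "exp (- (Rm * Cm)) * (lam / Cm * mean_excess (2 * ((1 + B) * (1 + H))) / 2) \<le> exp (- R * c) * K (u + c)"
    using Rc mean_excess_pos[OF A] intensity_pos Cm by (intro mult_mono) auto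
  also note ruin_prob_lower[OF u]
  finally show ?thesis .
qed

end

lemma adjusted_modelI:
  assumes "compound_poisson_model X" "model_assumptions k X" "2 \<le> k"
    and "exp_moment X k \<le> ennreal B" "0 \<le> B" "h_I X \<le> ennreal H" "0 \<le> H"
  shows "adjusted_model X k (adjustment_coeff X) H B"
proof -
  have cp: "compound_poisson X" using assms(1) by (rule compound_poisson.intro)
  obtain r where r: "is_adjustment_coeff X r" using assms(2) by (auto simp: model_assumptions_def)
  then have "is_adjustment_coeff X (adjustment_coeff X)"
    unfolding adjustment_coeff_def using adjustment_coeff_unique[OF cp] by (metis the_equality)
  then show ?thesis
    using assms cp unfolding exp_moment_def by (intro adjusted_model.intro adjusted_model_axioms.intro) auto
qed

lemma le_enn2real_SUP:
  fixes f :: "'i \<Rightarrow> ennreal"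
  assumes "(SUP i\<in>I. f i) < \<infinity>" "i \<in> I" "enn2real (SUP i\<in>I. f i) \<le> b"
  shows "f i \<le> ennreal b"
proof -
  have "f i \<le> (SUP i\<in>I. f i)" using assms(2) by (rule SUP_upper)
  also have "\<dots> = ennreal (enn2real (SUP i\<in>I. f i))" using assms(1) by simp
  also have "\<dots> \<le> ennreal b" using assms(3) by (rule ennreal_leI)
  finally show ?thesis .
qed

lemma claim_moment_cong_cdf:
  assumes "compound_poisson X" "compound_poisson Y" "claim_cdf X = claim_cdf Y"
  shows "claim_moment X j = claim_moment Y j"
proof -
  interpret X: compound_poisson X by fact
  interpret Y: compound_poisson Y by fact
  have "X.\<nu> = Y.\<nu>"
  proof (rule cdf_unique)
    show "real_distribution X.\<nu>" "real_distribution Y.\<nu>"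
      using X.prob_space_\<nu> Y.prob_space_\<nu>
      by (auto simp: real_distribution_def real_distribution_axioms_def X.sets_\<nu> Y.sets_\<nu>)
    show "cdf X.\<nu> = cdf Y.\<nu>" using assms(3) by (simp add: claim_cdf_def X.\<nu>_def Y.\<nu>_def)
  qed
  then show ?thesis by (simp add: X.claim_moment_eq Y.claim_moment_eq)
qed

theorem theorem1:
  fixes X :: "real \<Rightarrow> 'a reserve_model" and Y :: "real \<Rightarrow> 'b reserve_model"
    and I :: "real set" and k :: nat
    and lam :: real and F :: "real \<Rightarrow> real" and mDV :: "nat \<Rightarrow> real"
  assumes k: "k \<ge> 2"
    and interval: "is_interval I" "bounded I" "I \<subseteq> {0<..}"
    and model: "\<And>\<theta>. \<theta> \<in> I \<Longrightarrow> compound_poisson_model (X \<theta>)"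
    and intensity_fixed: "\<And>\<theta>. \<theta> \<in> I \<Longrightarrow> intensity (X \<theta>) = lam"
    and cdf_fixed: "\<And>\<theta>. \<theta> \<in> I \<Longrightarrow> claim_cdf (X \<theta>) = F"
    and premium: "\<And>\<theta>. \<theta> \<in> I \<Longrightarrow> premium (X \<theta>) = (1 + \<theta>) * lam * claim_moment (X \<theta>) 1"
    and de_vylder: "\<And>\<theta>. \<theta> \<in> I \<Longrightarrow> de_vylder_model k (X \<theta>) (Y \<theta>)"
    and DV_moments_fixed: "\<And>\<theta> j. \<theta> \<in> I \<Longrightarrow> j \<in> {1..k} \<Longrightarrow> claim_moment (Y \<theta>) j = mDV j"
    and assumptions_X: "\<And>\<theta>. \<theta> \<in> I \<Longrightarrow> model_assumptions k (X \<theta>)"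
    and assumptions_Y: "\<And>\<theta>. \<theta> \<in> I \<Longrightarrow> model_assumptions k (Y \<theta>)"
    and bounded_X: "(SUP \<theta>\<in>I. exp_moment (X \<theta>) k) < \<infinity>" "(SUP \<theta>\<in>I. h_I (X \<theta>)) < \<infinity>"
    and bounded_Y: "(SUP \<theta>\<in>I. exp_moment (Y \<theta>) k) < \<infinity>" "(SUP \<theta>\<in>I. h_I (Y \<theta>)) < \<infinity>"
  shows
    "(\<exists>a. unif_bigo I a (\<lambda>u \<theta>. \<theta> + \<theta> ^ k * u) \<and>
        (\<forall>u\<ge>0. \<forall>\<theta>\<in>I. ruin_prob (X \<theta>) u - ruin_prob (Y \<theta>) u =
           a u \<theta> * exp (- (min (adjustment_coeff (X \<theta>)) (adjustment_coeff (Y \<theta>)) * u)))) \<and>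
     (\<exists>a b. unif_bigo I a (\<lambda>u \<theta>. \<theta> + \<theta> ^ k * u) \<and> unif_bigo I b (\<lambda>u \<theta>. \<theta> ^ 2) \<and>
        (\<forall>u\<ge>0. \<forall>\<theta>\<in>I. ruin_prob (X \<theta>) u - ruin_prob (Y \<theta>) u =
           a u \<theta> * exp (- (\<bar>2 * claim_moment (X \<theta>) 1 / claim_moment (X \<theta>) 2 * \<theta> + b u \<theta>\<bar> * u)))) \<and>
     (\<exists>a b. unif_bigo I a (\<lambda>u \<theta>. \<theta> + \<theta> ^ k * u) \<and> unif_bigo I b (\<lambda>u \<theta>. \<theta> ^ k * u) \<and>
        (\<forall>u\<ge>0. \<forall>\<theta>\<in>I. (ruin_prob (X \<theta>) u - ruin_prob (Y \<theta>) u) / ruin_prob (X \<theta>) u =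
           a u \<theta> * exp (b u \<theta> *
             (if adjustment_coeff (X \<theta>) > adjustment_coeff (Y \<theta>) then 1 else 0))))"
proof (cases "I = {}")
  case True
  then show ?thesis by (simp add: unif_bigo_def) (auto intro: exI[of _ "0::real"])
next
  case False
  then obtain \<theta>0 where \<theta>0: "\<theta>0 \<in> I" by auto
  obtain \<Theta> where \<Theta>: "\<And>\<theta>. \<theta> \<in> I \<Longrightarrow> \<theta> \<le> \<Theta>"
    using interval(2) unfolding bounded_real by (auto simp: abs_le_iff)
  have \<theta>_pos: "0 < \<theta>" if "\<theta> \<in> I" for \<theta> using interval(3) that by auto
  define H where "H = max (enn2real (SUP \<theta>\<in>I. h_I (X \<theta>))) (enn2real (SUP \<theta>\<in>I. h_I (Y \<theta>)))"
  define B where "B = max (enn2real (SUP \<theta>\<in>I. exp_moment (X \<theta>) k)) (enn2real (SUP \<theta>\<in>I. exp_moment (Y \<theta>) k))"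
  have HB: "0 \<le> H" "0 \<le> B" by (simp_all add: H_def B_def max.coboundedI1)
  define RX where "RX \<theta> = adjustment_coeff (X \<theta>)" for \<theta>
  define RY where "RY \<theta> = adjustment_coeff (Y \<theta>)" for \<theta>
  have Ymodel: "compound_poisson_model (Y \<theta>)" if "\<theta> \<in> I" for \<theta>
    using de_vylder[OF that] by (simp add: de_vylder_model_def)
  have AX: "adjusted_model (X \<theta>) k (RX \<theta>) H B" if t: "\<theta> \<in> I" for \<theta>
    unfolding RX_def
    by (rule adjusted_modelI[OF model[OF t] assumptions_X[OF t] k le_enn2real_SUP[OF bounded_X(1) t] HB(2) le_enn2real_SUP[OF bounded_X(2) t] HB(1)])
       (simp_all add: H_def B_def)
  have AY: "adjusted_model (Y \<theta>) k (RY \<theta>) H B" if t: "\<theta> \<in> I" for \<theta>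
    unfolding RY_def
    by (rule adjusted_modelI[OF Ymodel[OF t] assumptions_Y[OF t] k le_enn2real_SUP[OF bounded_Y(1) t] HB(2) le_enn2real_SUP[OF bounded_Y(2) t] HB(1)])
       (simp_all add: H_def B_def)
  define m where "m = claim_moment (X \<theta>0)"
  have mX: "claim_moment (X \<theta>) j = m j" if "\<theta> \<in> I" for \<theta> j
    unfolding m_def using that \<theta>0 model cdf_fixed by (intro claim_moment_cong_cdf compound_poisson.intro) auto
  have m_pos: "0 < m j" if "1 \<le> j" "j \<le> k" for j
    unfolding m_def by (rule adjusted_model.claim_moment_pos[OF AX[OF \<theta>0] that])
  have mDV_pos: "0 < mDV j" if "1 \<le> j" "j \<le> k" for j
    using adjusted_model.claim_moment_pos[OF AY[OF \<theta>0] that] DV_moments_fixed[OF \<theta>0, of j] that by simp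
  have lam: "0 < lam"
    using model[OF \<theta>0] intensity_fixed[OF \<theta>0] by (simp add: compound_poisson_model_def)
  have cumX: "adjusted_model.cumulant (X \<theta>) j = (if j = 0 then 0 else if j = 1 then \<theta> * lam * m 1 else (-1) ^ j * (lam * m j))" if t: "\<theta> \<in> I" for \<theta> j
    unfolding adjusted_model.cumulant_def[OF AX[OF t]] mX[OF t] intensity_fixed[OF t] premium[OF t]
    by (simp add: algebra_simps)
  have match: "adjusted_model.cumulant (X \<theta>) j = adjusted_model.cumulant (Y \<theta>) j" if t: "\<theta> \<in> I" and "j \<le> k" for \<theta> j
  proof (rule cumulants_match[OF AX[OF t] AY[OF t] _ \<open>j \<le> k\<close>])
    show "reserve_moment (X \<theta>) 0 1 i = reserve_moment (Y \<theta>) 0 1 i" if "i \<in> {1..k}" for i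
      using de_vylder[OF t] that by (simp add: de_vylder_model_def)
  qed
  have drift: "premium (Y \<theta>) - intensity (Y \<theta>) * mDV 1 = \<theta> * lam * m 1" if t: "\<theta> \<in> I" for \<theta>
    using match[OF t, of 1] k cumX[OF t, of 1] DV_moments_fixed[OF t, of 1]
    by (simp add: adjusted_model.cumulant_def[OF AY[OF t]])
  have lamY_m: "intensity (Y \<theta>) * mDV j = lam * m j" if t: "\<theta> \<in> I" and j: "2 \<le> j" "j \<le> k" for \<theta> j
    using match[OF t j(2)] cumX[OF t, of j] DV_moments_fixed[OF t, of j] j
    by (simp add: adjusted_model.cumulant_def[OF AY[OF t]])
  define lamY where "lamY = lam * m 2 / mDV 2"
  \<comment> \<open>Equality of second cumulants fixes the intensity of the approximating model.\<close>
  have lamY: "intensity (Y \<theta>) = lamY" if "\<theta> \<in> I" for \<theta>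
    using lamY_m[OF that, of 2] k mDV_pos[of 2] by (simp add: lamY_def field_simps)
  have lamY_pos: "0 < lamY" using lam m_pos[of 2] mDV_pos[of 2] k by (simp add: lamY_def)
  define Cm where "Cm = (1 + \<Theta>) * lam * m 1 + lamY * mDV 1"
  have m1: "0 < m 1" "0 < mDV 1" "0 < m 2" using m_pos mDV_pos k by auto
  have cX: "premium (X \<theta>) \<le> Cm" and cY: "premium (Y \<theta>) \<le> Cm" if t: "\<theta> \<in> I" for \<theta>
  proof -
    have "\<theta> * (lam * m 1) \<le> \<Theta> * (lam * m 1)" using \<Theta>[OF t] lam m1 by (intro mult_right_mono) auto
    moreover have "0 < lam * m 1" "0 < lamY * mDV 1" using lam m1 lamY_pos by auto
    ultimately show "premium (X \<theta>) \<le> Cm" "premium (Y \<theta>) \<le> Cm"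
      using drift[OF t] unfolding lamY[OF t] premium[OF t] mX[OF t] Cm_def
      by (auto simp: distrib_right mult.assoc)
  qed
  have Cm: "0 < Cm" using cX[OF \<theta>0] model[OF \<theta>0] by (simp add: compound_poisson_model_def)
  define a where "a j = lam * m j" for j
  define D where "D = Cm * (1 + B)"
  define \<rho> where "\<rho> = 2 * m 1 / m 2"
  have \<rho>: "0 < \<rho>" using m1 by (simp add: \<rho>_def)
  have D: "0 \<le> D" using Cm HB by (simp add: D_def)
  have a_pos: "0 < a j" if "2 \<le> j" "j \<le> k" for j using that lam m_pos by (simp add: a_def)
  have R_pos: "0 < RX \<theta>" "0 < RY \<theta>" if "\<theta> \<in> I" for \<theta>
    using adjusted_model.R_pos[OF AX[OF that]] adjusted_model.R_pos[OF AY[OF that]] .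
  \<comment> \<open>By equality of cumulants the truncated equations of the two models have the same left-hand side \<open>P k\<close>; its linear
part \<open>P 2\<close> yields the expansion of the coefficients up to \<open>O(\<theta>^2)\<close>.\<close>
  define P where "P n x = (\<Sum>j=1..<n. x ^ j * a (Suc j) / fact (Suc j))" for n and x :: real
  have taylor: "P n (RX \<theta>) \<le> \<theta> * lam * m 1" "\<theta> * lam * m 1 - P n (RX \<theta>) \<le> D * RX \<theta> ^ n"
    "P n (RY \<theta>) \<le> \<theta> * lam * m 1" "\<theta> * lam * m 1 - P n (RY \<theta>) \<le> D * RY \<theta> ^ n" if t: "\<theta> \<in> I" and n: "1 \<le> n" "n \<le> k" for n \<theta>
  proof -
    have dX: "premium (X \<theta>) - intensity (X \<theta>) * claim_moment (X \<theta>) 1 = \<theta> * lam * m 1"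
      unfolding mX[OF t] intensity_fixed[OF t] premium[OF t] by (simp add: algebra_simps)
    have dY: "premium (Y \<theta>) - intensity (Y \<theta>) * claim_moment (Y \<theta>) 1 = \<theta> * lam * m 1"
      using drift[OF t] DV_moments_fixed[OF t, of 1] k by simp
    have PX: "(\<Sum>j=1..<n. x ^ j * (intensity (X \<theta>) * claim_moment (X \<theta>) (Suc j)) / fact (Suc j)) = P n x" for x
      unfolding P_def a_def mX[OF t] intensity_fixed[OF t] ..
    have PY: "(\<Sum>j=1..<n. x ^ j * (intensity (Y \<theta>) * claim_moment (Y \<theta>) (Suc j)) / fact (Suc j)) = P n x" for x
      unfolding P_def a_def
    proof (rule sum.cong[OF refl])
      fix j assume j: "j \<in> {1..<n}"
      then have "intensity (Y \<theta>) * claim_moment (Y \<theta>) (Suc j) = lam * m (Suc j)"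
        using lamY_m[OF t, of "Suc j"] DV_moments_fixed[OF t, of "Suc j"] n by simp
      then show "x ^ j * (intensity (Y \<theta>) * claim_moment (Y \<theta>) (Suc j)) / fact (Suc j) = x ^ j * (lam * m (Suc j)) / fact (Suc j)" by simp
    qed
    have DX: "premium (X \<theta>) * (1 + B) * RX \<theta> ^ n \<le> D * RX \<theta> ^ n" "premium (Y \<theta>) * (1 + B) * RY \<theta> ^ n \<le> D * RY \<theta> ^ n"
      unfolding D_def using cX[OF t] cY[OF t] HB R_pos[OF t] by (auto intro!: mult_right_mono)
    show "P n (RX \<theta>) \<le> \<theta> * lam * m 1" "\<theta> * lam * m 1 - P n (RX \<theta>) \<le> D * RX \<theta> ^ n"
      using adjusted_model.adjustment_taylor[OF AX[OF t] n] DX unfolding dX PX by auto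
    show "P n (RY \<theta>) \<le> \<theta> * lam * m 1" "\<theta> * lam * m 1 - P n (RY \<theta>) \<le> D * RY \<theta> ^ n"
      using adjusted_model.adjustment_taylor[OF AY[OF t] n] DX unfolding dY PY by auto
  qed
  have \<mu>: "2 * (\<theta> * lam * m 1) / a 2 = \<rho> * \<theta>" for \<theta> using lam m1 by (simp add: a_def \<rho>_def)
  define E1 where "E1 = 2 / a 2 * D * \<rho> ^ k"
  define E2 where "E2 = 2 / a 2 * D * \<rho>\<^sup>2"
  have E: "0 \<le> E1" "0 \<le> E2" using a_pos[of 2] k D \<rho> by (auto simp: E1_def E2_def intro!: mult_nonneg_nonneg)
  have roots: "RX \<theta> \<le> \<rho> * \<theta>" "RY \<theta> \<le> \<rho> * \<theta>" "\<bar>RX \<theta> - RY \<theta>\<bar> \<le> E1 * \<theta> ^ k" if t: "\<theta> \<in> I" for \<theta>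
  proof -
    have kk: "1 \<le> k" "k \<le> k" using k by auto
    note T = taylor[OF t kk, unfolded P_def]
    note RXp = less_imp_le[OF R_pos(1)[OF t]] and RYp = less_imp_le[OF R_pos(2)[OF t]]
    show "RX \<theta> \<le> \<rho> * \<theta>"
      using truncated_equation_roots(1)[OF k a_pos D RXp T(1,2) RYp T(3,4)] unfolding \<mu> by simp
    show "RY \<theta> \<le> \<rho> * \<theta>"
      using truncated_equation_roots(1)[OF k a_pos D RYp T(3,4) RXp T(1,2)] unfolding \<mu> by simp
    show "\<bar>RX \<theta> - RY \<theta>\<bar> \<le> E1 * \<theta> ^ k"
      using truncated_equation_roots(2)[OF k a_pos D RXp T(1,2) RYp T(3,4)] unfolding \<mu>
      by (simp add: E1_def power_mult_distrib mult.assoc)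
  qed
  have second: "\<bar>r - \<rho> * \<theta>\<bar> \<le> E2 * \<theta>\<^sup>2"
    if t: "\<theta> \<in> I" and r: "r = RX \<theta> \<or> r = RY \<theta>" for r \<theta>
  proof -
    have "P 2 r \<le> \<theta> * lam * m 1" "\<theta> * lam * m 1 - P 2 r \<le> D * r ^ 2" and rb: "0 \<le> r" "r \<le> \<rho> * \<theta>"
      using taylor[OF t, of 2] k r roots[OF t] R_pos[OF t] by auto
    moreover have "P 2 r = r * a 2 / 2" by (simp add: P_def numeral_2_eq_2)
    moreover have "D * r ^ 2 \<le> D * (\<rho> * \<theta>) ^ 2" using rb D by (intro mult_left_mono power_mono) auto
    ultimately have "\<theta> * lam * m 1 - r * a 2 / 2 \<le> D * (\<rho> * \<theta>) ^ 2" by linarith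
    then have "2 / a 2 * (\<theta> * lam * m 1 - r * a 2 / 2) \<le> 2 / a 2 * (D * (\<rho> * \<theta>) ^ 2)"
      using a_pos[of 2] k by (intro mult_left_mono) auto
    moreover have "2 / a 2 * (\<theta> * lam * m 1 - r * a 2 / 2) = \<rho> * \<theta> - r"
      unfolding \<mu>[symmetric] using a_pos[of 2] k by (simp add: right_diff_distrib)
    ultimately have "\<rho> * \<theta> - r \<le> 2 / a 2 * (D * (\<rho> * \<theta>) ^ 2)" by simp
    then show ?thesis using rb by (simp add: E2_def power_mult_distrib mult.assoc)
  qed
  define Rm where "Rm = \<rho> * \<Theta>"
  have RRm: "RX \<theta> \<le> Rm" "RY \<theta> \<le> Rm" if t: "\<theta> \<in> I" for \<theta>
  proof -
    have "\<rho> * \<theta> \<le> Rm" unfolding Rm_def using \<Theta>[OF t] \<rho> by (intro mult_left_mono) auto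
    then show "RX \<theta> \<le> Rm" "RY \<theta> \<le> Rm" using roots(1,2)[OF t] by linarith+
  qed
  define L where "L = Cm * exp (Rm * Cm) + (1 + B) * (1 + H)"
  have L: "0 \<le> L" using Cm HB by (simp add: L_def)
  define KX where "KX \<theta> u = exp (RX \<theta> * u) * ruin_prob (X \<theta>) u" for \<theta> u
  define KY where "KY \<theta> u = exp (RY \<theta> * u) * ruin_prob (Y \<theta>) u" for \<theta> u
  have nearX: "\<bar>KX \<theta> u - 1\<bar> \<le> \<rho> * L * \<theta>" and nearY: "\<bar>KY \<theta> u - 1\<bar> \<le> \<rho> * L * \<theta>" if t: "\<theta> \<in> I" and u: "0 \<le> u" for \<theta> u
  proof -
    have "\<bar>KX \<theta> u - 1\<bar> \<le> RX \<theta> * L" unfolding KX_def L_def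
      by (rule adjusted_model.ruin_prob_near_exp[OF AX[OF t] cX[OF t] RRm(1)[OF t] u])
    also have "\<dots> \<le> \<rho> * \<theta> * L" using roots[OF t] L by (intro mult_right_mono)
    finally show "\<bar>KX \<theta> u - 1\<bar> \<le> \<rho> * L * \<theta>" by (simp add: mult_ac)
    have "\<bar>KY \<theta> u - 1\<bar> \<le> RY \<theta> * L" unfolding KY_def L_def
      by (rule adjusted_model.ruin_prob_near_exp[OF AY[OF t] cY[OF t] RRm(2)[OF t] u])
    also have "\<dots> \<le> \<rho> * \<theta> * L" using roots[OF t] L by (intro mult_right_mono)
    finally show "\<bar>KY \<theta> u - 1\<bar> \<le> \<rho> * L * \<theta>" by (simp add: mult_ac)
  qed
  have psiX: "ruin_prob (X \<theta>) u = KX \<theta> u * exp (- RX \<theta> * u)" and psiY: "ruin_prob (Y \<theta>) u = KY \<theta> u * exp (- RY \<theta> * u)" for \<theta> u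
    by (simp_all add: KX_def KY_def exp_minus)
  define Rmin where "Rmin \<theta> = min (RX \<theta>) (RY \<theta>)" for \<theta>
  define err where "err u \<theta> = (ruin_prob (X \<theta>) u - ruin_prob (Y \<theta>) u) * exp (Rmin \<theta> * u)" for u \<theta>
  define C0 where "C0 = 2 * \<rho> * L + E1"
  have C0: "0 \<le> C0" using \<rho> L E by (simp add: C0_def)
  have nonneg: "0 \<le> \<theta> + \<theta> ^ k * u" if "\<theta> \<in> I" "0 \<le> u" for \<theta> u using \<theta>_pos[OF that(1)] that(2) by simp
  have err_bound: "\<bar>err u \<theta>\<bar> \<le> C0 * \<bar>\<theta> + \<theta> ^ k * u\<bar>" if t: "\<theta> \<in> I" and u: "0 \<le> u" for u \<theta>
  proof -
    have "\<bar>ruin_prob (X \<theta>) u - ruin_prob (Y \<theta>) u\<bar> \<le> (2 * (\<rho> * L * \<theta>) + \<bar>RX \<theta> - RY \<theta>\<bar> * u) * exp (- (Rmin \<theta> * u))"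
      unfolding psiX psiY Rmin_def by (rule exp_decay_difference[OF nearX[OF t u] nearY[OF t u] u])
    then have "\<bar>err u \<theta>\<bar> \<le> (2 * (\<rho> * L * \<theta>) + \<bar>RX \<theta> - RY \<theta>\<bar> * u) * exp (- (Rmin \<theta> * u)) * exp (Rmin \<theta> * u)"
      unfolding err_def abs_mult by (simp add: mult_right_mono)
    also have "\<dots> = 2 * (\<rho> * L * \<theta>) + \<bar>RX \<theta> - RY \<theta>\<bar> * u" by (simp add: mult.assoc exp_add[symmetric])
    also have "\<dots> \<le> 2 * (\<rho> * L * \<theta>) + E1 * \<theta> ^ k * u" using roots(3)[OF t] u by (intro add_left_mono mult_right_mono)
    also have "\<dots> \<le> C0 * (\<theta> + \<theta> ^ k * u)"
    proof -
      have "0 \<le> E1 * \<theta>" "0 \<le> 2 * \<rho> * L * (\<theta> ^ k * u)" using E \<rho> L \<theta>_pos[OF t] u by auto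
      then show ?thesis by (simp add: C0_def algebra_simps)
    qed
    finally show ?thesis using nonneg[OF t u] by simp
  qed
  have err_O: "unif_bigo I err (\<lambda>u \<theta>. \<theta> + \<theta> ^ k * u)"
    unfolding unif_bigo_def using C0 err_bound by blast
  have err_eq: "ruin_prob (X \<theta>) u - ruin_prob (Y \<theta>) u = err u \<theta> * exp (- (Rmin \<theta> * u))" for u \<theta>
    by (simp add: err_def mult.assoc exp_add[symmetric])
  define b where "b u \<theta> = Rmin \<theta> - \<rho> * \<theta>" for u :: real and \<theta>
  have b_O: "unif_bigo I b (\<lambda>u \<theta>. \<theta> ^ 2)"
    unfolding unif_bigo_def b_def Rmin_def using E second by (intro exI[of _ E2]) (auto simp: min_def)
  have second_form: "ruin_prob (X \<theta>) u - ruin_prob (Y \<theta>) u =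
      err u \<theta> * exp (- (\<bar>2 * claim_moment (X \<theta>) 1 / claim_moment (X \<theta>) 2 * \<theta> + b u \<theta>\<bar> * u))" if t: "\<theta> \<in> I" for u \<theta>
  proof -
    have "2 * claim_moment (X \<theta>) 1 / claim_moment (X \<theta>) 2 * \<theta> + b u \<theta> = Rmin \<theta>"
      unfolding mX[OF t] b_def \<rho>_def by simp
    moreover have "0 < Rmin \<theta>" using R_pos[OF t] by (simp add: Rmin_def)
    ultimately show ?thesis using err_eq[of \<theta> u] by simp
  qed
  \<comment> \<open>The integral of \<open>1 - F\<close> is the common value of \<open>mean_excess\<close> for all \<open>\<theta>\<close>, as the claim law does not vary.\<close>
  define e0 where "e0 = exp (- (Rm * Cm)) * (lam / Cm * (\<integral>x. (1 - F x) * indicator {2 * ((1 + B) * (1 + H))<..} x \<partial>lborel) / 2)"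
  have KX_ge: "e0 \<le> KX \<theta> u" if t: "\<theta> \<in> I" and u: "0 \<le> u" for \<theta> u
  proof -
    interpret Xt: adjusted_model "X \<theta>" k "RX \<theta>" H B by (rule AX[OF t])
    have "Xt.mean_excess v = (\<integral>x. (1 - F x) * indicator {v<..} x \<partial>lborel)" for v
      unfolding Xt.mean_excess_def Xt.tail_eq_cdf cdf_fixed[OF t] ..
    then show ?thesis
      using Xt.ruin_prob_bounded_below[OF cX[OF t] RRm(1)[OF t] u] unfolding e0_def KX_def intensity_fixed[OF t] by simp
  qed
  have e0: "0 < e0"
  proof -
    interpret Xt: adjusted_model "X \<theta>0" k "RX \<theta>0" H B by (rule AX[OF \<theta>0])
    have "Xt.mean_excess v = (\<integral>x. (1 - F x) * indicator {v<..} x \<partial>lborel)" for v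
      unfolding Xt.mean_excess_def Xt.tail_eq_cdf cdf_fixed[OF \<theta>0] ..
    moreover have "0 < Xt.mean_excess (2 * ((1 + B) * (1 + H)))" using HB by (intro Xt.mean_excess_pos) simp
    ultimately show ?thesis unfolding e0_def using lam Cm by simp
  qed
  define rel where "rel u \<theta> = err u \<theta> / KX \<theta> u" for u \<theta>
  \<comment> \<open>The exponent left over when \<open>exp (- Rmin * u)\<close> is divided by \<open>exp (- RX * u)\<close>; it is used only if \<open>RX > RY\<close>.\<close>
  define d where "d u \<theta> = (RX \<theta> - RY \<theta>) * u" for u \<theta>
  have rel_O: "unif_bigo I rel (\<lambda>u \<theta>. \<theta> + \<theta> ^ k * u)"
    unfolding unif_bigo_def
  proof (intro exI[of _ "C0 / e0"] conjI ballI allI impI)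
    show "0 \<le> C0 / e0" using C0 e0 by simp
    fix u \<theta> assume u: "0 \<le> (u :: real)" and t: "\<theta> \<in> I"
    have K0: "0 < KX \<theta> u" using KX_ge[OF t u] e0 by linarith
    have "\<bar>rel u \<theta>\<bar> = \<bar>err u \<theta>\<bar> / KX \<theta> u" using K0 by (simp add: rel_def)
    also have "\<dots> \<le> (C0 * \<bar>\<theta> + \<theta> ^ k * u\<bar>) / e0"
      using err_bound[OF t u] KX_ge[OF t u] e0 by (intro frac_le) auto
    finally show "\<bar>rel u \<theta>\<bar> \<le> C0 / e0 * \<bar>\<theta> + \<theta> ^ k * u\<bar>" by simp
  qed
  have d_O: "unif_bigo I d (\<lambda>u \<theta>. \<theta> ^ k * u)"
    unfolding unif_bigo_def
  proof (intro exI[of _ E1] conjI ballI allI impI E(1))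
    fix u \<theta> assume u: "0 \<le> (u :: real)" and t: "\<theta> \<in> I"
    have "\<bar>d u \<theta>\<bar> = \<bar>RX \<theta> - RY \<theta>\<bar> * u" using u by (simp add: d_def abs_mult)
    also have "\<dots> \<le> E1 * \<theta> ^ k * u" using roots(3)[OF t] u by (rule mult_right_mono)
    finally show "\<bar>d u \<theta>\<bar> \<le> E1 * \<bar>\<theta> ^ k * u\<bar>" using u \<theta>_pos[OF t] by (simp add: abs_mult)
  qed
  have rel_eq: "(ruin_prob (X \<theta>) u - ruin_prob (Y \<theta>) u) / ruin_prob (X \<theta>) u =
      rel u \<theta> * exp (d u \<theta> * (if RX \<theta> > RY \<theta> then 1 else 0))" for u \<theta>
  proof -
    have "(ruin_prob (X \<theta>) u - ruin_prob (Y \<theta>) u) / ruin_prob (X \<theta>) u = rel u \<theta> * (exp (- (Rmin \<theta> * u)) / exp (- RX \<theta> * u))"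
      unfolding err_eq by (simp add: psiX rel_def)
    also have "exp (- (Rmin \<theta> * u)) / exp (- RX \<theta> * u) = exp (d u \<theta> * (if RX \<theta> > RY \<theta> then 1 else 0))"
      by (simp add: exp_diff[symmetric] d_def Rmin_def min_def left_diff_distrib)
    finally show ?thesis .
  qed
  show ?thesis
    using err_O err_eq b_O second_form rel_O rel_eq d_O unfolding RX_def RY_def Rmin_def by blast
qed

end
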